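(* Let $\mathcal H$ be a complex infinite dimensional Hilbert space and let $\varphi$ be a star order automorphism on $\mathcal B(\mathcal H)_I$. Then $\varphi(0)=0$ and there exist a function $h:(0,\infty)\to\mathbb C$ that is bounded on any bounded subset of $(0,\infty)$ and such that $|h|$ is a bijection of $(0,\infty)$ onto itself, a constant $\alpha\in(0,\infty)$, and operators $S$ and $T$ on $\mathcal H$ which are either both unitary or both anti-unitary, such that one of the following assertions holds: (1) $\varphi(A)=\alpha S\Big(\sum_{j\in J}h(a_j)U_j\Big)T$ for all $A=\sum_{j\in J}a_jU_j\in\mathcal B(\mathcal H)_I$; (2) $\varphi(A)=\alpha S\Big(\sum_{j\in J}h(a_j)U_j^*\Big)T$ for all $A=\sum_{j\in J}a_jU_j\in\mathcal B(\mathcal H)_I$. Here $A=\sum_{j\in J}a_jU_j$ denotes the Penrose decomposition of $A$.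
   Context: $\mathcal B(\mathcal H)$ is the algebra of all bounded linear operators on $\mathcal H$. The star order on $\mathcal B(\mathcal H)$: $A\overset{*}{\leq}B$ iff $A^*A=A^*B$ and $AA^*=BA^*$. For $x,y\in\mathcal H$, $x\otimes y$ denotes the operator $z\mapsto\langle z,y\rangle x$. Operators $A,B$ are orthogonal if $A^*B=AB^*=0$. For $\mathcal A\subseteq\mathcal B(\mathcal H)$, $\sup\mathcal A$ is the least upper bound of $\mathcal A$ in $\mathcal B(\mathcal H)$ with respect to $\overset{*}{\leq}$ (when it exists). $A$ is of type 1 if $A=0$ or $A=\sup\{x\otimes y:\ x\otimes y \text{ of rank 1},\ x\otimes y\overset{*}{\leq}A\}$. $\mathcal B(\mathcal H)_I$ is the set of all type 1 operators, a poset under $\overset{*}{\leq}$. A star order automorphism on $\mathcal B(\mathcal H)_I$ is a bijection $\varphi:\mathcal B(\mathcal H)_I\to\mathcal B(\mathcal H)_I$ such that $\varphi(A)\overset{*}{\leq}\varphi(B)\Leftrightarrow A\overset{*}{\leq}B$ for all $A,B\in\mathcal B(\mathcal H)_I$ (no linearity or continuity is assumed). Penrose decomposition: every $A\in\mathcal B(\mathcal H)_I$ can be written, uniquely up to re-indexing, as $A=\sum_{j\in J}a_jU_j$ with $\{U_j\}_{j\in J}$ mutually orthogonal nonzero partial isometries and $\{a_j\}_{j\in J}$ pairwise distinct positive numbers (with $J$ empty when $A=0$). Sums over infinite index sets converge in the strong operator topology. An anti-unitary operator is a surjective conjugate-linear isometry of $\mathcal H$. *)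

theory Defs
  imports "HOL-Analysis.Analysis"
begin

section \<open>Complex Hilbert spaces\<close>

text \<open>The inner product is linear in its first argument and induces the norm; the real vector
  space structure is the restriction of the complex one, and completeness comes from
  \<^class>\<open>banach\<close>.\<close>

class complex_hilbert = banach +
  fixes scaleC :: "complex \<Rightarrow> 'a \<Rightarrow> 'a" (infixr "*\<^sub>C" 75)
    and cinner :: "'a \<Rightarrow> 'a \<Rightarrow> complex"
  assumes scaleC_add_right: "c *\<^sub>C (x + y) = c *\<^sub>C x + c *\<^sub>C y"
    and scaleC_add_left: "(c + d) *\<^sub>C x = c *\<^sub>C x + d *\<^sub>C x"
    and scaleC_scaleC: "c *\<^sub>C (d *\<^sub>C x) = (c * d) *\<^sub>C x"
    and scaleC_one: "1 *\<^sub>C x = x"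
    and scaleR_scaleC: "r *\<^sub>R x = complex_of_real r *\<^sub>C x"
    and cinner_commute: "cinner x y = cnj (cinner y x)"
    and cinner_add_left: "cinner (x + y) z = cinner x z + cinner y z"
    and cinner_scaleC_left: "cinner (c *\<^sub>C x) y = c * cinner x y"
    and cinner_self: "cinner x x = complex_of_real ((norm x)\<^sup>2)"

global_interpretation complex_vector:
  vector_space "scaleC :: complex \<Rightarrow> 'a \<Rightarrow> 'a::complex_hilbert"
  by unfold_locales
    (simp_all add: scaleC_add_right scaleC_add_left scaleC_scaleC scaleC_one)

section \<open>Bounded operators and the star order\<close>

text \<open>Operators are plain functions, so that linear and conjugate-linear maps compose freely;
  \<open>bounded_ops\<close> is $\mathcal B(\mathcal H)$.\<close>

definition bounded_ops :: "('a::complex_hilbert \<Rightarrow> 'a) set" where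
  "bounded_ops = {A. bounded_linear A \<and> (\<forall>c x. A (c *\<^sub>C x) = c *\<^sub>C A x)}"

text \<open>Only meaningful for elements of \<open>bounded_ops\<close>, where existence and uniqueness are
  guaranteed by the Riesz representation theorem.\<close>

definition cadjoint :: "('a::complex_hilbert \<Rightarrow> 'a) \<Rightarrow> ('a \<Rightarrow> 'a)" where
  "cadjoint A = (THE B. B \<in> bounded_ops \<and> (\<forall>x y. cinner (A x) y = cinner x (B y)))"

definition star_le :: "('a::complex_hilbert \<Rightarrow> 'a) \<Rightarrow> ('a \<Rightarrow> 'a) \<Rightarrow> bool" where
  "star_le A B \<longleftrightarrow>
     cadjoint A \<circ> A = cadjoint A \<circ> B \<and> A \<circ> cadjoint A = B \<circ> cadjoint A"

definition star_sup :: "('a::complex_hilbert \<Rightarrow> 'a) set \<Rightarrow> ('a \<Rightarrow> 'a) \<Rightarrow> bool" where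
  "star_sup \<A> S \<longleftrightarrow> S \<in> bounded_ops \<and> (\<forall>A\<in>\<A>. star_le A S) \<and>
     (\<forall>B\<in>bounded_ops. (\<forall>A\<in>\<A>. star_le A B) \<longrightarrow> star_le S B)"

definition outer_op :: "'a::complex_hilbert \<Rightarrow> 'a \<Rightarrow> ('a \<Rightarrow> 'a)" (infixl "\<otimes>" 70) where
  "x \<otimes> y = (\<lambda>z. cinner z y *\<^sub>C x)"

definition type_1 :: "('a::complex_hilbert \<Rightarrow> 'a) \<Rightarrow> bool" where
  "type_1 A \<longleftrightarrow> A = (\<lambda>_. 0) \<or>
     star_sup {x \<otimes> y | x y. complex_vector.dim (range (x \<otimes> y)) = 1 \<and> star_le (x \<otimes> y) A} A"

definition type_1_ops :: "('a::complex_hilbert \<Rightarrow> 'a) set" where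
  "type_1_ops = {A \<in> bounded_ops. type_1 A}"

definition star_order_automorphism ::
    "(('a::complex_hilbert \<Rightarrow> 'a) \<Rightarrow> ('a \<Rightarrow> 'a)) \<Rightarrow> bool" where
  "star_order_automorphism \<phi> \<longleftrightarrow> bij_betw \<phi> type_1_ops type_1_ops \<and>
     (\<forall>A\<in>type_1_ops. \<forall>B\<in>type_1_ops. star_le (\<phi> A) (\<phi> B) \<longleftrightarrow> star_le A B)"

section \<open>Penrose decomposition\<close>

definition orthogonal_ops :: "('a::complex_hilbert \<Rightarrow> 'a) \<Rightarrow> ('a \<Rightarrow> 'a) \<Rightarrow> bool" where
  "orthogonal_ops A B \<longleftrightarrow>
     cadjoint A \<circ> B = (\<lambda>_. 0) \<and> A \<circ> cadjoint B = (\<lambda>_. 0)"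

definition partial_isometry :: "('a::complex_hilbert \<Rightarrow> 'a) \<Rightarrow> bool" where
  "partial_isometry U \<longleftrightarrow> U \<in> bounded_ops \<and>
     (\<forall>x. (\<forall>k. U k = 0 \<longrightarrow> cinner x k = 0) \<longrightarrow> norm (U x) = norm x)"

text \<open>Unconditional convergence of a family of bounded operators, in the strong operator
  topology, to an element of \<open>bounded_ops\<close>.\<close>

definition has_sot_sum ::
    "('i \<Rightarrow> 'a::complex_hilbert \<Rightarrow> 'a) \<Rightarrow> ('a \<Rightarrow> 'a) \<Rightarrow> 'i set \<Rightarrow> bool" where
  "has_sot_sum F A J \<longleftrightarrow> A \<in> bounded_ops \<and> (\<forall>x. ((\<lambda>j. F j x) has_sum A x) J)"

text \<open>Since \<open>a\<close> is injective on \<open>J\<close>, every index set embeds into the reals: decompositions indexed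
  by sets of reals are all decompositions up to re-indexing.\<close>

definition penrose_decomposition ::
    "('a::complex_hilbert \<Rightarrow> 'a) \<Rightarrow> 'i set \<Rightarrow> ('i \<Rightarrow> real) \<Rightarrow> ('i \<Rightarrow> 'a \<Rightarrow> 'a) \<Rightarrow> bool" where
  "penrose_decomposition A J a U \<longleftrightarrow>
     (\<forall>j\<in>J. partial_isometry (U j) \<and> U j \<noteq> (\<lambda>_. 0)) \<and>
     pairwise (\<lambda>i j. orthogonal_ops (U i) (U j)) J \<and>
     (\<forall>j\<in>J. 0 < a j) \<and> inj_on a J \<and>
     has_sot_sum (\<lambda>j x. a j *\<^sub>R U j x) A J"

section \<open>Unitary and anti-unitary operators\<close>

definition unitary_op :: "('a::complex_hilbert \<Rightarrow> 'a) \<Rightarrow> bool" where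
  "unitary_op S \<longleftrightarrow>
     S \<in> bounded_ops \<and> cadjoint S \<circ> S = id \<and> S \<circ> cadjoint S = id"

definition antiunitary_op :: "('a::complex_hilbert \<Rightarrow> 'a) \<Rightarrow> bool" where
  "antiunitary_op S \<longleftrightarrow> (\<forall>x y. S (x + y) = S x + S y) \<and>
     (\<forall>c x. S (c *\<^sub>C x) = cnj c *\<^sub>C S x) \<and> (\<forall>x. norm (S x) = norm x) \<and> surj S"

end

(*
  A type 1 operator is determined by the rank one operators below it, and a rank one operator
  s (u x v) with unit vectors u, v lies below A iff A v = s u and A^* u = s v.  An automorphism
  permutes these atoms.  Two distinct atoms have a common upper bound dominating no third atom iff
  their scales s differ and both pairs of vectors are orthogonal; hence the new scale depends
  only on the old one, and the induced map on pairs of rays ([u], [v]) preserves orthogonality and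
  is independent of s.  Such a map sends pairs with a common component to pairs with a common
  component, so up to exchanging u and v (the second alternative of the theorem, obtained by
  composing with the adjoint) it is a product of two orthogonality preserving maps of rays, which
  are implemented by unitary or antiunitary operators as in Uhlhorn's version of Wigner's theorem.
  Comparing an atom with a normalized sum of two orthogonal atoms of equal scale shows that the
  remaining phase depends only on s.
*)
theory Submission
  imports Defs
begin

section \<open>Inner product spaces\<close>

text \<open>No linearity or continuity is available, so everything is read off from finite
  configurations of atoms. The compatibility relation sees orthogonality only between atoms of
  different scales; orthogonality within one scale, and equality of rays across two scales, are
  therefore tested at a further scale. Infinite dimension supplies a unit vector orthogonal to any
  finite set, which connects arbitrary pairs and removes degenerate cases. Phases are fixed through
  inner products that are nonzero and real, because at that stage the conjugation types of the two
  ray maps are not yet known to agree. The function is \<open>h s = f s * \<sigma> (\<mu> s)\<close>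
  with \<open>f\<close> the induced map of scales and \<open>\<mu>\<close> the remaining phase, so
  the constant \<alpha> can be 1. If \<open>f\<close> were unbounded on a bounded set, a diagonal
  operator with those scales would have an unbounded image. The passage from atoms to general
  operators rests on the fact that the atoms below A are the singular pairs of its Penrose
  components.\<close>

lemma cinner_add_right: "cinner x (y + z) = cinner x y + cinner x z"
  by (metis cinner_add_left cinner_commute complex_cnj_add)

lemma cinner_scaleC_right: "cinner x (c *\<^sub>C y) = cnj c * cinner x y"
  by (metis cinner_commute cinner_scaleC_left complex_cnj_mult)

lemma scaleC_zero_left [simp]: "0 *\<^sub>C x = 0"
  using complex_vector.scale_zero_left .

lemma scaleC_zero_right [simp]: "c *\<^sub>C 0 = 0"
  using complex_vector.scale_zero_right .

lemma scaleC_minus_one [simp]: "(-1) *\<^sub>C x = - x"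
  by (metis complex_vector.scale_minus_left scaleC_one)

lemma cinner_zero_left [simp]: "cinner 0 x = 0"
  using cinner_scaleC_left[of 0 0 x] by simp

lemma cinner_zero_right [simp]: "cinner x 0 = 0"
  using cinner_scaleC_right[of x 0 0] by simp

lemma cinner_minus_left: "cinner (- x) y = - cinner x y"
  using cinner_scaleC_left[of "-1" x y] by simp

lemma cinner_minus_right: "cinner x (- y) = - cinner x y"
  using cinner_scaleC_right[of x "-1" y] by simp

lemma cinner_diff_left: "cinner (x - y) z = cinner x z - cinner y z"
  using cinner_add_left[of x "-y" z] by (simp add: cinner_minus_left)

lemma cinner_diff_right: "cinner x (y - z) = cinner x y - cinner x z"
  using cinner_add_right[of x y "-z"] by (simp add: cinner_minus_right)

lemma cinner_scaleR_left: "cinner (r *\<^sub>R x) y = of_real r * cinner x y"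
  by (simp add: scaleR_scaleC cinner_scaleC_left)

lemma cinner_scaleR_right: "cinner x (r *\<^sub>R y) = of_real r * cinner x y"
  by (simp add: scaleR_scaleC cinner_scaleC_right)

lemmas cinner_algebra = cinner_add_left cinner_add_right cinner_diff_left cinner_diff_right
  cinner_minus_left cinner_minus_right cinner_scaleC_left cinner_scaleC_right
  cinner_scaleR_left cinner_scaleR_right

lemma cinner_sum_left: "cinner (sum f A) y = (\<Sum>i\<in>A. cinner (f i) y)"
  by (induction A rule: infinite_finite_induct) (simp_all add: cinner_add_left)

lemma cinner_sum_right: "cinner y (sum f A) = (\<Sum>i\<in>A. cinner y (f i))"
  by (induction A rule: infinite_finite_induct) (simp_all add: cinner_add_right)

lemma cinner_self_eq_0 [simp]: "cinner x x = 0 \<longleftrightarrow> x = 0"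
  by (simp add: cinner_self)

lemma cinner_eq_0_commute: "cinner x y = 0 \<longleftrightarrow> cinner y x = 0"
  by (metis cinner_commute complex_cnj_zero)

lemma cinner_self_unit: "norm x = 1 \<Longrightarrow> cinner x x = 1"
  by (simp add: cinner_self)

lemma norm_eq_if_cinner_self_eq: "cinner x x = cinner y y \<Longrightarrow> norm x = norm y"
  by (simp only: cinner_self of_real_eq_iff) simp

lemma norm_power2_cinner: "(norm x)\<^sup>2 = Re (cinner x x)"
  by (simp add: cinner_self)

lemma norm_scaleC [simp]: "norm (c *\<^sub>C x) = cmod c * norm x"
proof -
  have "cinner (c *\<^sub>C x) (c *\<^sub>C x) = (c * cnj c) * cinner x x"
    by (simp add: cinner_scaleC_left cinner_scaleC_right)
  also have "\<dots> = of_real ((cmod c * norm x)\<^sup>2)"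
    by (simp add: cinner_self power_mult_distrib flip: complex_norm_square)
  finally have "(norm (c *\<^sub>C x))\<^sup>2 = (cmod c * norm x)\<^sup>2"
    unfolding cinner_self of_real_eq_iff .
  then show ?thesis
    by (simp add: power2_eq_iff_nonneg)
qed

lemma cinner_eqI: "(\<And>z. cinner x z = cinner y z) \<Longrightarrow> x = y"
  by (metis cinner_diff_left cinner_self_eq_0 right_minus_eq)

lemma cinner_eqI_right: "(\<And>z. cinner z x = cinner z y) \<Longrightarrow> x = y"
  by (metis cinner_eqI cinner_commute)

lemma norm_add_power2: "(norm (x + y))\<^sup>2 = (norm x)\<^sup>2 + (norm y)\<^sup>2 + 2 * Re (cinner x y)"
proof -
  have "Re (cinner y x) = Re (cinner x y)"
    by (subst cinner_commute) simp
  then show ?thesis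
    by (simp add: norm_power2_cinner cinner_algebra)
qed

lemma cinner_Cauchy_Schwarz: "cmod (cinner x y) \<le> norm x * norm y"
proof (cases "y = 0")
  case False
  define c where "c = cinner x y / cinner y y"
  have yy: "cinner y y \<noteq> 0" "norm y > 0" using False by simp_all
  have orth: "cinner (x - c *\<^sub>C y) (c *\<^sub>C y) = 0"
    using yy by (simp add: c_def cinner_algebra)
  have "(norm x)\<^sup>2 = (norm (x - c *\<^sub>C y))\<^sup>2 + (norm (c *\<^sub>C y))\<^sup>2"
    using norm_add_power2[of "x - c *\<^sub>C y" "c *\<^sub>C y"] orth by simp
  then have "norm (c *\<^sub>C y) \<le> norm x"
    by (metis le_add_same_cancel2 norm_ge_zero power2_le_imp_le zero_le_power2)
  moreover have "cmod c = cmod (cinner x y) / (norm y)\<^sup>2"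
    by (simp add: c_def norm_divide cinner_self norm_power)
  ultimately show ?thesis
    using yy by (simp add: power2_eq_square field_simps)
qed simp

lemma bounded_linear_cinner_left: "bounded_linear (\<lambda>x. cinner x y)"
  by (rule bounded_linear_intro[where K="norm y"])
    (simp_all add: cinner_algebra scaleR_conv_of_real cinner_Cauchy_Schwarz)

lemma bounded_linear_cinner_right: "bounded_linear (\<lambda>x. cinner y x)"
  by (rule bounded_linear_intro[where K="norm y"])
    (use cinner_Cauchy_Schwarz[of y] in \<open>simp_all add: cinner_algebra scaleR_conv_of_real mult.commute\<close>)

section \<open>Lines, planes and finite spans described by orthogonality\<close>

lemma unit_multiple_cmod:
  fixes x y :: "'a::complex_hilbert"
  assumes "norm x = 1" "norm y = 1" "x = c *\<^sub>C y"
  shows "cmod c = 1"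
  using assms by simp

text \<open>The remainder of \<open>y\<close> after projection onto \<open>x\<close> is orthogonal
  to \<open>x\<close>, hence by assumption to \<open>y\<close>, hence to itself. For
  \<open>x = 0\<close> the quotient defaults to 0 and the assumption forces \<open>y = 0\<close>.
  This recovers rays from orthogonality alone.\<close>

lemma multiple_if_perp_subset:
  fixes x y :: "'a::complex_hilbert"
  assumes "\<And>z. cinner z x = 0 \<Longrightarrow> cinner z y = 0"
  obtains c where "y = c *\<^sub>C x"
proof -
  define c where "c = cinner y x / cinner x x"
  have "cinner (y - c *\<^sub>C x) x = 0"
    by (cases "x = 0") (simp_all add: c_def cinner_algebra)
  moreover from assms[OF this] have "cinner (y - c *\<^sub>C x) y = 0" .
  ultimately have "cinner (y - c *\<^sub>C x) (y - c *\<^sub>C x) = 0"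
    by (simp add: cinner_diff_right cinner_scaleC_right)
  then show thesis using that[of c] by simp
qed

text \<open>Gram-Schmidt replaces \<open>x, y\<close> by an orthogonal pair \<open>x, y'\<close>;
  the remainder \<open>r\<close> of \<open>w\<close> is orthogonal to both, hence to
  \<open>w\<close> and to itself.\<close>

lemma in_span2_if_perp_subset:
  fixes x y :: "'a::complex_hilbert"
  assumes "\<And>z. cinner z x = 0 \<Longrightarrow> cinner z y = 0 \<Longrightarrow> cinner z w = 0"
  obtains c d where "w = c *\<^sub>C x + d *\<^sub>C y"
proof -
  define c where "c = cinner y x / cinner x x"
  define y' where "y' = y - c *\<^sub>C x"
  have y'x: "cinner y' x = 0"
    by (cases "x = 0") (simp_all add: y'_def c_def cinner_algebra)
  define a where "a = cinner w x / cinner x x"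
  define b where "b = cinner w y' / cinner y' y'"
  define r where "r = w - a *\<^sub>C x - b *\<^sub>C y'"
  have rx: "cinner r x = 0"
    using y'x by (cases "x = 0") (simp_all add: r_def a_def cinner_algebra)
  have ry': "cinner r y' = 0"
    using y'x cinner_eq_0_commute[of x y']
    by (cases "y' = 0") (simp_all add: r_def b_def cinner_algebra)
  have ry: "cinner r y = 0"
    using rx ry' by (simp add: y'_def cinner_algebra)
  have "cinner r w = 0" using assms rx ry by blast
  then have "cinner r r = 0"
    using rx ry' by (subst (2) r_def) (simp add: cinner_algebra)
  then have "w = a *\<^sub>C x + b *\<^sub>C y'" by (simp add: r_def algebra_simps)
  also have "\<dots> = (a - b * c) *\<^sub>C x + b *\<^sub>C y"
    by (simp add: y'_def complex_vector.scale_left_diff_distrib complex_vector.scale_right_diff_distrib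
        scaleC_scaleC)
  finally show thesis using that by blast
qed

text \<open>Gram-Schmidt by induction: \<open>g\<close> is the part of the new vector orthogonal to
  the old ones, and \<open>g = 0\<close> is harmless since then \<open>c = 0\<close>.\<close>

lemma ex_orthogonal_remainder:
  fixes x :: "'a::complex_hilbert"
  assumes "finite E"
  shows "\<exists>y\<in>complex_vector.span E. \<forall>e\<in>E. cinner (x - y) e = 0"
  using assms
proof (induction E arbitrary: x rule: finite_induct)
  case empty
  show ?case using complex_vector.span_zero by blast
next
  case (insert e E)
  obtain p where p: "p \<in> complex_vector.span E" "\<And>d. d \<in> E \<Longrightarrow> cinner (e - p) d = 0"
    using insert.IH by blast
  obtain q where q: "q \<in> complex_vector.span E" "\<And>d. d \<in> E \<Longrightarrow> cinner (x - q) d = 0"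
    using insert.IH by blast
  define g where "g = e - p"
  define c where "c = cinner (x - q) g / cinner g g"
  have perp_span: "cinner z d = 0"
    if "\<And>d. d \<in> E \<Longrightarrow> cinner z d = 0" "d \<in> complex_vector.span E" for z d
    using that(2)
    by (induction rule: complex_vector.span_induct_alt) (simp_all add: cinner_algebra that(1))
  have sub: "complex_vector.span E \<subseteq> complex_vector.span (insert e E)"
    by (rule complex_vector.span_mono) blast
  have g: "g \<in> complex_vector.span (insert e E)"
    unfolding g_def using sub p(1)
    by (intro complex_vector.span_diff) (auto intro: complex_vector.span_base)
  have "q + c *\<^sub>C g \<in> complex_vector.span (insert e E)"
    using g q(1) sub by (intro complex_vector.span_add complex_vector.span_scale) auto
  moreover have E0: "cinner (x - (q + c *\<^sub>C g)) d = 0" if "d \<in> E" for d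
    using p(2)[OF that] q(2)[OF that] by (simp add: g_def cinner_algebra)
  moreover have "cinner (x - (q + c *\<^sub>C g)) e = 0"
  proof -
    have "cinner (x - (q + c *\<^sub>C g)) g = 0"
      by (cases "g = 0") (simp_all add: c_def cinner_algebra)
    moreover have "cinner (x - (q + c *\<^sub>C g)) p = 0"
      using perp_span[OF _ p(1)] E0 by blast
    ultimately have "cinner (x - (q + c *\<^sub>C g)) (g + p) = 0"
      by (simp add: cinner_add_right)
    then show ?thesis by (simp add: g_def)
  qed
  ultimately show ?case by (intro bexI[of _ "q + c *\<^sub>C g"]) auto
qed

text \<open>The form in which infinite dimension is used: a vector outside the span of
  \<open>E\<close> has a nonzero remainder.\<close>

lemma ex_unit_orthogonal:
  assumes "\<not> (\<exists>B :: 'a set. finite B \<and> complex_vector.span B = UNIV)" and "finite E"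
  shows "\<exists>z::'a::complex_hilbert. norm z = 1 \<and> (\<forall>e\<in>E. cinner z e = 0)"
proof -
  obtain x where x: "x \<notin> complex_vector.span E" using assms by blast
  obtain y where y: "y \<in> complex_vector.span E" "\<forall>e\<in>E. cinner (x - y) e = 0"
    using ex_orthogonal_remainder[OF assms(2)] by blast
  have "x - y \<noteq> 0" using x y(1) by auto
  then show ?thesis
    using y(2) by (intro exI[of _ "inverse (norm (x - y)) *\<^sub>R (x - y)"]) (simp add: cinner_scaleR_left)
qed

lemma ex_orthonormal_sequence:
  assumes "\<not> (\<exists>B :: 'a set. finite B \<and> complex_vector.span B = UNIV)"
  obtains e :: "nat \<Rightarrow> 'a::complex_hilbert"
  where "\<And>n. norm (e n) = 1" and "\<And>m n. m \<noteq> n \<Longrightarrow> cinner (e m) (e n) = 0"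
proof -
  have "\<exists>e. \<forall>n::nat. norm (e n :: 'a) = 1 \<and> (\<forall>m<n. cinner (e n) (e m) = 0)"
  proof (rule dependent_wellorder_choice)
    fix n :: nat and e :: "nat \<Rightarrow> 'a"
    show "\<exists>r. norm r = 1 \<and> (\<forall>m<n. cinner r (e m) = 0)"
      using ex_unit_orthogonal[OF assms, of "e ` {..<n}"] by auto
  qed auto
  then obtain e :: "nat \<Rightarrow> 'a"
    where e: "\<And>n. norm (e n) = 1" "\<And>m n. m < n \<Longrightarrow> cinner (e n) (e m) = 0" by blast
  moreover have "cinner (e m) (e n) = 0" if "m \<noteq> n" for m n
    using that e(2) cinner_eq_0_commute by (metis linorder_neqE_nat)
  ultimately show thesis using that by blast
qed

section \<open>Riesz representation and adjoints\<close>

text \<open>If \<open>f\<close> were the inner product with \<open>y\<close>, then \<open>E\<close>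
  would be the squared distance to \<open>y\<close> up to a constant. So the representing vector is
  sought as a minimizer of \<open>E\<close>, which completeness provides.\<close>

lemma Riesz_representation:
  fixes f :: "'a::complex_hilbert \<Rightarrow> complex"
  assumes bl: "bounded_linear f" and f_scaleC: "\<And>c x. f (c *\<^sub>C x) = c * f x"
  obtains y where "\<And>x. f x = cinner x y"
proof -
  interpret bounded_linear f by (fact bl)
  obtain K where K: "K > 0" "\<And>x. cmod (f x) \<le> norm x * K" using pos_bounded by blast
  define E where "E = (\<lambda>x. (norm x)\<^sup>2 - 2 * Re (f x))"
  have lower: "- K\<^sup>2 \<le> E x" for x
  proof -
    have "Re (f x) \<le> norm x * K" using K(2) complex_Re_le_cmod order_trans by blast
    moreover have "0 \<le> (norm x - K)\<^sup>2" by simp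
    ultimately show ?thesis by (simp add: E_def power2_diff)
  qed
  define m where "m = Inf (range E)"
  have bdd: "bdd_below (range E)" using lower by (intro bdd_belowI2)
  have mE: "m \<le> E x" for x unfolding m_def by (rule cInf_lower) (use bdd in auto)
  have "\<exists>x. E x < m + inverse (Suc n)" for n
  proof -
    have "Inf (range E) < m + inverse (Suc n)" by (simp add: m_def)
    then show ?thesis using bdd by (subst (asm) cInf_less_iff) auto
  qed
  then obtain X where X: "\<And>n. E (X n) < m + inverse (real (Suc n))" by metis
  \<comment> \<open>Parallelogram law for \<open>E\<close>: the linear parts cancel, so two nearly
    minimal points are close to each other.\<close>
  have par: "(norm (a - b))\<^sup>2 \<le> 2 * (E a + E b - 2 * m)" for a b
  proof -
    have eq: "(norm (a - b))\<^sup>2 = 2 * (E a + E b - 2 * E ((1/2) *\<^sub>R (a + b)))"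
    proof -
      have h: "(norm ((1/2) *\<^sub>R (a + b)))\<^sup>2 = (norm (a + b))\<^sup>2 / 4"
        by (simp only: norm_scaleR power_mult_distrib) (simp add: power2_eq_square)
      have "(norm (a + b))\<^sup>2 = (norm a)\<^sup>2 + (norm b)\<^sup>2 + 2 * Re (cinner a b)"
        "(norm (a - b))\<^sup>2 = (norm a)\<^sup>2 + (norm b)\<^sup>2 - 2 * Re (cinner a b)"
        using norm_add_power2[of a b] norm_add_power2[of a "- b"] by (simp_all add: cinner_minus_right)
      moreover have "Re (f ((1/2) *\<^sub>R (a + b))) = (Re (f a) + Re (f b)) / 2"
        by (simp only: scaleR add) simp
      ultimately show ?thesis
        unfolding E_def h by (simp add: field_simps)
    qed
    show ?thesis unfolding eq using mE[of "(1/2) *\<^sub>R (a + b)"] by simp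
  qed
  have "Cauchy X"
  proof (rule metric_CauchyI)
    fix e :: real assume e: "e > 0"
    obtain N where N: "inverse (real (Suc N)) < e\<^sup>2 / 4"
      using reals_Archimedean[of "e\<^sup>2/4"] e by auto
    have "dist (X i) (X j) < e" if "i \<ge> N" "j \<ge> N" for i j
    proof -
      have *: "E (X k) < m + e\<^sup>2 / 4" if "k \<ge> N" for k
      proof -
        have "inverse (real (Suc k)) \<le> inverse (real (Suc N))"
          using that by (simp add: le_imp_inverse_le)
        from X[of k] le_less_trans[OF this N] show ?thesis by (rule order_less_trans[OF _ add_strict_left_mono])
      qed
      have "2 * (E (X i) + E (X j) - 2 * m) < e\<^sup>2"
        using *[OF that(1)] *[OF that(2)] by (simp add: field_simps)
      then have "(norm (X i - X j))\<^sup>2 < e\<^sup>2" using par[of "X i" "X j"] by (rule le_less_trans[rotated])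
      then show ?thesis using e by (simp add: dist_norm power2_less_imp_less)
    qed
    then show "\<exists>M. \<forall>i\<ge>M. \<forall>j\<ge>M. dist (X i) (X j) < e" by blast
  qed
  then obtain y where y: "X \<longlonglongrightarrow> y" using Cauchy_convergent convergent_def by blast
  have "(\<lambda>n. E (X n)) \<longlonglongrightarrow> E y"
    unfolding E_def by (intro tendsto_intros y tendsto[OF y])
  moreover have "(\<lambda>n. m + inverse (real (Suc n))) \<longlonglongrightarrow> m + 0"
    by (intro tendsto_intros LIMSEQ_inverse_real_of_nat)
  ultimately have "E y \<le> m + 0"
    by (rule LIMSEQ_le) (use X less_imp_le in blast)
  then have min: "E y \<le> E x" for x using mE[of x] by simp
  have re: "Re (f x) = Re (cinner y x)" for x
  proof -
    define b where "b = Re (cinner y x) - Re (f x)"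
    have q: "0 \<le> t\<^sup>2 * (norm x)\<^sup>2 + 2 * t * b" for t
      using min[of "y + t *\<^sub>R x"]
      by (simp add: E_def add scaleR norm_add_power2 cinner_scaleR_right power_mult_distrib b_def algebra_simps)
    have "b = 0"
    proof (rule ccontr)
      assume "b \<noteq> 0"
      \<comment> \<open>Close to the minimizer of the quadratic in \<open>t\<close>; the added 1
        keeps the denominator nonzero for \<open>x = 0\<close> and still makes the value
        negative.\<close>
      define t where "t = - b / ((norm x)\<^sup>2 + 1)"
      have d: "(norm x)\<^sup>2 + 1 > 0" by (simp add: add_nonneg_pos)
      have tb: "b = - t * ((norm x)\<^sup>2 + 1)" using d by (simp add: t_def)
      have "t\<^sup>2 * (norm x)\<^sup>2 + 2 * t * b = - t\<^sup>2 * ((norm x)\<^sup>2 + 2)"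
        by (subst tb) (simp add: power2_eq_square algebra_simps)
      moreover have "t\<^sup>2 > 0" using \<open>b \<noteq> 0\<close> d by (simp add: t_def)
      then have "t\<^sup>2 * ((norm x)\<^sup>2 + 2) > 0" by (simp add: add_nonneg_pos)
      ultimately show False using q[of t] by linarith
    qed
    then show ?thesis by (simp add: b_def)
  qed
  have "f x = cinner x y" for x
  proof (subst cinner_commute, rule complex_eqI)
    show "Re (f x) = Re (cnj (cinner y x))" using re by simp
    show "Im (f x) = Im (cnj (cinner y x))"
      using re[of "\<i> *\<^sub>C x"] by (simp add: f_scaleC cinner_scaleC_right)
  qed
  then show thesis using that by blast
qed

section \<open>Bounded operators and their adjoints\<close>

lemma bounded_opsI:
  assumes "\<And>x y. A (x + y) = A x + A y" "\<And>c x. A (c *\<^sub>C x) = c *\<^sub>C A x" "\<And>x. norm (A x) \<le> norm x * K"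
  shows "A \<in> bounded_ops"
  unfolding bounded_ops_def using assms
  by (auto intro!: bounded_linear_intro[where K=K] simp: scaleR_scaleC)

lemma bounded_ops_bounded_linear: "A \<in> bounded_ops \<Longrightarrow> bounded_linear A"
  by (simp add: bounded_ops_def)

lemma bounded_ops_scaleC: "A \<in> bounded_ops \<Longrightarrow> A (c *\<^sub>C x) = c *\<^sub>C A x"
  by (simp add: bounded_ops_def)

lemma bounded_ops_scaleR: "A \<in> bounded_ops \<Longrightarrow> A (c *\<^sub>R x) = c *\<^sub>R A x"
  by (simp add: scaleR_scaleC bounded_ops_scaleC)

lemma bounded_ops_add: "A \<in> bounded_ops \<Longrightarrow> A (x + y) = A x + A y"
  by (simp add: bounded_ops_def linear_simps)

lemma bounded_ops_diff: "A \<in> bounded_ops \<Longrightarrow> A (x - y) = A x - A y"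
  by (simp add: bounded_ops_def linear_simps)

lemma bounded_ops_minus: "A \<in> bounded_ops \<Longrightarrow> A (- x) = - A x"
  by (simp add: bounded_ops_def linear_simps)

lemma bounded_ops_zero: "A \<in> bounded_ops \<Longrightarrow> A 0 = 0"
  by (simp add: bounded_ops_def linear_simps)

lemmas bounded_ops_linear = bounded_ops_scaleC bounded_ops_scaleR bounded_ops_add bounded_ops_diff
  bounded_ops_minus bounded_ops_zero

lemma bounded_ops_norm_le:
  assumes "A \<in> bounded_ops"
  obtains K where "K > 0" "\<And>x. norm (A x) \<le> norm x * K"
  using bounded_linear.pos_bounded[OF bounded_ops_bounded_linear[OF assms]] that by blast

lemma zero_in_bounded_ops [simp]: "(\<lambda>_. 0) \<in> bounded_ops"
  by (rule bounded_opsI[where K=0]) simp_all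

lemma scaleC_in_bounded_ops: "A \<in> bounded_ops \<Longrightarrow> (\<lambda>x. c *\<^sub>C A x) \<in> bounded_ops"
proof -
  assume A: "A \<in> bounded_ops"
  then obtain K where "K > 0" and K: "\<And>x. norm (A x) \<le> norm x * K" using bounded_ops_norm_le by metis
  show ?thesis
  proof (rule bounded_opsI[where K="cmod c * K"])
    show "norm (c *\<^sub>C A x) \<le> norm x * (cmod c * K)" for x
      using mult_left_mono[OF K[of x], of "cmod c"] by (simp add: mult_ac)
  qed (simp_all add: bounded_ops_linear[OF A] scaleC_add_right scaleC_scaleC mult.commute)
qed

lemma add_in_bounded_ops:
  "A \<in> bounded_ops \<Longrightarrow> B \<in> bounded_ops \<Longrightarrow> (\<lambda>x. A x + B x) \<in> bounded_ops"
  by (auto simp: bounded_ops_def scaleC_add_right intro: bounded_linear_add)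

lemma cadjoint_exists:
  assumes A: "A \<in> bounded_ops"
  shows "\<exists>!B. B \<in> bounded_ops \<and> (\<forall>x y. cinner (A x) y = cinner x (B y))"
proof -
  obtain K where K: "K > 0" "\<And>x. norm (A x) \<le> norm x * K" using bounded_ops_norm_le[OF A] by metis
  have "\<exists>z. \<forall>x. cinner (A x) y = cinner x z" for y
  proof -
    have "bounded_linear (\<lambda>x. cinner (A x) y)"
      using bounded_linear_compose[OF bounded_linear_cinner_left bounded_ops_bounded_linear[OF A]] .
    then show ?thesis
      by (rule Riesz_representation) (auto simp: bounded_ops_scaleC[OF A] cinner_scaleC_left)
  qed
  then obtain B where B: "\<And>x y. cinner (A x) y = cinner x (B y)" by metis
  have "B \<in> bounded_ops"
  proof (rule bounded_opsI[where K=K])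
    show "norm (B y) \<le> norm y * K" for y
    proof (cases "B y = 0")
      case False
      have "(norm (B y))\<^sup>2 = cmod (cinner (A (B y)) y)"
        by (simp add: B cinner_self norm_power)
      also have "\<dots> \<le> norm (A (B y)) * norm y" by (rule cinner_Cauchy_Schwarz)
      also have "\<dots> \<le> norm (B y) * K * norm y" by (intro mult_right_mono K(2)) simp
      finally show ?thesis using False by (simp add: power2_eq_square mult_ac)
    qed (use K in simp)
  qed (rule cinner_eqI_right, simp add: cinner_algebra flip: B)+
  moreover have "B' = B" if "\<forall>x y. cinner (A x) y = cinner x (B' y)" for B'
    by (rule ext, rule cinner_eqI_right) (simp add: B flip: that)
  ultimately show ?thesis using B by blast
qed

lemma cadjoint_in_bounded_ops: "A \<in> bounded_ops \<Longrightarrow> cadjoint A \<in> bounded_ops"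
  and cinner_cadjoint_right: "A \<in> bounded_ops \<Longrightarrow> cinner x (cadjoint A y) = cinner (A x) y"
proof -
  assume "A \<in> bounded_ops"
  then have "cadjoint A \<in> bounded_ops \<and> (\<forall>x y. cinner (A x) y = cinner x (cadjoint A y))"
    unfolding cadjoint_def by (rule theI'[OF cadjoint_exists])
  then show "cadjoint A \<in> bounded_ops" "cinner x (cadjoint A y) = cinner (A x) y"
    by simp_all
qed

lemma cinner_cadjoint_left: "A \<in> bounded_ops \<Longrightarrow> cinner (cadjoint A x) y = cinner x (A y)"
proof -
  assume A: "A \<in> bounded_ops"
  have "cinner (cadjoint A x) y = cnj (cinner (A y) x)"
    by (simp only: cinner_cadjoint_right[OF A, symmetric]) (rule cinner_commute)
  also have "\<dots> = cinner x (A y)" by (rule cinner_commute[symmetric])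
  finally show ?thesis .
qed

lemma cadjoint_eqI:
  assumes "A \<in> bounded_ops" "\<And>x y. cinner (A x) y = cinner x (B y)"
  shows "cadjoint A = B"
  by (rule ext, rule cinner_eqI_right) (simp add: cinner_cadjoint_right[OF assms(1)] assms(2))

lemma cadjoint_cadjoint [simp]: "A \<in> bounded_ops \<Longrightarrow> cadjoint (cadjoint A) = A"
  by (rule cadjoint_eqI) (simp_all add: cadjoint_in_bounded_ops cinner_cadjoint_left)

lemma cadjoint_zero [simp]: "cadjoint (\<lambda>_::'a::complex_hilbert. 0) = (\<lambda>_. 0)"
  by (rule cadjoint_eqI) simp_all

lemma cadjoint_scaleC: "A \<in> bounded_ops \<Longrightarrow> cadjoint (\<lambda>x. c *\<^sub>C A x) = (\<lambda>x. cnj c *\<^sub>C cadjoint A x)"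
  by (rule cadjoint_eqI) (simp_all add: scaleC_in_bounded_ops cinner_algebra cinner_cadjoint_right)

lemma cadjoint_add:
  "A \<in> bounded_ops \<Longrightarrow> B \<in> bounded_ops \<Longrightarrow> cadjoint (\<lambda>x. A x + B x) = (\<lambda>x. cadjoint A x + cadjoint B x)"
  by (rule cadjoint_eqI) (simp_all add: add_in_bounded_ops cinner_algebra cinner_cadjoint_right)

section \<open>Rank one operators and the star order\<close>

lemma scaleC_of_real_cancel:
  fixes x y :: "'a::complex_hilbert"
  assumes "s \<noteq> 0" "(of_real s * c) *\<^sub>C x = of_real s *\<^sub>C y"
  shows "y = c *\<^sub>C x"
  using assms complex_vector.scale_cancel_left[of "of_real s" y "c *\<^sub>C x"] by simp

lemma outer_op_in_bounded_ops: "x \<otimes> y \<in> bounded_ops"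
proof (rule bounded_opsI[where K="norm y * norm x"])
  fix z show "norm ((x \<otimes> y) z) \<le> norm z * (norm y * norm x)"
    using mult_right_mono[OF cinner_Cauchy_Schwarz[of z y], of "norm x"]
    by (simp add: outer_op_def mult_ac)
qed (simp_all add: outer_op_def cinner_algebra scaleC_add_left scaleC_scaleC)

lemma cadjoint_outer_op: "cadjoint (x \<otimes> y) = y \<otimes> x"
proof (rule cadjoint_eqI[OF outer_op_in_bounded_ops])
  fix a b
  have "cnj (cinner b x) = cinner x b" by (rule cinner_commute[symmetric])
  then show "cinner ((x \<otimes> y) a) b = cinner a ((y \<otimes> x) b)"
    by (simp add: outer_op_def cinner_algebra mult.commute)
qed

text \<open>Composition with a rank one operator leaves a single value to compare on each side, so
  the order relation says that \<open>x\<close> and \<open>y\<close> are, up to scaling, singular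
  vectors of \<open>A\<close>.\<close>

lemma star_le_outer_op_iff:
  assumes "x \<noteq> 0" "y \<noteq> 0" "A \<in> bounded_ops"
  shows "star_le (x \<otimes> y) A \<longleftrightarrow>
    cadjoint A x = cinner x x *\<^sub>C y \<and> A y = cinner y y *\<^sub>C x"
proof -
  have "cadjoint (x \<otimes> y) \<circ> (x \<otimes> y) = cadjoint (x \<otimes> y) \<circ> A \<longleftrightarrow>
      (\<forall>z. cinner z (cinner x x *\<^sub>C y) *\<^sub>C y = cinner z (cadjoint A x) *\<^sub>C y)"
    unfolding fun_eq_iff cadjoint_outer_op
    by (simp add: outer_op_def cinner_algebra cinner_cadjoint_right[OF assms(3)] cinner_self mult.commute)
  also have "\<dots> \<longleftrightarrow> cadjoint A x = cinner x x *\<^sub>C y"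
    using assms(2) cinner_eqI_right[of "cinner x x *\<^sub>C y" "cadjoint A x"] by auto
  finally have 1: "cadjoint (x \<otimes> y) \<circ> (x \<otimes> y) = cadjoint (x \<otimes> y) \<circ> A \<longleftrightarrow>
    cadjoint A x = cinner x x *\<^sub>C y" .
  have "(x \<otimes> y) \<circ> cadjoint (x \<otimes> y) = A \<circ> cadjoint (x \<otimes> y) \<longleftrightarrow>
      (\<forall>z. cinner z x *\<^sub>C (cinner y y *\<^sub>C x) = cinner z x *\<^sub>C A y)"
    unfolding fun_eq_iff cadjoint_outer_op
    by (simp add: outer_op_def cinner_algebra bounded_ops_linear[OF assms(3)] scaleC_scaleC)
  also have "\<dots> \<longleftrightarrow> A y = cinner y y *\<^sub>C x"
    using assms(1) by (auto simp del: complex_vector.scale_scale dest: spec[of _ x])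
  finally show ?thesis using 1 by (simp add: star_le_def)
qed

lemma star_le_refl: "star_le A A"
  by (simp add: star_le_def)

lemma zero_star_le: "A \<in> bounded_ops \<Longrightarrow> star_le (\<lambda>_. 0) A"
  by (auto simp: star_le_def fun_eq_iff bounded_ops_zero)

lemma star_leD:
  assumes "star_le A B"
  shows "cadjoint A (A x) = cadjoint A (B x)" "A (cadjoint A x) = B (cadjoint A x)"
  using assms by (auto simp: star_le_def fun_eq_iff)

text \<open>The first equation of each relation identifies a mixed inner product of
  \<open>A x\<close> and \<open>B x\<close> with a pure one, so the squared norm of
  \<open>A x - B x\<close> cancels.\<close>

lemma star_le_antisym:
  assumes A: "A \<in> bounded_ops" and B: "B \<in> bounded_ops" and "star_le A B" "star_le B A"
  shows "A = B"
proof
  fix x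
  have "cinner (A x - B x) (A x - B x) = 0"
    using star_leD(1)[OF assms(3), of x] star_leD(1)[OF assms(4), of x]
      cinner_cadjoint_left[OF A, of "A x" x] cinner_cadjoint_left[OF A, of "B x" x]
      cinner_cadjoint_left[OF B, of "A x" x] cinner_cadjoint_left[OF B, of "B x" x]
    by (simp add: cinner_diff_left cinner_diff_right)
  then show "A x = B x" by simp
qed

lemma star_le_zero_iff:
  assumes "A \<in> bounded_ops" shows "star_le A (\<lambda>_. 0) \<longleftrightarrow> A = (\<lambda>_. 0)"
  using star_le_antisym[OF assms zero_in_bounded_ops] zero_star_le[OF assms] star_le_refl by blast

text \<open>In each defining equation one side is self-adjoint, so taking adjoints turns the two
  equations for \<open>A, B\<close> into those for the adjoints. This symmetry reduces the second
  alternative of the theorem to the first.\<close>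

lemma star_le_cadjoint_iff:
  assumes A: "A \<in> bounded_ops" and B: "B \<in> bounded_ops"
  shows "star_le (cadjoint A) (cadjoint B) \<longleftrightarrow> star_le A B"
proof -
  have *: "star_le (cadjoint A) (cadjoint B)"
    if A: "A \<in> bounded_ops" and B: "B \<in> bounded_ops" and le: "star_le A B" for A B :: "'a \<Rightarrow> 'a"
  proof -
    note adj = cinner_cadjoint_left[OF A] cinner_cadjoint_left[OF B]
      cinner_cadjoint_right[OF A] cinner_cadjoint_right[OF B]
    have "A (cadjoint A x) = A (cadjoint B x)" for x
    proof (rule cinner_eqI_right)
      fix z
      have "cinner z (A (cadjoint A x)) = cinner (A (cadjoint A z)) x"
        by (simp only: adj flip: cinner_cadjoint_left[OF A, of z])
      also have "\<dots> = cinner (B (cadjoint A z)) x" using star_leD(2)[OF le] by simp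
      also have "\<dots> = cinner z (A (cadjoint B x))"
        by (simp only: adj(4)[symmetric] adj(1))
      finally show "cinner z (A (cadjoint A x)) = cinner z (A (cadjoint B x))" .
    qed
    moreover have "cadjoint A (A x) = cadjoint B (A x)" for x
    proof (rule cinner_eqI)
      fix z
      have "cinner (cadjoint A (A x)) z = cinner x (cadjoint A (A z))"
        by (simp only: adj)
      also have "\<dots> = cinner x (cadjoint A (B z))" using star_leD(1)[OF le] by simp
      also have "\<dots> = cinner (cadjoint B (A x)) z"
        by (simp only: adj)
      finally show "cinner (cadjoint A (A x)) z = cinner (cadjoint B (A x)) z" .
    qed
    ultimately show ?thesis using A by (auto simp: star_le_def fun_eq_iff)
  qed
  show ?thesis
    using *[OF A B] *[OF cadjoint_in_bounded_ops[OF A] cadjoint_in_bounded_ops[OF B]] A B by auto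
qed

section \<open>Atoms as singular values with unit singular vectors\<close>

definition atom :: "real \<Rightarrow> 'a::complex_hilbert \<Rightarrow> 'a \<Rightarrow> ('a \<Rightarrow> 'a)" where
  "atom s u v = (s *\<^sub>R u) \<otimes> v"

lemma atom_apply: "atom s u v z = (of_real s * cinner z v) *\<^sub>C u"
  by (simp add: atom_def outer_op_def scaleR_scaleC scaleC_scaleC mult.commute)

lemma atom_in_bounded_ops [simp]: "atom s u v \<in> bounded_ops"
  by (simp add: atom_def outer_op_in_bounded_ops)

lemma cadjoint_atom [simp]: "cadjoint (atom s u v) = atom s v u"
proof (rule cadjoint_eqI[OF atom_in_bounded_ops])
  fix a b
  have "cnj (cinner b u) = cinner u b" by (rule cinner_commute[symmetric])
  then show "cinner (atom s u v a) b = cinner a (atom s v u b)"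
    by (simp add: atom_apply cinner_algebra)
qed

text \<open>The outer product is linear in one factor and conjugate-linear in the other, so a common
  phase cancels. By \<open>atom_eq_atomD\<close> this is the only ambiguity in the data of an
  atom.\<close>

lemma atom_phase: "cmod c = 1 \<Longrightarrow> atom s (c *\<^sub>C u) (c *\<^sub>C v) = atom s u v"
proof -
  assume "cmod c = 1"
  then have "c * cnj c = 1" by (simp add: complex_norm_square[symmetric])
  moreover have "atom s (c *\<^sub>C u) (c *\<^sub>C v) = (\<lambda>z. ((c * cnj c) * (of_real s * cinner z v)) *\<^sub>C u)"
    by (simp add: fun_eq_iff atom_apply cinner_algebra scaleC_scaleC mult_ac)
  ultimately show ?thesis by (simp add: fun_eq_iff atom_apply)
qed

lemma atom_le_iff:
  assumes "0 < s" "norm u = 1" "norm v = 1" "A \<in> bounded_ops"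
  shows "star_le (atom s u v) A \<longleftrightarrow> A v = s *\<^sub>R u \<and> cadjoint A u = s *\<^sub>R v"
proof -
  have nz: "s *\<^sub>R u \<noteq> 0" "v \<noteq> 0" using assms by auto
  have "star_le (atom s u v) A \<longleftrightarrow>
      s *\<^sub>R cadjoint A u = s *\<^sub>R (s *\<^sub>R v) \<and> A v = s *\<^sub>R u"
    unfolding atom_def star_le_outer_op_iff[OF nz assms(4)]
    by (simp add: bounded_ops_scaleR[OF cadjoint_in_bounded_ops[OF assms(4)]] cinner_algebra
        cinner_self_unit assms scaleC_one flip: scaleR_scaleC of_real_mult)
  moreover have "s *\<^sub>R cadjoint A u = s *\<^sub>R (s *\<^sub>R v) \<longleftrightarrow> cadjoint A u = s *\<^sub>R v"
    unfolding scaleR_cancel_left using assms(1) by simp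
  ultimately show ?thesis by blast
qed

text \<open>Pairing the two singular vector equations with \<open>x\<close> and \<open>y\<close>
  gives \<open>s * c = t * d\<close> and \<open>s * d = t * c\<close> for the inner products
  \<open>c, d\<close>, hence \<open>s * s = t * t\<close>. Positivity yields \<open>s = t\<close>,
  then \<open>c = d\<close>, and this number is a phase relating both pairs of vectors. So distinct
  atoms are incomparable.\<close>

lemma atom_le_atomD:
  assumes "0 < s" "norm u = 1" "norm v = 1" "0 < t" "norm x = 1" "norm y = 1"
    and "star_le (atom s u v) (atom t x y)"
  obtains c where "t = s" "cmod c = 1" "x = c *\<^sub>C u" "y = c *\<^sub>C v"
proof -
  have 1: "(of_real t * cinner v y) *\<^sub>C x = of_real s *\<^sub>C u"
    and 2: "(of_real t * cinner u x) *\<^sub>C y = of_real s *\<^sub>C v"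
    using assms(7) by (simp_all add: atom_le_iff[OF assms(1-3)] atom_apply scaleR_scaleC)
  define d where "d = cinner v y"
  define c where "c = cinner u x"
  have "cinner (of_real s *\<^sub>C u) x = of_real t * d" "cinner (of_real s *\<^sub>C v) y = of_real t * c"
    unfolding 1[symmetric] 2[symmetric]
    by (simp_all add: cinner_algebra cinner_self_unit assms d_def c_def)
  then have sc: "of_real s * c = of_real t * d" "of_real s * d = of_real t * c"
    by (simp_all add: cinner_algebra d_def c_def)
  have "norm ((of_real t * cinner v y) *\<^sub>C x) = norm (of_real s *\<^sub>C u)" using 1 by simp
  then have "d \<noteq> 0" using assms by (auto simp: d_def)
  have "of_real s * (of_real s * c) = of_real t * (of_real t * c)" using sc by algebra
  moreover have "c \<noteq> 0" using sc \<open>d \<noteq> 0\<close> assms by auto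
  ultimately have "(of_real (s * s) :: complex) = of_real (t * t)" by (simp add: mult.assoc[symmetric])
  then have "s * s = t * t" by (simp only: of_real_eq_iff)
  then have "t = s" using assms square_eq_iff[of s t] by auto
  then have "d = c" using sc assms by simp
  have "(of_real s * c) *\<^sub>C x = of_real s *\<^sub>C u"
    using 1 unfolding d_def[symmetric] \<open>t = s\<close> \<open>d = c\<close> .
  then have u: "u = c *\<^sub>C x" by (rule scaleC_of_real_cancel[rotated]) (use assms(1) in simp)
  have "(of_real s * c) *\<^sub>C y = of_real s *\<^sub>C v"
    using 2 unfolding c_def[symmetric] \<open>t = s\<close> .
  then have v: "v = c *\<^sub>C y" by (rule scaleC_of_real_cancel[rotated]) (use assms(1) in simp)
  have c1: "cmod c = 1" using unit_multiple_cmod[OF assms(2,5) u] .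
  then have cc: "cnj c * c = 1" by (metis complex_norm_square mult.commute of_real_1 power_one)
  have "x = cnj c *\<^sub>C u" "y = cnj c *\<^sub>C v"
    by (subst u v, simp add: scaleC_scaleC cc)+
  moreover have "cmod (cnj c) = 1" using c1 by simp
  ultimately show thesis using that \<open>t = s\<close> by blast
qed

definition is_atom :: "('a::complex_hilbert \<Rightarrow> 'a) \<Rightarrow> bool" where
  "is_atom P \<longleftrightarrow> (\<exists>s u v. 0 < s \<and> norm u = 1 \<and> norm v = 1 \<and> P = atom s u v)"

lemma is_atomE:
  assumes "is_atom P"
  obtains s u v where "0 < s" "norm u = 1" "norm v = 1" "P = atom s u v"
  using assms unfolding is_atom_def by blast

lemma is_atom_cadjoint: "is_atom P \<Longrightarrow> is_atom (cadjoint P)"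
  unfolding is_atom_def by (metis cadjoint_atom)

lemma is_atom_atom: "0 < s \<Longrightarrow> norm u = 1 \<Longrightarrow> norm v = 1 \<Longrightarrow> is_atom (atom s u v)"
  unfolding is_atom_def by blast

lemma is_atom_in_bounded_ops: "is_atom P \<Longrightarrow> P \<in> bounded_ops"
  by (auto simp: is_atom_def)

lemma atom_nonzero: "is_atom P \<Longrightarrow> P \<noteq> (\<lambda>_. 0)"
proof -
  assume "is_atom P"
  then obtain s u v where P: "0 < s" "norm u = 1" "norm v = 1" "P = atom s u v"
    by (auto simp: is_atom_def)
  then have "norm (P v) = s" by (simp add: atom_apply cinner_self_unit norm_mult)
  then show ?thesis using P(1) by auto
qed

lemma atom_le_atom_imp_eq: "is_atom P \<Longrightarrow> is_atom Q \<Longrightarrow> star_le P Q \<Longrightarrow> P = Q"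
  by (elim is_atomE) (metis atom_le_atomD atom_phase)

lemma atom_eq_atomD:
  assumes "0 < s" "norm u = 1" "norm v = 1" "0 < t" "norm x = 1" "norm y = 1"
    and "atom s u v = atom t x y"
  obtains c where "t = s" "cmod c = 1" "x = c *\<^sub>C u" "y = c *\<^sub>C v"
  using atom_le_atomD[OF assms(1-6)] assms(7) star_le_refl by metis

text \<open>Up to the factor \<open>s\<close>, \<open>v\<close> lies in the range of the adjoint of
  \<open>A\<close>, where \<open>B\<close> agrees with \<open>A\<close>, and \<open>u\<close> lies
  in the range of \<open>A\<close>, where the adjoints agree.\<close>

lemma atom_le_trans:
  assumes "is_atom P" and B: "B \<in> bounded_ops" and A: "A \<in> bounded_ops"
    and "star_le P A" and le: "star_le A B"
  shows "star_le P B"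
proof -
  obtain s u v where P: "0 < s" "norm u = 1" "norm v = 1" "P = atom s u v"
    using assms(1) by (auto simp: is_atom_def)
  have Av: "A v = s *\<^sub>R u" "cadjoint A u = s *\<^sub>R v"
    using assms(4) by (simp_all add: P(4) atom_le_iff[OF P(1-3) A])
  have "s *\<^sub>R B v = s *\<^sub>R A v"
    using star_leD(2)[OF le, of u, symmetric] by (simp add: Av(2) bounded_ops_scaleR A B)
  moreover have "s *\<^sub>R cadjoint B u = s *\<^sub>R cadjoint A u"
  proof -
    have "star_le (cadjoint A) (cadjoint B)" using le A B star_le_cadjoint_iff by blast
    from star_leD(2)[OF this, of v, symmetric] show ?thesis
      by (simp add: Av(1) bounded_ops_scaleR cadjoint_in_bounded_ops A B)
  qed
  ultimately have "B v = A v" "cadjoint B u = cadjoint A u"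
    using P(1) by (simp_all only: scaleR_cancel_left) auto
  then show ?thesis by (simp add: P(4) atom_le_iff[OF P(1-3) B] Av)
qed

section \<open>Type 1 operators through the atoms below them\<close>

lemma dim_range_outer_op: "complex_vector.dim (range (x \<otimes> y)) = 1 \<longleftrightarrow> x \<noteq> 0 \<and> y \<noteq> 0"
  for x y :: "'a::complex_hilbert"
proof (cases "x = 0 \<or> y = 0")
  case True
  then have "range (x \<otimes> y) = {0}" by (auto simp: outer_op_def)
  then show ?thesis using True complex_vector.dim_eq_card_independent[OF complex_vector.independent_empty]
    by (metis card.empty complex_vector.dim_span complex_vector.span_empty zero_neq_one)
next
  case False
  have "range (x \<otimes> y) = complex_vector.span {x}"
  proof -
    have "c *\<^sub>C x \<in> range (x \<otimes> y)" for c
      using False by (intro image_eqI[of _ _ "(c / cinner y y) *\<^sub>C y"]) (simp_all add: outer_op_def cinner_algebra)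
    then show ?thesis by (auto simp: complex_vector.span_singleton outer_op_def)
  qed
  moreover have "complex_vector.independent {x}"
    using False complex_vector.dependent_single by blast
  ultimately show ?thesis using False
    by (metis complex_vector.dim_eq_card_independent complex_vector.dim_span card_1_singleton_iff is_singletonI is_singleton_altdef)
qed

lemma rank_one_ops_eq_atoms:
  "{x \<otimes> y | x y. complex_vector.dim (range (x \<otimes> y)) = 1 \<and> star_le (x \<otimes> y) A} =
   {P. is_atom P \<and> star_le P A}"
proof -
  have "is_atom (x \<otimes> y)" if "x \<noteq> 0" "y \<noteq> 0" for x y :: 'a
  proof -
    have "x \<otimes> y = atom (norm x * norm y) (inverse (norm x) *\<^sub>R x) (inverse (norm y) *\<^sub>R y)"
      using that by (simp add: fun_eq_iff atom_apply outer_op_def scaleR_scaleC scaleC_scaleC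
          cinner_algebra field_simps)
    then show ?thesis
      using that is_atom_atom[of "norm x * norm y" "inverse (norm x) *\<^sub>R x" "inverse (norm y) *\<^sub>R y"]
      by simp
  qed
  moreover have "\<exists>x y. P = x \<otimes> y \<and> x \<noteq> 0 \<and> y \<noteq> 0" if "is_atom P" for P :: "'a \<Rightarrow> 'a"
  proof -
    from that obtain s u v where "0 < s" "norm u = 1" "norm v = 1" "P = atom s u v"
      by (rule is_atomE)
    then have "P = (s *\<^sub>R u) \<otimes> v" "s *\<^sub>R u \<noteq> 0" "v \<noteq> 0" by (auto simp: atom_def)
    then show ?thesis by blast
  qed
  ultimately show ?thesis
    unfolding dim_range_outer_op by (intro set_eqI) (unfold mem_Collect_eq, metis)
qed

text \<open>\<open>A\<close> bounds the atoms below it by construction, so leastness is the whole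
  condition; the zero operator satisfies it because it lies below every operator.\<close>

lemma type_1_iff:
  assumes "A \<in> bounded_ops"
  shows "type_1 A \<longleftrightarrow>
    (\<forall>C\<in>bounded_ops. (\<forall>P. is_atom P \<longrightarrow> star_le P A \<longrightarrow> star_le P C) \<longrightarrow> star_le A C)"
  using zero_star_le assms unfolding type_1_def star_sup_def rank_one_ops_eq_atoms by blast

lemma type_1_opsD:
  assumes "A \<in> type_1_ops" "C \<in> bounded_ops" "\<And>P. is_atom P \<Longrightarrow> star_le P A \<Longrightarrow> star_le P C"
  shows "star_le A C"
  using assms type_1_iff unfolding type_1_ops_def by blast

lemma type_1_opsI:
  assumes "A \<in> bounded_ops"
    and "\<And>C. C \<in> bounded_ops \<Longrightarrow> (\<And>P. is_atom P \<Longrightarrow> star_le P A \<Longrightarrow> star_le P C) \<Longrightarrow> star_le A C"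
  shows "A \<in> type_1_ops"
  using assms type_1_iff unfolding type_1_ops_def by blast

lemma type_1_ops_bounded: "A \<in> type_1_ops \<Longrightarrow> A \<in> bounded_ops"
  by (simp add: type_1_ops_def)

lemma zero_in_type_1_ops [simp]: "(\<lambda>_. 0) \<in> type_1_ops"
  by (simp add: type_1_ops_def type_1_def)

lemma is_atom_in_type_1_ops: "is_atom P \<Longrightarrow> P \<in> type_1_ops"
  by (rule type_1_opsI) (auto simp: is_atom_in_bounded_ops star_le_refl)

lemma type_1_ops_eqI:
  assumes "A \<in> type_1_ops" "B \<in> type_1_ops"
    and "\<And>P. is_atom P \<Longrightarrow> star_le P A \<longleftrightarrow> star_le P B"
  shows "A = B"
proof (rule star_le_antisym)
  show A: "A \<in> bounded_ops" and B: "B \<in> bounded_ops"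
    using assms by (simp_all add: type_1_ops_bounded)
  show "star_le A B" "star_le B A"
    using type_1_opsD[OF assms(1) B] type_1_opsD[OF assms(2) A] assms(3) by blast+
qed

lemma ex_atom_le:
  assumes "A \<in> type_1_ops" "A \<noteq> (\<lambda>_. 0)"
  obtains P where "is_atom P" "star_le P A"
  using type_1_opsD[OF assms(1) zero_in_bounded_ops] assms star_le_zero_iff[OF type_1_ops_bounded] by blast

lemma cadjoint_in_type_1_ops:
  assumes "A \<in> type_1_ops" shows "cadjoint A \<in> type_1_ops"
proof (rule type_1_opsI)
  have A: "A \<in> bounded_ops" using assms by (rule type_1_ops_bounded)
  then show "cadjoint A \<in> bounded_ops" by (rule cadjoint_in_bounded_ops)
  fix C assume C: "C \<in> bounded_ops"
    and le: "\<And>P. is_atom P \<Longrightarrow> star_le P (cadjoint A) \<Longrightarrow> star_le P C"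
  have "star_le A (cadjoint C)"
  proof (rule type_1_opsD[OF assms cadjoint_in_bounded_ops[OF C]])
    fix P :: "'a \<Rightarrow> 'a" assume P: "is_atom P" "star_le P A"
    have "is_atom (cadjoint P)" using P(1) by (rule is_atom_cadjoint)
    moreover have "star_le (cadjoint P) (cadjoint A)"
      using P A is_atom_in_bounded_ops star_le_cadjoint_iff by blast
    ultimately have "star_le (cadjoint P) C" using le by blast
    then show "star_le P (cadjoint C)"
      using star_le_cadjoint_iff[OF cadjoint_in_bounded_ops C, of P]
      by (simp add: is_atom_in_bounded_ops P(1) C)
  qed
  then show "star_le (cadjoint A) C"
    using star_le_cadjoint_iff[OF A cadjoint_in_bounded_ops[OF C]] C by simp
qed

section \<open>Pairs of atoms with a common upper bound\<close>

text \<open>The matrix entries of \<open>C\<close> between the two singular pairs can be computed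
  from either side, which gives two linear relations between the inner products, with
  \<open>s\<close> and \<open>t\<close> exchanged. The equal scale case later determines phases, the
  other one orthogonality.\<close>

lemma common_upper_bound_cinner:
  assumes "C \<in> bounded_ops"
    and "0 < s" "norm u = 1" "norm v = 1" "0 < t" "norm x = 1" "norm y = 1"
    and "star_le (atom s u v) C" "star_le (atom t x y) C"
  shows "s = t \<Longrightarrow> cinner u x = cinner v y" "s \<noteq> t \<Longrightarrow> cinner u x = 0 \<and> cinner v y = 0"
proof -
  have C: "C v = s *\<^sub>R u" "cadjoint C u = s *\<^sub>R v" "C y = t *\<^sub>R x" "cadjoint C x = t *\<^sub>R y"
    using assms by (simp_all add: atom_le_iff)
  have 1: "of_real s * cinner u x = of_real t * cinner v y"
    using cinner_cadjoint_right[OF assms(1), of v x] by (simp add: C cinner_algebra)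
  have 2: "of_real t * cinner u x = of_real s * cinner v y"
    using cinner_cadjoint_left[OF assms(1), of u y] by (simp add: C cinner_algebra)
  show "s = t \<Longrightarrow> cinner u x = cinner v y" using 1 assms(2) by simp
  assume "s \<noteq> t"
  then have "s * s \<noteq> t * t" using assms(2,5) square_eq_iff[of s t] by auto
  then have "(of_real (s * s) :: complex) \<noteq> of_real (t * t)" by (simp only: of_real_eq_iff not_False_eq_True)
  moreover have "of_real (s * s) * cinner v y = of_real (t * t) * cinner v y"
    using 1 2 by simp algebra
  ultimately have "cinner v y = 0" by simp
  then show "cinner u x = 0 \<and> cinner v y = 0" using 1 assms(2) by simp
qed

text \<open>The singular vectors of \<open>C\<close> for one singular value form a subspace, on
  which \<open>C\<close> is \<open>s\<close> times an isometry.\<close>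

lemma combined_atom_le:
  assumes C: "C \<in> bounded_ops"
    and s: "0 < s" "norm u = 1" "norm v = 1" "norm x = 1" "norm y = 1"
    and le: "star_le (atom s u v) C" "star_le (atom s x y) C"
    and w: "norm (a *\<^sub>C v + b *\<^sub>C y) = 1"
  shows "norm (a *\<^sub>C u + b *\<^sub>C x) = 1" "star_le (atom s (a *\<^sub>C u + b *\<^sub>C x) (a *\<^sub>C v + b *\<^sub>C y)) C"
proof -
  have C': "C v = s *\<^sub>R u" "cadjoint C u = s *\<^sub>R v" "C y = s *\<^sub>R x" "cadjoint C x = s *\<^sub>R y"
    using assms by (simp_all add: atom_le_iff)
  define w where "w = a *\<^sub>C v + b *\<^sub>C y"
  define z where "z = a *\<^sub>C u + b *\<^sub>C x"
  have Cw: "C w = s *\<^sub>R z" "cadjoint C z = s *\<^sub>R w"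
    by (simp_all add: w_def z_def bounded_ops_linear[OF C] bounded_ops_linear[OF cadjoint_in_bounded_ops[OF C]]
        C' complex_vector.scale_right_distrib mult.commute scaleR_scaleC)
  have "of_real s * cinner z z = of_real s * cinner w w"
    using cinner_cadjoint_right[OF C, of w z, symmetric] by (simp add: Cw cinner_algebra)
  then have "norm z = 1"
    using s(1) w norm_eq_if_cinner_self_eq[of z w] by (simp add: w_def)
  then show "norm (a *\<^sub>C u + b *\<^sub>C x) = 1" "star_le (atom s (a *\<^sub>C u + b *\<^sub>C x) (a *\<^sub>C v + b *\<^sub>C y)) C"
    using w Cw s(1) C by (simp_all add: atom_le_iff z_def w_def)
qed

text \<open>The normalized sum of the two singular pairs is again one. It is new because
  \<open>v\<close> and \<open>y\<close> are independent: \<open>C\<close> would carry a dependence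
  over to \<open>u\<close> and \<open>x\<close> with the same factor, and a common phase does not
  change an atom.\<close>

lemma third_atom_le:
  assumes C: "C \<in> bounded_ops"
    and s: "0 < s" "norm u = 1" "norm v = 1" "norm x = 1" "norm y = 1"
    and le: "star_le (atom s u v) C" "star_le (atom s x y) C" and ne: "atom s u v \<noteq> atom s x y"
  obtains P where "is_atom P" "star_le P C" "P \<noteq> atom s u v" "P \<noteq> atom s x y"
proof -
  have C': "C v = s *\<^sub>R u" "C y = s *\<^sub>R x" using assms by (simp_all add: atom_le_iff)
  have indep: False if "y = c *\<^sub>C v" for c
  proof -
    have "s *\<^sub>R x = s *\<^sub>R (c *\<^sub>C u)"
      using C' by (simp add: that bounded_ops_linear[OF C] scaleR_scaleC mult.commute)
    then have "x = c *\<^sub>C u" using s(1) by simp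
    moreover have "cmod c = 1" using that s by simp
    ultimately show False using ne that atom_phase by metis
  qed
  have indep': False if "v = c *\<^sub>C y" for c
  proof -
    have "c \<noteq> 0" using that s by auto
    then have "y = inverse c *\<^sub>C v" by (simp add: that)
    then show False using indep by blast
  qed
  define r where "r = complex_of_real (inverse (norm (v + y)))"
  have "v + y \<noteq> 0" using indep[of "-1"] by (auto simp: add_eq_0_iff)
  then have w: "norm (r *\<^sub>C v + r *\<^sub>C y) = 1" and r: "r \<noteq> 0"
    by (simp_all add: r_def scaleC_add_right[symmetric] norm_inverse del: scaleC_add_right)
  note P = combined_atom_le[OF C s le w]
  have "atom s (r *\<^sub>C u + r *\<^sub>C x) (r *\<^sub>C v + r *\<^sub>C y) \<noteq> atom s u v"
  proof
    assume "atom s (r *\<^sub>C u + r *\<^sub>C x) (r *\<^sub>C v + r *\<^sub>C y) = atom s u v"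
    then obtain c where "r *\<^sub>C v + r *\<^sub>C y = c *\<^sub>C v"
      using atom_eq_atomD[OF s(1-3) s(1) P(1) w] by metis
    then have "r *\<^sub>C y = (c - r) *\<^sub>C v"
      by (simp add: complex_vector.scale_left_diff_distrib eq_diff_eq add.commute)
    then have "inverse r *\<^sub>C (r *\<^sub>C y) = inverse r *\<^sub>C ((c - r) *\<^sub>C v)" by simp
    then have "y = (inverse r * (c - r)) *\<^sub>C v" using r by simp
    then show False by (rule indep)
  qed
  moreover have "atom s (r *\<^sub>C u + r *\<^sub>C x) (r *\<^sub>C v + r *\<^sub>C y) \<noteq> atom s x y"
  proof
    assume "atom s (r *\<^sub>C u + r *\<^sub>C x) (r *\<^sub>C v + r *\<^sub>C y) = atom s x y"
    then obtain c where "r *\<^sub>C v + r *\<^sub>C y = c *\<^sub>C y"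
      using atom_eq_atomD[OF s(1,4,5) s(1) P(1) w] by metis
    then have "r *\<^sub>C v = (c - r) *\<^sub>C y"
      by (simp add: complex_vector.scale_left_diff_distrib eq_diff_eq)
    then have "inverse r *\<^sub>C (r *\<^sub>C v) = inverse r *\<^sub>C ((c - r) *\<^sub>C y)" by simp
    then have "v = (inverse r * (c - r)) *\<^sub>C y" using r by simp
    then show False by (rule indep')
  qed
  ultimately show thesis using that is_atom_atom[OF s(1) P(1) w] P(2) by blast
qed

text \<open>Any bound \<open>D\<close> of both atoms acts like \<open>C\<close> on the four singular
  vectors, so the sum is least. For different scales, an atom of scale \<open>r\<close> below
  \<open>C\<close> is orthogonal to every summand whose scale differs from \<open>r\<close>; hence
  \<open>C\<close> acts on it as a single summand, or as zero.\<close>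

lemma sum_of_orthogonal_atoms:
  assumes s: "0 < s" "norm u = 1" "norm v = 1" and t: "0 < t" "norm x = 1" "norm y = 1"
    and orth: "cinner u x = 0" "cinner v y = 0"
  defines "C \<equiv> \<lambda>z. atom s u v z + atom t x y z"
  shows "C \<in> type_1_ops" "star_le (atom s u v) C" "star_le (atom t x y) C"
    and "\<And>P. s \<noteq> t \<Longrightarrow> is_atom P \<Longrightarrow> star_le P C \<Longrightarrow> P = atom s u v \<or> P = atom t x y"
proof -
  have orth': "cinner x u = 0" "cinner y v = 0" using orth cinner_eq_0_commute by auto
  have C: "C \<in> bounded_ops" unfolding C_def by (intro add_in_bounded_ops atom_in_bounded_ops)
  have adj: "cadjoint C = (\<lambda>z. atom s v u z + atom t y x z)"
    unfolding C_def by (simp add: cadjoint_add)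
  show le: "star_le (atom s u v) C" "star_le (atom t x y) C"
    using s t orth orth' C
    by (simp_all add: atom_le_iff adj) (simp_all add: C_def atom_apply cinner_self_unit scaleR_scaleC)
  show "C \<in> type_1_ops"
  proof (rule type_1_opsI[OF C])
    fix D assume D: "D \<in> bounded_ops" and atoms: "\<And>P. is_atom P \<Longrightarrow> star_le P C \<Longrightarrow> star_le P D"
    have "star_le (atom s u v) D" "star_le (atom t x y) D"
      using le atoms is_atom_atom s t by blast+
    then have D': "D v = s *\<^sub>R u" "cadjoint D u = s *\<^sub>R v" "D y = t *\<^sub>R x" "cadjoint D x = t *\<^sub>R y"
      using s t D by (simp_all add: atom_le_iff)
    have C': "C v = s *\<^sub>R u" "cadjoint C u = s *\<^sub>R v" "C y = t *\<^sub>R x" "cadjoint C x = t *\<^sub>R y"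
      using s t C le by (simp_all add: atom_le_iff)
    have "cinner (C z) u = cinner (D z) u" "cinner (C z) x = cinner (D z) x" for z
      by (simp_all only: cinner_cadjoint_right[OF C, symmetric] cinner_cadjoint_right[OF D, symmetric] C' D')
    then have "cadjoint C (C z) = cadjoint C (D z)" for z
      by (simp add: adj atom_apply)
    moreover have "C (cadjoint C z) = D (cadjoint C z)" for z
    proof -
      have "cadjoint C z = (of_real s * cinner z u) *\<^sub>C v + (of_real t * cinner z x) *\<^sub>C y"
        by (simp add: adj atom_apply)
      then show ?thesis by (simp only: bounded_ops_linear[OF C] bounded_ops_linear[OF D] C' D')
    qed
    ultimately show "star_le C D" by (simp add: star_le_def fun_eq_iff)
  qed
  fix P assume st: "s \<noteq> t" and P: "is_atom P" "star_le P C"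
  obtain r p q where r: "0 < r" "norm p = 1" "norm q = 1" "P = atom r p q"
    using P(1) by (auto simp: is_atom_def)
  have Cq: "C q = r *\<^sub>R p" "cadjoint C p = r *\<^sub>R q"
    using r P C by (simp_all add: atom_le_iff)
  have s_perp: "cinner p u = 0 \<and> cinner q v = 0" if "r \<noteq> s"
    using common_upper_bound_cinner(2)[OF C r(1-3) s] le P r that by blast
  have t_perp: "cinner p x = 0 \<and> cinner q y = 0" if "r \<noteq> t"
    using common_upper_bound_cinner(2)[OF C r(1-3) t] le P r that by blast
  \<comment> \<open>Proportionality of both vectors does not suffice: the two factors must be the
    same phase, which follows by pairing the first equation with \<open>a\<close>.\<close>
  have eq: "P = atom r a b"
    if "norm a = 1" "norm b = 1" and p: "p = cinner q b *\<^sub>C a" and q: "q = cinner p a *\<^sub>C b" for a b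
  proof -
    have "cinner p a = cinner q b"
      using arg_cong[OF p, of "\<lambda>p. cinner p a"] that(1) by (simp add: cinner_algebra cinner_self_unit)
    then show ?thesis
      using p q r(4) atom_phase unit_multiple_cmod[OF r(2) that(1) p] by metis
  qed
  consider "r = s" | "r = t" "r \<noteq> s" | "r \<noteq> s" "r \<noteq> t" by blast
  then show "P = atom s u v \<or> P = atom t x y"
  proof cases
    case 1
    have "(of_real s * cinner q v) *\<^sub>C u = of_real s *\<^sub>C p" "(of_real s * cinner p u) *\<^sub>C v = of_real s *\<^sub>C q"
      using Cq(1) Cq(2)[unfolded adj] t_perp 1 s(1) st by (simp_all add: C_def atom_apply scaleR_scaleC)
    then have "p = cinner q v *\<^sub>C u" "q = cinner p u *\<^sub>C v"
      using s(1) scaleC_of_real_cancel[of s] by (metis less_irrefl)+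
    then show ?thesis using eq s 1 by blast
  next
    case 2
    have "(of_real t * cinner q y) *\<^sub>C x = of_real t *\<^sub>C p" "(of_real t * cinner p x) *\<^sub>C y = of_real t *\<^sub>C q"
      using Cq(1) Cq(2)[unfolded adj] s_perp 2 t(1) by (simp_all add: C_def atom_apply scaleR_scaleC)
    then have "p = cinner q y *\<^sub>C x" "q = cinner p x *\<^sub>C y"
      using t(1) scaleC_of_real_cancel[of t] by (metis less_irrefl)+
    then show ?thesis using eq t 2 by blast
  next
    case 3
    then have "r *\<^sub>R p = 0" using Cq(1) s_perp t_perp by (simp add: C_def atom_apply)
    then show ?thesis using r by auto
  qed
qed

section \<open>Orthogonal sums and the Penrose decomposition\<close>

lemma norm_sum_orthogonal:
  fixes g :: "'i \<Rightarrow> 'a::complex_hilbert"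
  assumes "finite F" "pairwise (\<lambda>i j. cinner (g i) (g j) = 0) F"
  shows "(norm (sum g F))\<^sup>2 = (\<Sum>j\<in>F. (norm (g j))\<^sup>2)"
  using assms
proof (induction F rule: finite_induct)
  case (insert k F)
  have "cinner (g k) (sum g F) = 0"
    using insert.prems insert.hyps(2)
    by (auto simp: cinner_sum_right pairwise_insert intro!: sum.neutral)
  then have "(norm (g k + sum g F))\<^sup>2 = (norm (g k))\<^sup>2 + (norm (sum g F))\<^sup>2"
    by (simp add: norm_add_power2)
  then show ?case
    using insert by (simp add: pairwise_insert)
qed simp

text \<open>Pythagoras turns the squared distance of nested partial sums into an increment of the
  bounded monotone function \<open>q\<close>, so all finite sets beyond one that nearly attains the
  supremum have close sums.\<close>

lemma orthogonal_summable_on: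
  fixes g :: "'i \<Rightarrow> 'a::complex_hilbert"
  assumes orth: "pairwise (\<lambda>i j. cinner (g i) (g j) = 0) J"
    and bound: "\<And>F. finite F \<Longrightarrow> F \<subseteq> J \<Longrightarrow> (\<Sum>j\<in>F. (norm (g j))\<^sup>2) \<le> M"
  shows "g summable_on J"
proof -
  define \<F> where "\<F> = {F. finite F \<and> F \<subseteq> J}"
  define q where "q F = (\<Sum>j\<in>F. (norm (g j))\<^sup>2)" for F
  define L where "L = Sup (q ` \<F>)"
  have bdd: "bdd_above (q ` \<F>)"
    using bound unfolding q_def \<F>_def by (intro bdd_aboveI2) auto
  have ne: "\<F> \<noteq> {}" by (auto simp: \<F>_def)
  have qL: "q F \<le> L" if "F \<in> \<F>" for F
    unfolding L_def using bdd that by (intro cSup_upper) auto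
  have dist_sub: "(dist (sum g F) (sum g F'))\<^sup>2 = q F - q F'" if "F \<in> \<F>" "F' \<subseteq> F" for F F'
  proof -
    have fin: "finite F" using that by (simp add: \<F>_def)
    have "sum g F - sum g F' = sum g (F - F')" using fin that(2) by (simp add: sum_diff)
    moreover have "pairwise (\<lambda>i j. cinner (g i) (g j) = 0) (F - F')"
      using orth that by (auto simp: \<F>_def intro: pairwise_subset)
    ultimately have "(dist (sum g F) (sum g F'))\<^sup>2 = q (F - F')"
      using fin by (simp add: dist_norm norm_sum_orthogonal q_def)
    also have "\<dots> = q F - q F'" using fin that(2) by (simp add: q_def sum_diff)
    finally show ?thesis .
  qed
  have "\<exists>P. eventually P (finite_subsets_at_top J) \<and>
          (\<forall>F F'. P F \<and> P F' \<longrightarrow> dist (sum g F) (sum g F') < e)" if "e > 0" for e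
  proof -
    have "L - (e/2)\<^sup>2 < Sup (q ` \<F>)" using that by (simp add: L_def)
    then obtain F0 where F0: "F0 \<in> \<F>" "L - (e/2)\<^sup>2 < q F0"
      using less_cSup_iff[of "q ` \<F>"] ne bdd by auto
    have near: "dist (sum g F) (sum g F0) < e/2" if "F \<in> \<F>" "F0 \<subseteq> F" for F
    proof -
      have "(dist (sum g F) (sum g F0))\<^sup>2 < (e/2)\<^sup>2"
        using dist_sub[OF that] qL[OF that(1)] F0(2) by linarith
      then show ?thesis by (rule power2_less_imp_less) (use \<open>e > 0\<close> in simp)
    qed
    have "dist (sum g F) (sum g F') < e" if "F \<in> \<F> \<and> F0 \<subseteq> F" "F' \<in> \<F> \<and> F0 \<subseteq> F'" for F F'
      using near[of F] near[of F'] that dist_triangle2[of "sum g F" "sum g F'" "sum g F0"] by linarith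
    moreover have "eventually (\<lambda>F. F \<in> \<F> \<and> F0 \<subseteq> F) (finite_subsets_at_top J)"
      unfolding eventually_finite_subsets_at_top using F0(1)
      by (intro exI[of _ F0]) (simp add: \<F>_def)
    ultimately show ?thesis by (intro exI[of _ "\<lambda>F. F \<in> \<F> \<and> F0 \<subseteq> F"]) blast
  qed
  then have "cauchy_filter (filtermap (sum g) (finite_subsets_at_top J))"
    by (simp add: cauchy_filter_metric_filtermap)
  moreover have "complete (UNIV :: 'a set)"
    by (meson Cauchy_convergent UNIV_I complete_def convergent_def)
  ultimately obtain S where "(sum g \<longlongrightarrow> S) (finite_subsets_at_top J)"
    using complete_uniform[where S=UNIV] by (force simp add: filterlim_def)
  then show ?thesis using summable_on_def has_sum_def by blast
qed

lemma has_sum_norm_power2_le: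
  fixes g :: "'i \<Rightarrow> 'a::complex_hilbert"
  assumes orth: "pairwise (\<lambda>i j. cinner (g i) (g j) = 0) J" and sum: "(g has_sum S) J"
    and bound: "\<And>F. finite F \<Longrightarrow> F \<subseteq> J \<Longrightarrow> (\<Sum>j\<in>F. (norm (g j))\<^sup>2) \<le> M"
  shows "(norm S)\<^sup>2 \<le> M"
proof (rule tendsto_upperbound)
  show "((\<lambda>F. (norm (sum g F))\<^sup>2) \<longlongrightarrow> (norm S)\<^sup>2) (finite_subsets_at_top J)"
    using sum unfolding has_sum_def by (intro tendsto_intros)
  show "\<forall>\<^sub>F F in finite_subsets_at_top J. (norm (sum g F))\<^sup>2 \<le> M"
  proof (rule eventually_finite_subsets_at_top_weakI)
    fix F assume F: "finite F" "F \<subseteq> J"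
    then show "(norm (sum g F))\<^sup>2 \<le> M"
      using norm_sum_orthogonal[OF F(1) pairwise_subset[OF orth F(2)]] bound by metis
  qed
qed simp

lemma has_sum_single_term:
  assumes "(f has_sum S) J" "k \<in> J" "\<And>j. j \<in> J \<Longrightarrow> j \<noteq> k \<Longrightarrow> f j = 0"
  shows "S = (f k :: 'b::{topological_comm_monoid_add, t2_space})"
proof -
  have "(f has_sum S) {k}"
    using assms has_sum_cong_neutral[of "{k}" J f f S] by auto
  moreover have "(f has_sum f k) {k}" by (simp add: has_sum_finiteI)
  ultimately show ?thesis by (rule has_sum_unique)
qed

text \<open>Replaces the condition on the complement of the kernel by an algebraic identity, which
  behaves well under adjoints and under composition with unitary or antiunitary maps.\<close>

lemma partial_isometry_iff:
  assumes U: "U \<in> bounded_ops"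
  shows "partial_isometry U \<longleftrightarrow> (\<forall>x. U (cadjoint U (U x)) = U x)"
proof
  note U' = cadjoint_in_bounded_ops[OF U]
  note adj = cinner_cadjoint_left[OF U] cinner_cadjoint_right[OF U]
  assume "partial_isometry U"
  then have iso: "norm (U x) = norm x" if "\<And>k. U k = 0 \<Longrightarrow> cinner x k = 0" for x
    using that by (auto simp: partial_isometry_def)
  have fixed: "cadjoint U (U x) = x" if x: "\<And>k. U k = 0 \<Longrightarrow> cinner x k = 0" for x
  proof -
    \<comment> \<open>\<open>y\<close> is orthogonal to the kernel as well. Isometry on
      \<open>x\<close>, \<open>y\<close> and \<open>x + y\<close> gives equal real parts of inner
      products, which says that \<open>y\<close> has norm zero.\<close>
    define y where "y = cadjoint U (U x) - x"
    have y: "cinner y k = 0" if "U k = 0" for k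
      using that x by (simp add: y_def cinner_diff_left adj)
    have "norm (U (x + y)) = norm (x + y)" "norm (U x) = norm x" "norm (U y) = norm y"
      using x y by (auto intro!: iso simp: cinner_add_left)
    then have "Re (cinner (U x) (U y)) = Re (cinner x y)"
      using norm_add_power2[of x y] norm_add_power2[of "U x" "U y"] by (simp add: bounded_ops_add[OF U])
    then have "Re (cinner y y) = 0"
      by (subst (1) y_def) (simp add: cinner_diff_left adj)
    then have "y = 0" by (simp add: cinner_self)
    then show ?thesis by (simp add: y_def)
  qed
  have rng: "cadjoint U (U (cadjoint U z)) = cadjoint U z" for z
    by (rule fixed) (simp add: adj)
  show "\<forall>x. U (cadjoint U (U x)) = U x"
  proof (intro allI cinner_eqI)
    fix x z
    have "cinner (U (cadjoint U (U x))) z = cinner x (cadjoint U (U (cadjoint U z)))"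
      by (simp only: adj(2)[symmetric] adj(1))
    also have "\<dots> = cinner (U x) z" by (simp only: rng adj(2))
    finally show "cinner (U (cadjoint U (U x))) z = cinner (U x) z" .
  qed
next
  note adj = cinner_cadjoint_left[OF U] cinner_cadjoint_right[OF U]
  assume UUU: "\<forall>x. U (cadjoint U (U x)) = U x"
  have "norm (U x) = norm x" if x: "\<And>k. U k = 0 \<Longrightarrow> cinner x k = 0" for x
  proof -
    define k where "k = x - cadjoint U (U x)"
    have "U k = 0" using UUU by (simp add: k_def bounded_ops_diff[OF U])
    then have "cinner k k = 0"
      using x[of k] by (subst (1) k_def) (simp add: cinner_diff_left adj)
    then have "x = cadjoint U (U x)" by (simp add: k_def)
    then have "cinner x x = cinner (U x) (U x)" by (metis adj(1))
    then show ?thesis using norm_eq_if_cinner_self_eq by metis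
  qed
  then show "partial_isometry U" using U by (auto simp: partial_isometry_def)
qed

lemma partial_isometry_in_bounded_ops: "partial_isometry U \<Longrightarrow> U \<in> bounded_ops"
  by (simp add: partial_isometry_def)

lemma partial_isometry_cadjoint_apply:
  assumes "partial_isometry U"
  shows "U (cadjoint U (U x)) = U x" "cadjoint U (U (cadjoint U x)) = cadjoint U x"
proof -
  have U: "U \<in> bounded_ops" using assms by (rule partial_isometry_in_bounded_ops)
  show 1: "U (cadjoint U (U x)) = U x" for x using assms partial_isometry_iff[OF U] by blast
  show "cadjoint U (U (cadjoint U x)) = cadjoint U x"
  proof (rule cinner_eqI_right)
    fix z
    have "cinner z (cadjoint U (U (cadjoint U x))) = cinner (U (cadjoint U (U z))) x"
      by (simp only: cinner_cadjoint_right[OF U] cinner_cadjoint_left[OF U, symmetric])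
    also have "\<dots> = cinner z (cadjoint U x)" by (simp only: 1 cinner_cadjoint_right[OF U])
    finally show "cinner z (cadjoint U (U (cadjoint U x))) = cinner z (cadjoint U x)" .
  qed
qed

lemma partial_isometry_cadjoint: "partial_isometry U \<Longrightarrow> partial_isometry (cadjoint U)"
  using partial_isometry_iff[of "cadjoint U"] partial_isometry_cadjoint_apply(2)[of U]
  by (simp add: cadjoint_in_bounded_ops partial_isometry_in_bounded_ops)

lemma orthogonal_opsD:
  assumes "orthogonal_ops A B"
  shows "cadjoint A (B x) = 0" "A (cadjoint B x) = 0"
  using assms by (auto simp: orthogonal_ops_def fun_eq_iff)

lemma orthogonal_ops_cadjoint:
  assumes "orthogonal_ops A B" "A \<in> bounded_ops" "B \<in> bounded_ops"
  shows "orthogonal_ops (cadjoint A) (cadjoint B)"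
  using assms by (auto simp: orthogonal_ops_def)

section \<open>Orthogonal families of partial isometries\<close>

locale orthogonal_partial_isometries =
  fixes J :: "'i set" and U :: "'i \<Rightarrow> 'a::complex_hilbert \<Rightarrow> 'a"
  assumes piso: "j \<in> J \<Longrightarrow> partial_isometry (U j)"
    and orth: "pairwise (\<lambda>i j. orthogonal_ops (U i) (U j)) J"
begin

lemma bounded [simp]: "j \<in> J \<Longrightarrow> U j \<in> bounded_ops"
  using piso partial_isometry_in_bounded_ops by blast

lemma orth_apply:
  assumes "i \<in> J" "j \<in> J" "i \<noteq> j"
  shows "cadjoint (U i) (U j x) = 0" "U i (cadjoint (U j) x) = 0"
  using orthogonal_opsD pairwiseD[OF orth] assms by blast+

lemma cinner_orth:
  assumes "i \<in> J" "j \<in> J" "i \<noteq> j"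
  shows "cinner (U i x) (U j y) = 0"
  using orth_apply(1)[OF assms, of y] assms by (simp flip: cinner_cadjoint_right)

text \<open>The products of the adjoints with the \<open>U j\<close> are projections with orthogonal
  ranges. Their finite sum sends \<open>x\<close> to a vector \<open>y\<close> whose squared norm
  equals its inner product with \<open>x\<close>, so Cauchy-Schwarz gives
  \<open>norm y \<le> norm x\<close>.\<close>

lemma Bessel:
  assumes F: "finite F" "F \<subseteq> J"
  shows "(\<Sum>j\<in>F. (norm (U j x))\<^sup>2) \<le> (norm x)\<^sup>2"
proof -
  define P where "P j = cadjoint (U j) (U j x)" for j
  define y where "y = sum P F"
  define S where "S = (\<Sum>j\<in>F. (norm (U j x))\<^sup>2)"
  have PP: "(norm (P j))\<^sup>2 = (norm (U j x))\<^sup>2" if "j \<in> J" for j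
  proof -
    have "cinner (P j) (P j) = cinner (U j x) (U j x)"
      using that by (simp add: P_def cinner_cadjoint_left partial_isometry_cadjoint_apply[OF piso])
    then show ?thesis using norm_eq_if_cinner_self_eq by metis
  qed
  have "pairwise (\<lambda>i j. cinner (P i) (P j) = 0) F"
  proof (rule pairwiseI)
    fix i j assume "i \<in> F" "j \<in> F" "i \<noteq> j"
    then have "i \<in> J" "j \<in> J" "i \<noteq> j" using F(2) by auto
    then show "cinner (P i) (P j) = 0"
      by (simp add: P_def cinner_cadjoint_left orth_apply)
  qed
  then have "(norm y)\<^sup>2 = (\<Sum>j\<in>F. (norm (P j))\<^sup>2)"
    unfolding y_def by (rule norm_sum_orthogonal[OF F(1)])
  also have "\<dots> = S" unfolding S_def using PP F(2) by (intro sum.cong) auto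
  finally have yS: "(norm y)\<^sup>2 = S" .
  have "cinner y x = (\<Sum>j\<in>F. cinner (U j x) (U j x))"
    unfolding y_def cinner_sum_left P_def using F(2) by (intro sum.cong) (auto simp: cinner_cadjoint_left)
  also have "\<dots> = of_real S" by (simp add: S_def cinner_self)
  finally have "cmod (cinner y x) = S" using yS by (metis norm_of_real abs_of_nonneg zero_le_power2)
  then have "norm y * norm y \<le> norm y * norm x"
    using cinner_Cauchy_Schwarz[of y x] yS by (simp add: power2_eq_square)
  then have "norm y \<le> norm x"
    by (cases "norm y = 0") (simp_all add: mult_le_cancel_left_pos)
  then have "(norm y)\<^sup>2 \<le> (norm x)\<^sup>2" by (simp add: power_mono)
  then show ?thesis unfolding yS S_def .
qed

text \<open>Bessel's inequality makes bounded coefficients sufficient for strong convergence. This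
  yields the operators \<open>B\<close> of the theorem and also the diagonal test operator behind
  the boundedness of \<open>h\<close>.\<close>

lemma ex_sot_sum:
  assumes c: "\<And>j. j \<in> J \<Longrightarrow> cmod (c j) \<le> K" and K: "0 \<le> K"
  obtains B where "has_sot_sum (\<lambda>j x. c j *\<^sub>C U j x) B J"
proof -
  have o: "pairwise (\<lambda>i j. cinner (c i *\<^sub>C U i x) (c j *\<^sub>C U j x) = 0) J" for x
    by (rule pairwiseI) (simp add: cinner_scaleC_left cinner_scaleC_right cinner_orth)
  have b: "(\<Sum>j\<in>F. (norm (c j *\<^sub>C U j x))\<^sup>2) \<le> (norm x * K)\<^sup>2" if F: "finite F" "F \<subseteq> J" for F x
  proof -
    have "(\<Sum>j\<in>F. (norm (c j *\<^sub>C U j x))\<^sup>2) \<le> (\<Sum>j\<in>F. K\<^sup>2 * (norm (U j x))\<^sup>2)"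
      using F(2) c by (intro sum_mono) (auto simp: power_mult_distrib intro!: mult_right_mono power_mono)
    also have "\<dots> = K\<^sup>2 * (\<Sum>j\<in>F. (norm (U j x))\<^sup>2)" by (simp add: sum_distrib_left)
    also have "\<dots> \<le> K\<^sup>2 * (norm x)\<^sup>2" by (intro mult_left_mono Bessel F) simp
    finally show ?thesis by (simp add: power_mult_distrib mult.commute)
  qed
  define B where "B x = infsum (\<lambda>j. c j *\<^sub>C U j x) J" for x
  have B: "((\<lambda>j. c j *\<^sub>C U j x) has_sum B x) J" for x
    unfolding B_def by (rule has_sum_infsum, rule orthogonal_summable_on[OF o b])
  have "B \<in> bounded_ops"
  proof (rule bounded_opsI[where K=K])
    show "norm (B x) \<le> norm x * K" for x
    proof (rule power2_le_imp_le)
      show "(norm (B x))\<^sup>2 \<le> (norm x * K)\<^sup>2" by (rule has_sum_norm_power2_le[OF o B b])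
      show "0 \<le> norm x * K" using K by simp
    qed
    show "B (x + y) = B x + B y" for x y
    proof (rule has_sum_unique[OF B])
      have "((\<lambda>j. c j *\<^sub>C U j x + c j *\<^sub>C U j y) has_sum (B x + B y)) J"
        by (intro has_sum_add B)
      then show "((\<lambda>j. c j *\<^sub>C U j (x + y)) has_sum (B x + B y)) J"
        by (rule has_sum_cong[THEN iffD1, rotated]) (simp add: bounded_ops_add scaleC_add_right)
    qed
    show "B (d *\<^sub>C x) = d *\<^sub>C B x" for d x
    proof (rule has_sum_unique[OF B])
      have "bounded_linear (\<lambda>x::'a. d *\<^sub>C x)"
        by (rule bounded_linear_intro[where K="cmod d"]) (simp_all add: scaleC_add_right scaleR_scaleC mult.commute)
      from has_sum_bounded_linear[OF this B[of x]]
      show "((\<lambda>j. c j *\<^sub>C U j (d *\<^sub>C x)) has_sum (d *\<^sub>C B x)) J"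
        by (rule has_sum_cong[THEN iffD1, rotated]) (simp add: bounded_ops_scaleC mult.commute)
    qed
  qed
  then have "has_sot_sum (\<lambda>j x. c j *\<^sub>C U j x) B J" using B by (simp add: has_sot_sum_def)
  then show thesis by (rule that)
qed

end

section \<open>Atoms below an operator with given Penrose data\<close>

locale penrose =
  fixes A :: "'a::complex_hilbert \<Rightarrow> 'a" and J :: "'i set" and a :: "'i \<Rightarrow> real"
    and U :: "'i \<Rightarrow> 'a \<Rightarrow> 'a"
  assumes penrose: "penrose_decomposition A J a U"
begin

sublocale orthogonal_partial_isometries J U
  using penrose by unfold_locales (auto simp: penrose_decomposition_def)

lemma A [simp]: "A \<in> bounded_ops"
  using penrose by (simp add: penrose_decomposition_def has_sot_sum_def)

lemma pos: "j \<in> J \<Longrightarrow> 0 < a j" and nonzero: "j \<in> J \<Longrightarrow> U j \<noteq> (\<lambda>_. 0)" and inj: "inj_on a J"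
  using penrose by (auto simp: penrose_decomposition_def)

lemma A_sum: "((\<lambda>j. a j *\<^sub>R U j x) has_sum A x) J"
  using penrose by (simp add: penrose_decomposition_def has_sot_sum_def)

lemma A_sum_image:
  assumes "L \<in> bounded_ops"
  shows "((\<lambda>j. a j *\<^sub>R L (U j x)) has_sum L (A x)) J"
  using has_sum_bounded_linear[OF bounded_ops_bounded_linear[OF assms] A_sum]
  by (simp add: bounded_ops_scaleR[OF assms])

text \<open>Bounded operators apply to the series term by term, and orthogonality leaves only the
  term at \<open>k\<close>.\<close>

lemma cadjoint_U_A: "k \<in> J \<Longrightarrow> cadjoint (U k) (A x) = a k *\<^sub>R cadjoint (U k) (U k x)"
  using A_sum_image[of "cadjoint (U k)" x]
  by (rule has_sum_single_term) (simp_all add: orth_apply cadjoint_in_bounded_ops)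

lemma A_cadjoint_U: "k \<in> J \<Longrightarrow> A (cadjoint (U k) x) = a k *\<^sub>R U k (cadjoint (U k) x)"
  using A_sum[of "cadjoint (U k) x"]
  by (rule has_sum_single_term) (simp_all add: orth_apply)

lemma U_cadjoint_A: "k \<in> J \<Longrightarrow> U k (cadjoint A x) = a k *\<^sub>R U k (cadjoint (U k) x)"
proof (rule cinner_eqI)
  fix z assume k: "k \<in> J"
  have "cinner (U k (cadjoint A x)) z = cinner x (A (cadjoint (U k) z))"
    using k by (simp add: cinner_cadjoint_right[symmetric] cinner_cadjoint_left)
  also have "\<dots> = cinner (a k *\<^sub>R U k (cadjoint (U k) x)) z"
    using k by (simp add: A_cadjoint_U cinner_algebra cinner_cadjoint_left[symmetric]
        cinner_cadjoint_right[symmetric])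
  finally show "cinner (U k (cadjoint A x)) z = cinner (a k *\<^sub>R U k (cadjoint (U k) x)) z" .
qed

lemma norm_cadjoint_U: "k \<in> J \<Longrightarrow> norm (cadjoint (U k) (U k x)) = norm (U k x)"
  by (rule norm_eq_if_cinner_self_eq)
    (simp add: cinner_cadjoint_left partial_isometry_cadjoint_apply[OF piso])

text \<open>\<open>A\<close> stretches vectors in the range of the adjoint of \<open>U j\<close> by
  the factor \<open>a j\<close>, so every bound for \<open>A\<close> bounds the
  coefficients.\<close>

lemma bounded_coeff:
  obtains K where "0 < K" "\<And>j. j \<in> J \<Longrightarrow> a j \<le> K"
proof -
  obtain K where K: "K > 0" "\<And>x. norm (A x) \<le> norm x * K" using bounded_ops_norm_le[OF A] by metis
  have "a j \<le> K" if j: "j \<in> J" for j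
  proof -
    obtain x where x: "U j x \<noteq> 0" using nonzero[OF j] by (auto simp: fun_eq_iff)
    have "a j * norm (U j x) = norm (A (cadjoint (U j) (U j x)))"
      using pos[OF j] j by (simp add: A_cadjoint_U partial_isometry_cadjoint_apply[OF piso])
    also have "\<dots> \<le> norm (U j x) * K" using K(2)[of "cadjoint (U j) (U j x)"] norm_cadjoint_U[OF j] by simp
    finally show ?thesis using x by (simp add: mult.commute)
  qed
  then show thesis using that K(1) by blast
qed

text \<open>Applying \<open>U k\<close> and its adjoint to the two singular vector equations gives
  \<open>(s * s - a k * a k) *\<^sub>R U k v = 0\<close>, so \<open>v\<close> meets only a component
  of scale \<open>s\<close>. Such a component exists because \<open>A v\<close> is nonzero, and is
  unique by injectivity of \<open>a\<close>.\<close>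

lemma atom_le_iff_component:
  assumes s: "0 < s" "norm u = 1" "norm v = 1"
  shows "star_le (atom s u v) A \<longleftrightarrow> (\<exists>k\<in>J. a k = s \<and> U k v = u \<and> cadjoint (U k) u = v)"
proof
  assume "star_le (atom s u v) A"
  then have Av: "A v = s *\<^sub>R u" "cadjoint A u = s *\<^sub>R v" using s by (simp_all add: atom_le_iff)
  have Ukv: "U k v = 0" if k: "k \<in> J" "a k \<noteq> s" for k
  proof -
    have 1: "s *\<^sub>R cadjoint (U k) u = a k *\<^sub>R cadjoint (U k) (U k v)"
      using cadjoint_U_A[OF k(1), of v] k(1) by (simp add: Av bounded_ops_scaleR cadjoint_in_bounded_ops)
    have 2: "s *\<^sub>R U k v = a k *\<^sub>R U k (cadjoint (U k) u)"
      using U_cadjoint_A[OF k(1), of u] k(1) by (simp add: Av bounded_ops_scaleR)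
    have "s *\<^sub>R (s *\<^sub>R U k v) = a k *\<^sub>R U k (s *\<^sub>R cadjoint (U k) u)"
      using k(1) by (simp add: 2 bounded_ops_scaleR mult.commute)
    also have "\<dots> = (a k * a k) *\<^sub>R U k v"
      using k(1) by (simp add: 1 bounded_ops_scaleR partial_isometry_cadjoint_apply[OF piso])
    finally have "(s * s - a k * a k) *\<^sub>R U k v = 0" by (simp add: scaleR_left_diff_distrib)
    moreover have "s * s \<noteq> a k * a k" using s(1) pos[OF k(1)] k(2) square_eq_iff[of s "a k"] by auto
    ultimately show ?thesis by simp
  qed
  have "\<exists>k\<in>J. a k = s"
  proof (rule ccontr)
    assume "\<not> (\<exists>k\<in>J. a k = s)"
    then have "((\<lambda>j. a j *\<^sub>R U j v) has_sum 0) J" using Ukv by (intro has_sum_0) auto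
    then have "A v = 0" using A_sum has_sum_unique by blast
    then show False using Av s by auto
  qed
  then obtain k where k: "k \<in> J" "a k = s" by blast
  have "A v = a k *\<^sub>R U k v"
  proof (rule has_sum_single_term[OF A_sum k(1)])
    fix j assume "j \<in> J" "j \<noteq> k"
    then have "a j \<noteq> s" using inj k by (auto dest: inj_onD)
    then show "a j *\<^sub>R U j v = 0" using Ukv \<open>j \<in> J\<close> by simp
  qed
  then have u: "U k v = u" using Av k s(1) by simp
  \<comment> \<open>Two unit vectors with inner product 1 are equal; this upgrades
    \<open>U k v = u\<close> to the equation for the adjoint.\<close>
  define w where "w = cadjoint (U k) u"
  have "norm w = 1"
    using norm_cadjoint_U[OF k(1), of v] u s(2) by (simp add: w_def)
  moreover have "cinner v w = 1"
    using k u s by (simp add: w_def cinner_cadjoint_right cinner_self_unit)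
  then have "cinner w v = 1" by (subst cinner_commute) simp
  ultimately have "cinner (v - w) (v - w) = 0"
    using \<open>cinner v w = 1\<close> s by (simp add: cinner_algebra cinner_self_unit)
  then have "cadjoint (U k) u = v" by (simp add: w_def)
  then show "\<exists>k\<in>J. a k = s \<and> U k v = u \<and> cadjoint (U k) u = v" using k u by blast
next
  assume "\<exists>k\<in>J. a k = s \<and> U k v = u \<and> cadjoint (U k) u = v"
  then obtain k where k: "k \<in> J" "a k = s" "U k v = u" "cadjoint (U k) u = v" by blast
  have "A v = s *\<^sub>R u" using A_cadjoint_U[OF k(1), of u] k by simp
  moreover have "cadjoint A u = s *\<^sub>R v"
  proof (rule cinner_eqI)
    fix z
    have "cinner (cadjoint A u) z = cnj (cinner (cadjoint (U k) (A z)) v)"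
      using k(1) by (simp add: cinner_cadjoint_left k(3) cinner_commute[symmetric])
    also have "\<dots> = cnj (of_real s * cinner (U k z) (U k v))"
      using k(1) by (simp add: cadjoint_U_A cinner_algebra cinner_cadjoint_left k(2))
    also have "\<dots> = of_real s * cinner (U k v) (U k z)"
      by (simp add: cinner_commute[of "U k v"])
    also have "\<dots> = cinner (s *\<^sub>R v) z"
      using k(1) by (simp add: cinner_algebra k(3) k(4)[symmetric] cinner_cadjoint_left)
        (simp add: k)
    finally show "cinner (cadjoint A u) z = cinner (s *\<^sub>R v) z" .
  qed
  ultimately show "star_le (atom s u v) A" using s by (simp add: atom_le_iff)
qed

text \<open>The atoms below \<open>A\<close> exhaust the ranges of all \<open>U k\<close> and of
  their adjoints up to scaling, so an upper bound \<open>D\<close> agrees with \<open>A\<close>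
  there. The series for \<open>A\<close> extends this agreement to the two equations of the star
  order.\<close>

lemma type_1: "A \<in> type_1_ops"
proof (rule type_1_opsI[OF A])
  fix D assume D: "D \<in> bounded_ops" and atoms: "\<And>P. is_atom P \<Longrightarrow> star_le P A \<Longrightarrow> star_le P D"
  note D' = cadjoint_in_bounded_ops[OF D]
  note A' = cadjoint_in_bounded_ops[OF A]
  have agree: "D (cadjoint (U k) y) = A (cadjoint (U k) y) \<and> cadjoint D y = cadjoint A y"
    if k: "k \<in> J" and y: "y = U k x" for k x y
  proof (cases "y = 0")
    case True
    then show ?thesis using k D D' A' by (simp add: bounded_ops_zero cadjoint_in_bounded_ops)
  next
    case False
    define r where "r = inverse (norm y)"
    have r: "r \<noteq> 0" using False by (simp add: r_def)
    have UUy: "U k (cadjoint (U k) y) = y" using y k partial_isometry_cadjoint_apply[OF piso] by simp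
    have 1: "norm (r *\<^sub>R y) = 1" "norm (r *\<^sub>R cadjoint (U k) y) = 1"
      using False norm_cadjoint_U[OF k, of x] y by (simp_all add: r_def)
    have "star_le (atom (a k) (r *\<^sub>R y) (r *\<^sub>R cadjoint (U k) y)) A"
      unfolding atom_le_iff_component[OF pos[OF k] 1] using k UUy
      by (intro bexI[of _ k]) (simp_all add: bounded_ops_scaleR cadjoint_in_bounded_ops)
    moreover from this have "star_le (atom (a k) (r *\<^sub>R y) (r *\<^sub>R cadjoint (U k) y)) D"
      using atoms is_atom_atom pos[OF k] 1 by blast
    ultimately have "r *\<^sub>R A (cadjoint (U k) y) = r *\<^sub>R D (cadjoint (U k) y)"
      "r *\<^sub>R cadjoint A y = r *\<^sub>R cadjoint D y"
      using pos[OF k] 1 D by (simp_all add: atom_le_iff bounded_ops_scaleR D' A')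
    then show ?thesis using r by simp
  qed
  have 1: "cadjoint A (A x) = cadjoint A (D x)" for x
  proof -
    have "cadjoint A (A x) = cadjoint D (A x)" for x
    proof (rule has_sum_unique[OF A_sum_image[OF A']])
      show "((\<lambda>j. a j *\<^sub>R cadjoint A (U j x)) has_sum cadjoint D (A x)) J"
        using A_sum_image[OF D', of x]
        by (rule has_sum_cong[THEN iffD1, rotated]) (use agree in auto)
    qed
    note * = this
    show ?thesis
    proof (rule cinner_eqI_right)
      fix z
      have "cinner z (cadjoint A (A x)) = cinner (cadjoint A (A z)) x"
        by (simp add: cinner_cadjoint_left cinner_cadjoint_right)
      also have "\<dots> = cinner z (cadjoint A (D x))"
        using D by (simp add: * cinner_cadjoint_left cinner_cadjoint_right)
      finally show "cinner z (cadjoint A (A x)) = cinner z (cadjoint A (D x))" .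
    qed
  qed
  \<comment> \<open>Only the series of \<open>A\<close> is at hand, not one of its adjoint.
    Agreement is therefore moved to \<open>U k\<close> composed with the adjoints of
    \<open>D\<close> and \<open>A\<close>, summed, and brought back by inner products.\<close>
  have 2: "A (cadjoint A x) = D (cadjoint A x)" for x
  proof -
    have DU: "D (cadjoint (U k) z) = A (cadjoint (U k) z)" if k: "k \<in> J" for k z
      using agree[OF k refl, of "cadjoint (U k) z"] k partial_isometry_cadjoint_apply(2)[OF piso[OF k]] by simp
    have UD: "U k (cadjoint D z) = U k (cadjoint A z)" if k: "k \<in> J" for k z
    proof (rule cinner_eqI)
      fix y
      have "cinner (U k (cadjoint D z)) y = cinner z (D (cadjoint (U k) y))"
        using k D by (simp add: cinner_cadjoint_right[symmetric] cinner_cadjoint_left)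
      also have "\<dots> = cinner z (A (cadjoint (U k) y))" using DU k by simp
      also have "\<dots> = cinner (U k (cadjoint A z)) y"
        using k by (simp add: cinner_cadjoint_right[symmetric] cinner_cadjoint_left)
      finally show "cinner (U k (cadjoint D z)) y = cinner (U k (cadjoint A z)) y" .
    qed
    have "A (cadjoint A z) = A (cadjoint D z)" for z
    proof (rule has_sum_unique[OF A_sum])
      show "((\<lambda>j. a j *\<^sub>R U j (cadjoint A z)) has_sum A (cadjoint D z)) J"
        using A_sum by (rule has_sum_cong[THEN iffD1, rotated]) (use UD in auto)
    qed
    note * = this
    show ?thesis
    proof (rule cinner_eqI)
      fix z
      have "cinner (A (cadjoint A x)) z = cinner x (A (cadjoint A z))"
        by (simp add: cinner_cadjoint_right[symmetric] cinner_cadjoint_left)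
      also have "\<dots> = cinner (D (cadjoint A x)) z"
        using D by (simp add: * cinner_cadjoint_right[symmetric] cinner_cadjoint_left)
      finally show "cinner (A (cadjoint A x)) z = cinner (D (cadjoint A x)) z" .
    qed
  qed
  show "star_le A D" using 1 2 by (simp add: star_le_def fun_eq_iff)
qed

lemma orthogonal_partial_isometries_cadjoint:
  "orthogonal_partial_isometries J (\<lambda>j. cadjoint (U j))"
proof
  show "partial_isometry (cadjoint (U j))" if "j \<in> J" for j
    using piso[OF that] by (rule partial_isometry_cadjoint)
  show "pairwise (\<lambda>i j. orthogonal_ops (cadjoint (U i)) (cadjoint (U j))) J"
    using orth by (auto simp: pairwise_def intro: orthogonal_ops_cadjoint)
qed

text \<open>Taking adjoints is not continuous in the strong operator topology, so the series of
  adjoints is built independently and its sum is recognized through inner products.\<close>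

lemma penrose_cadjoint: "penrose_decomposition (cadjoint A) J a (\<lambda>j. cadjoint (U j))"
proof -
  interpret adj: orthogonal_partial_isometries J "\<lambda>j. cadjoint (U j)"
    by (rule orthogonal_partial_isometries_cadjoint)
  obtain K where K: "0 < K" "\<And>j. j \<in> J \<Longrightarrow> a j \<le> K" using bounded_coeff by blast
  have "cmod (of_real (a j)) \<le> K" if "j \<in> J" for j using K(2)[OF that] pos[OF that] by simp
  then obtain B where B: "has_sot_sum (\<lambda>j x. of_real (a j) *\<^sub>C cadjoint (U j) x) B J"
    using adj.ex_sot_sum[of "\<lambda>j. of_real (a j)" K] K(1) less_imp_le by blast
  have "cadjoint A = B"
  proof (rule cadjoint_eqI[OF A])
    fix x y
    have "((\<lambda>j. cinner (a j *\<^sub>R U j x) y) has_sum cinner (A x) y) J"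
      using has_sum_bounded_linear[OF bounded_linear_cinner_left A_sum] .
    moreover have "((\<lambda>j. cinner x (of_real (a j) *\<^sub>C cadjoint (U j) y)) has_sum cinner x (B y)) J"
      using B by (intro has_sum_bounded_linear[OF bounded_linear_cinner_right]) (simp add: has_sot_sum_def)
    then have "((\<lambda>j. cinner (a j *\<^sub>R U j x) y) has_sum cinner x (B y)) J"
      by (rule has_sum_cong[THEN iffD1, rotated]) (simp add: cinner_algebra cinner_cadjoint_right)
    ultimately show "cinner (A x) y = cinner x (B y)" by (rule has_sum_unique)
  qed
  then have "has_sot_sum (\<lambda>j x. a j *\<^sub>R cadjoint (U j) x) (cadjoint A) J"
    using B by (simp add: scaleR_scaleC)
  moreover have "cadjoint (U j) \<noteq> (\<lambda>_. 0)" if "j \<in> J" for j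
    using nonzero[OF that] cadjoint_cadjoint[OF bounded[OF that]] by (metis cadjoint_zero)
  ultimately show ?thesis
    unfolding penrose_decomposition_def using adj.piso adj.orth pos inj by auto
qed

end

section \<open>Orthogonality preserving maps of rays\<close>

text \<open>The parameter \<open>\<sigma>\<close> allows unitary and antiunitary operators to be
  treated by one set of computations.\<close>

definition semi_unitary :: "(complex \<Rightarrow> complex) \<Rightarrow> ('a::complex_hilbert \<Rightarrow> 'a) \<Rightarrow> bool" where
  "semi_unitary \<sigma> S \<longleftrightarrow> (\<sigma> = id \<or> \<sigma> = cnj) \<and> (\<forall>x y. S (x + y) = S x + S y) \<and>
     (\<forall>c x. S (c *\<^sub>C x) = \<sigma> c *\<^sub>C S x) \<and> (\<forall>x y. cinner (S x) (S y) = \<sigma> (cinner x y)) \<and> surj S"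

text \<open>Squares go to squares, hence the map is monotone. It fixes the rationals, and one of
  them would separate \<open>x\<close> from a different value.\<close>

lemma real_ring_hom_eq_id:
  fixes \<rho> :: "real \<Rightarrow> real"
  assumes add: "\<And>x y. \<rho> (x + y) = \<rho> x + \<rho> y" and mult: "\<And>x y. \<rho> (x * y) = \<rho> x * \<rho> y"
    and one: "\<rho> 1 = 1"
  shows "\<rho> x = x"
proof -
  have zero: "\<rho> 0 = 0" using add[of 0 0] by simp
  have minus: "\<rho> (- x) = - \<rho> x" for x using add[of x "- x"] zero by simp
  have nat: "\<rho> (of_nat n) = of_nat n" for n by (induction n) (simp_all add: zero one add)
  have int: "\<rho> (of_int k) = of_int k" for k
    by (cases k rule: int_cases2) (simp_all add: nat minus)
  have rat: "\<rho> q = q" if "q \<in> \<rat>" for q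
  proof -
    from that obtain a b :: int where q: "b > 0" "q = of_int a / of_int b" by (rule Rats_cases')
    have "\<rho> (of_int b * q) = of_int b * \<rho> q" by (simp add: mult int)
    moreover have "of_int b * q = of_int a" using q by simp
    ultimately have "\<rho> q = of_int a / of_int b" using q(1) int[of a] by (simp add: eq_divide_eq mult.commute)
    then show ?thesis by (simp only: q(2)[symmetric])
  qed
  have mono: "\<rho> x \<le> \<rho> y" if "x \<le> y" for x y
  proof -
    have "\<rho> (y - x) = \<rho> (sqrt (y - x)) * \<rho> (sqrt (y - x))" using that by (simp flip: mult)
    then have "\<rho> (y - x) \<ge> 0" by simp
    then show ?thesis using add[of "y - x" x] by simp
  qed
  show ?thesis
  proof (rule ccontr)
    assume "\<rho> x \<noteq> x"
    then consider "\<rho> x < x" | "x < \<rho> x" by linarith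
    then show False
    proof cases
      case 1
      then obtain q where "q \<in> \<rat>" "\<rho> x < q" "q < x" using Rats_dense_in_real by blast
      then show False using mono[of q x] rat[of q] by simp
    next
      case 2
      then obtain q where "q \<in> \<rat>" "x < q" "q < \<rho> x" using Rats_dense_in_real by blast
      then show False using mono[of x q] rat[of q] by simp
    qed
  qed
qed

text \<open>Commuting with conjugation keeps the real line invariant and so excludes wild
  automorphisms; what remains is the choice of a square root of -1.\<close>

lemma complex_hom_commuting_with_cnj:
  fixes \<sigma> :: "complex \<Rightarrow> complex"
  assumes add: "\<And>x y. \<sigma> (x + y) = \<sigma> x + \<sigma> y" and mult: "\<And>x y. \<sigma> (x * y) = \<sigma> x * \<sigma> y"
    and one: "\<sigma> 1 = 1" and cnj: "\<And>x. \<sigma> (cnj x) = cnj (\<sigma> x)"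
  shows "\<sigma> = id \<or> \<sigma> = cnj"
proof -
  have real: "\<sigma> (of_real r) = of_real r" for r
  proof -
    define \<rho> where "\<rho> r = Re (\<sigma> (of_real r))" for r
    have re: "\<sigma> (of_real r) = of_real (\<rho> r)" for r
      using cnj[of "of_real r"] by (simp add: \<rho>_def complex_eq_iff)
    have "\<rho> r = r"
    proof (rule real_ring_hom_eq_id)
      show "\<rho> (x + y) = \<rho> x + \<rho> y" for x y by (simp add: \<rho>_def add)
      show "\<rho> (x * y) = \<rho> x * \<rho> y" for x y
        using re[of x] re[of y] by (subst \<rho>_def) (simp add: mult)
      show "\<rho> 1 = 1" by (simp add: \<rho>_def one)
    qed
    then show ?thesis using re by simp
  qed
  have "\<sigma> \<i> * \<sigma> \<i> = -1"
    using mult[of \<i> \<i>] real[of "-1"] by simp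
  then have "(\<sigma> \<i> - \<i>) * (\<sigma> \<i> + \<i>) = 0" by (simp add: algebra_simps)
  then have i: "\<sigma> \<i> = \<i> \<or> \<sigma> \<i> = - \<i>" by (auto simp: add_eq_0_iff2)
  have "\<sigma> z = of_real (Re z) + \<sigma> \<i> * of_real (Im z)" for z
    by (subst complex_eq) (simp only: add mult real)
  note z = this
  show ?thesis
  proof (rule disjE[OF i])
    assume "\<sigma> \<i> = \<i>"
    then have "\<sigma> z = z" for z by (subst z) (simp flip: complex_eq)
    then show ?thesis by (auto simp: fun_eq_iff)
  next
    assume "\<sigma> \<i> = - \<i>"
    then have "\<sigma> z = cnj z" for z by (subst z) (simp add: complex_eq_iff)
    then show ?thesis by (auto simp: fun_eq_iff)
  qed
qed

section \<open>Uhlhorn's theorem through an affine chart of rays\<close>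

locale ray_map =
  fixes g :: "'a::complex_hilbert \<Rightarrow> 'a"
  assumes inf: "\<not> (\<exists>B :: 'a set. finite B \<and> complex_vector.span B = UNIV)"
    and g_nonzero: "x \<noteq> 0 \<Longrightarrow> g x \<noteq> 0"
    and g_orth: "x \<noteq> 0 \<Longrightarrow> y \<noteq> 0 \<Longrightarrow> cinner (g x) (g y) = 0 \<longleftrightarrow> cinner x y = 0"
    and g_onto: "y \<noteq> 0 \<Longrightarrow> \<exists>x c. x \<noteq> 0 \<and> y = c *\<^sub>C g x"
begin

text \<open>The vectors \<open>g x\<close> are arbitrary representatives of image rays, so the
  arguments work with nonzero multiples of them and choose convenient ones.\<close>

definition rep :: "'a \<Rightarrow> 'a \<Rightarrow> bool" where
  "rep x X \<longleftrightarrow> x \<noteq> 0 \<and> (\<exists>c. c \<noteq> 0 \<and> X = c *\<^sub>C g x)"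

lemma rep_nonzero: "rep x X \<Longrightarrow> X \<noteq> 0"
  unfolding rep_def using g_nonzero[of x] by auto

lemma rep_g: "x \<noteq> 0 \<Longrightarrow> rep x (g x)"
  by (auto simp: rep_def intro!: exI[of _ 1])

lemma rep_scaleC: "rep x X \<Longrightarrow> c \<noteq> 0 \<Longrightarrow> rep x (c *\<^sub>C X)"
proof -
  assume "rep x X" and c: "c \<noteq> 0"
  then obtain d where "x \<noteq> 0" "d \<noteq> 0" "X = d *\<^sub>C g x" by (auto simp: rep_def)
  then show ?thesis using c unfolding rep_def by (intro conjI exI[of _ "c * d"]) simp_all
qed

lemma rep_orth: "rep x X \<Longrightarrow> rep y Y \<Longrightarrow> cinner X Y = 0 \<longleftrightarrow> cinner x y = 0"
  using g_orth unfolding rep_def by (auto simp: cinner_algebra)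

text \<open>A plane is a double orthogonal complement, and by \<open>g_onto\<close> the vectors
  testing it are images up to factors. Hence preserving orthogonality implies preserving linear
  dependence.\<close>

lemma rep_span:
  assumes "rep x X" "rep y Y" "rep w W" "w = a *\<^sub>C x + b *\<^sub>C y"
  obtains c d where "W = c *\<^sub>C X + d *\<^sub>C Y"
proof (rule in_span2_if_perp_subset)
  fix z assume z: "cinner z X = 0" "cinner z Y = 0"
  show "cinner z W = 0"
  proof (cases "z = 0")
    case False
    then obtain p c where p: "p \<noteq> 0" "z = c *\<^sub>C g p" using g_onto by blast
    then have "c \<noteq> 0" using False by auto
    then have p: "rep p z" using p by (auto simp: rep_def)
    then have "cinner p x = 0" "cinner p y = 0"
      using z rep_orth assms by blast+
    then have "cinner p w = 0" by (simp add: assms(4) cinner_algebra)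
    then show ?thesis using rep_orth[OF p assms(3)] by blast
  qed simp
qed (rule that)

lemma rep_multiple:
  assumes "rep x X" "rep w W" "w = a *\<^sub>C x"
  obtains c where "W = c *\<^sub>C X"
proof -
  have "w = a *\<^sub>C x + 0 *\<^sub>C x" using assms by simp
  then obtain c d where "W = c *\<^sub>C X + d *\<^sub>C X" using rep_span[OF assms(1,1,2)] by blast
  then show thesis using that[of "c + d"] by (simp add: scaleC_add_left)
qed

lemma multiple_rep:
  assumes "rep x X" "rep w W" "W = a *\<^sub>C X"
  obtains c where "w = c *\<^sub>C x"
proof (rule multiple_if_perp_subset)
  fix z assume z: "cinner z x = 0"
  show "cinner z w = 0"
  proof (cases "z = 0")
    case False
    then have "cinner (g z) X = 0" using z rep_orth[OF rep_g assms(1)] by blast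
    then have "cinner (g z) W = 0" by (simp add: assms(3) cinner_algebra)
    then show ?thesis using rep_orth[OF rep_g[OF False] assms(2)] by blast
  qed simp
qed (rule that)

text \<open>Rays not orthogonal to \<open>e\<close> are written as \<open>e + x\<close> with
  \<open>x\<close> orthogonal to \<open>e\<close>. In this chart the ray map becomes a map
  \<open>T\<close> between hyperplanes: preservation of planes makes it additive and semilinear,
  preservation of orthogonality controls inner products. \<open>S\<close> extends \<open>T\<close>
  to the whole space.\<close>

lemma ex_semi_unitary_aux:
  assumes e: "norm (e :: 'a) = 1"
  shows "\<exists>\<sigma> S. semi_unitary \<sigma> S \<and> (\<forall>x. x \<noteq> 0 \<longrightarrow> (\<exists>c. S x = c *\<^sub>C g x))"
proof -
  have e0: "e \<noteq> 0" using e by auto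
  define e' where "e' = complex_of_real (inverse (norm (g e))) *\<^sub>C g e"
  have e': "norm e' = 1" using g_nonzero[OF e0] by (simp add: e'_def norm_inverse)
  have ee: "cinner e e = 1" "cinner e' e' = 1" using e e' by (simp_all add: cinner_self_unit)
  have rep_e: "rep e e'" unfolding e'_def using g_nonzero[OF e0] by (intro rep_scaleC rep_g e0) auto
  \<comment> \<open>The representative of the image of \<open>e + x\<close> is scaled so that its
    component along \<open>e'\<close> is exactly \<open>e'\<close>.\<close>
  define T where "T x = inverse (cinner (g (e + x)) e') *\<^sub>C g (e + x) - e'" for x
  have perp': "cinner e x = 0" if "cinner x e = 0" for x :: 'a using that cinner_eq_0_commute by blast
  have T: "rep (e + x) (e' + T x) \<and> cinner (T x) e' = 0" if x: "cinner x e = 0" for x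
  proof -
    have "cinner (e + x) e = 1" using x ee by (simp add: cinner_add_left)
    then have nz: "e + x \<noteq> 0" and "cinner (e + x) e \<noteq> 0" by auto
    then have k: "cinner (g (e + x)) e' \<noteq> 0" using rep_orth[OF rep_g rep_e] by blast
    then have "rep (e + x) (e' + T x)" unfolding T_def by (simp add: rep_scaleC rep_g nz)
    moreover have "cinner (T x) e' = 0" using k ee by (simp add: T_def cinner_algebra)
    ultimately show ?thesis by blast
  qed
  have Tperp: "cinner (T x) e' = 0" "cinner e' (T x) = 0" if "cinner x e = 0" for x
    using T[OF that] cinner_eq_0_commute by blast+
  have T0: "T 0 = 0"
  proof -
    obtain c where c: "e' + T 0 = c *\<^sub>C e'" using rep_multiple[OF rep_e, of "e + 0" "e' + T 0" 1] T[of 0]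
      by auto
    have "cinner (e' + T 0) e' = cinner (c *\<^sub>C e') e'" using c by simp
    then have "c = 1" using ee Tperp[of 0] by (simp add: cinner_algebra)
    then show ?thesis using c by simp
  qed
  have repT: "rep x (T x)" if x: "cinner x e = 0" "x \<noteq> 0" for x
  proof -
    have "x = 1 *\<^sub>C (e + x) + (-1) *\<^sub>C e" by simp
    then obtain c d where cd: "g x = c *\<^sub>C (e' + T x) + d *\<^sub>C e'"
      using rep_span[OF _ rep_e rep_g[OF x(2)], of "e + x" "e' + T x"] T[OF x(1)] by metis
    have "cinner (g x) e' = 0" using rep_orth[OF rep_g[OF x(2)] rep_e] x by blast
    then have "c + d = 0" using ee Tperp[OF x(1)] by (simp add: cd cinner_algebra)
    moreover have "g x = c *\<^sub>C T x + (c + d) *\<^sub>C e'" by (simp add: cd scaleC_add_left scaleC_add_right)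
    ultimately have gx: "g x = c *\<^sub>C T x" by simp
    then have "c \<noteq> 0" using g_nonzero[OF x(2)] by auto
    then have "T x = inverse c *\<^sub>C g x" by (simp add: gx)
    then show ?thesis using \<open>c \<noteq> 0\<close> x(2) unfolding rep_def by (intro conjI exI[of _ "inverse c"]) simp_all
  qed
  have T_indep: "a = 0 \<and> b = 0"
    if x: "cinner x e = 0" "x \<noteq> 0" and y: "cinner y e = 0" "y \<noteq> 0"
      and ind: "\<And>c. y \<noteq> c *\<^sub>C x" and eq: "a *\<^sub>C T x = b *\<^sub>C T y" for x y a b
  proof -
    have "b = 0"
    proof (rule ccontr)
      assume b: "b \<noteq> 0"
      have "inverse b *\<^sub>C (b *\<^sub>C T y) = inverse b *\<^sub>C (a *\<^sub>C T x)" by (simp only: eq)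
      then have "T y = (inverse b * a) *\<^sub>C T x" using b by simp
      then obtain c where "y = c *\<^sub>C x" using multiple_rep[OF repT[OF x] repT[OF y]] by blast
      then show False using ind by blast
    qed
    then show ?thesis using eq rep_nonzero[OF repT[OF x]] by auto
  qed
  \<comment> \<open>The vector \<open>e + (x + y)\<close> lies in the plane of \<open>e + x\<close>
    and \<open>y\<close> and in that of \<open>e + y\<close> and \<open>x\<close>; independence of
    \<open>T x\<close> and \<open>T y\<close> fixes both coefficients.\<close>
  have add1: "T (x + y) = T x + T y"
    if x: "cinner x e = 0" "x \<noteq> 0" and y: "cinner y e = 0" "y \<noteq> 0" and ind: "\<And>c. y \<noteq> c *\<^sub>C x" for x y
  proof -
    have xy: "cinner (x + y) e = 0" using x y by (simp add: cinner_add_left)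
    have half: "\<exists>d. T (x + y) = T x + d *\<^sub>C T y"
      if x: "cinner x e = 0" and y: "cinner y e = 0" "y \<noteq> 0" for x y
    proof -
      have xy: "cinner (x + y) e = 0" using x y by (simp add: cinner_add_left)
      have "e + (x + y) = 1 *\<^sub>C (e + x) + 1 *\<^sub>C y" by simp
      then obtain c d where cd: "e' + T (x + y) = c *\<^sub>C (e' + T x) + d *\<^sub>C T y"
        using rep_span[OF _ repT[OF y], of "e + x" "e' + T x" "e + (x + y)" "e' + T (x + y)"] T[OF x] T[OF xy]
        by metis
      have "cinner (e' + T (x + y)) e' = cinner (c *\<^sub>C (e' + T x) + d *\<^sub>C T y) e'" by (simp only: cd)
      then have "c = 1" using ee Tperp x y xy by (simp add: cinner_algebra)
      then show ?thesis using cd by auto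
    qed
    obtain d where d: "T (x + y) = T x + d *\<^sub>C T y" using half x y by blast
    obtain d' where d': "T (y + x) = T y + d' *\<^sub>C T x" using half x y by blast
    have "T x + d *\<^sub>C T y = T y + d' *\<^sub>C T x" using d d' by (simp add: add.commute)
    then have "(1 - d') *\<^sub>C T x = (1 - d) *\<^sub>C T y"
      by (simp add: complex_vector.scale_left_diff_distrib scaleC_one algebra_simps)
    then have "1 - d' = 0 \<and> 1 - d = 0" using T_indep[OF x y ind] by blast
    then show ?thesis using d by simp
  qed
  have fresh: "\<exists>z. cinner z e = 0 \<and> z \<noteq> 0 \<and> cinner x z = 0 \<and> cinner y z = 0 \<and>
      (\<forall>c w. cinner w z = 0 \<longrightarrow> z \<noteq> c *\<^sub>C w)" for x y :: 'a
  proof -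
    obtain z where z: "norm z = 1" "cinner z e = 0" "cinner z x = 0" "cinner z y = 0"
      using ex_unit_orthogonal[OF inf, of "{e, x, y}"] by auto
    have "z \<noteq> c *\<^sub>C w" if "cinner w z = 0" for c w
    proof
      assume "z = c *\<^sub>C w"
      then have "cinner z z = c * cinner w z" by (metis cinner_scaleC_left)
      then show False using that z(1) by (simp add: cinner_self_unit)
    qed
    moreover have "z \<noteq> 0" using z(1) by auto
    ultimately show ?thesis using z cinner_eq_0_commute by blast
  qed
  \<comment> \<open>To cover dependent \<open>x, y\<close>, a fresh \<open>z\<close> orthogonal to
    both is added: expanding \<open>T (x + y + z)\<close> in two ways needs only sums of independent
    vectors.\<close>
  have T_add: "T (x + y) = T x + T y" if x: "cinner x e = 0" and y: "cinner y e = 0" for x y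
  proof (cases "x = 0 \<or> y = 0")
    case True
    then show ?thesis using T0 by auto
  next
    case False
    obtain z where z: "cinner z e = 0" "z \<noteq> 0" "cinner x z = 0" "cinner y z = 0"
      and z_ind: "\<And>c w. cinner w z = 0 \<Longrightarrow> z \<noteq> c *\<^sub>C w"
      using fresh by blast
    have yz: "cinner (y + z) e = 0" using y z by (simp add: cinner_add_left)
    have "y + z \<noteq> 0" using z_ind[OF z(4), of "-1"] by (auto simp: add_eq_0_iff)
    moreover have "y + z \<noteq> c *\<^sub>C x" for c
    proof
      assume "y + z = c *\<^sub>C x"
      then have "cinner (y + z) z = 0" using z by (simp add: cinner_algebra)
      then show False using z by (simp add: cinner_add_left)
    qed
    ultimately have "T (x + (y + z)) = T x + T (y + z)" using add1 x yz False by blast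
    also have "T (y + z) = T y + T z" using add1 y z False z_ind by blast
    finally have 1: "T (x + (y + z)) = T x + (T y + T z)" .
    have "T ((x + y) + z) = T (x + y) + T z"
    proof (cases "x + y = 0")
      case True
      then show ?thesis using T0 by simp
    next
      case False
      have "cinner (x + y) e = 0" "cinner (x + y) z = 0" using x y z by (simp_all add: cinner_add_left)
      then show ?thesis using add1[of "x + y" z] False z z_ind by blast
    qed
    then show ?thesis using 1 by (simp add: add.assoc)
  qed
  have T_scale: "\<exists>s. T (c *\<^sub>C x) = s *\<^sub>C T x" if x: "cinner x e = 0" "x \<noteq> 0" for c x
  proof (cases "c = 0")
    case True
    then show ?thesis using T0 by (intro exI[of _ 0]) simp
  next
    case False
    then have "rep (c *\<^sub>C x) (T (c *\<^sub>C x))" using x by (intro repT) (simp_all add: cinner_scaleC_left)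
    then show ?thesis using rep_multiple[OF repT[OF x] _ refl] by metis
  qed
  \<comment> \<open>Additivity on independent \<open>x, y\<close> forces one factor for both.
    Comparing through a fresh third direction, the factor depends on \<open>c\<close> alone.\<close>
  have same: "s = t"
    if x: "cinner x e = 0" "x \<noteq> 0" and y: "cinner y e = 0" "y \<noteq> 0" and ind: "\<And>c. y \<noteq> c *\<^sub>C x"
      and s: "T (c *\<^sub>C x) = s *\<^sub>C T x" and t: "T (c *\<^sub>C y) = t *\<^sub>C T y" for x y s t c
  proof -
    have xy: "cinner (x + y) e = 0" using x y by (simp add: cinner_add_left)
    have xy0: "x + y \<noteq> 0" using ind[of "-1"] by (auto simp: add_eq_0_iff)
    obtain r where r: "T (c *\<^sub>C (x + y)) = r *\<^sub>C T (x + y)" using T_scale[OF xy xy0] by blast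
    have "T (c *\<^sub>C (x + y)) = T (c *\<^sub>C x) + T (c *\<^sub>C y)"
      using x y by (simp add: scaleC_add_right T_add cinner_scaleC_left)
    then have "r *\<^sub>C T x + r *\<^sub>C T y = s *\<^sub>C T x + t *\<^sub>C T y"
      using r s t x y by (simp add: T_add scaleC_add_right)
    then have "(r - s) *\<^sub>C T x = (t - r) *\<^sub>C T y"
      by (simp add: complex_vector.scale_left_diff_distrib algebra_simps)
    then have "r - s = 0 \<and> t - r = 0" using T_indep[OF x y ind] by blast
    then show ?thesis by simp
  qed
  obtain f where f: "norm f = 1" "cinner f e = 0" using ex_unit_orthogonal[OF inf, of "{e}"] by auto
  have f0: "f \<noteq> 0" "cinner f f = 1" using f by (auto simp: cinner_self_unit)
  obtain \<sigma> where \<sigma>f: "\<And>c. T (c *\<^sub>C f) = \<sigma> c *\<^sub>C T f" using T_scale[OF f(2) f0(1)] by metis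
  have \<sigma>: "T (c *\<^sub>C x) = \<sigma> c *\<^sub>C T x" if x: "cinner x e = 0" for c x
  proof (cases "x = 0")
    case True
    then show ?thesis using T0 by simp
  next
    case False
    obtain s where s: "T (c *\<^sub>C x) = s *\<^sub>C T x" using T_scale[OF x False] by blast
    obtain z where z: "cinner z e = 0" "z \<noteq> 0" "cinner x z = 0" "cinner f z = 0"
      and z_ind: "\<And>c w. cinner w z = 0 \<Longrightarrow> z \<noteq> c *\<^sub>C w"
      using fresh by blast
    obtain t where t: "T (c *\<^sub>C z) = t *\<^sub>C T z" using T_scale[OF z(1,2)] by blast
    have "\<sigma> c = t" using same[OF f(2) f0(1) z(1,2) z_ind[OF z(4)] \<sigma>f t] .
    moreover have "s = t" using same[OF x False z(1,2) z_ind[OF z(3)] s t] .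
    ultimately show ?thesis using s by simp
  qed
  have Tf: "T f \<noteq> 0" using rep_nonzero[OF repT[OF f(2) f0(1)]] .
  have \<sigma>_cancel: "a = b" if "a *\<^sub>C T f = b *\<^sub>C T f" for a b using that Tf by simp
  have \<sigma>_add: "\<sigma> (c + d) = \<sigma> c + \<sigma> d" for c d
    using T_add[of "c *\<^sub>C f" "d *\<^sub>C f"] f
    by (intro \<sigma>_cancel) (simp add: cinner_scaleC_left \<sigma>f scaleC_add_left flip: scaleC_add_left)
  have \<sigma>_mult: "\<sigma> (c * d) = \<sigma> c * \<sigma> d" for c d
  proof (rule \<sigma>_cancel)
    have "\<sigma> (c * d) *\<^sub>C T f = T (c *\<^sub>C (d *\<^sub>C f))" by (simp add: \<sigma>f)
    also have "\<dots> = \<sigma> c *\<^sub>C T (d *\<^sub>C f)" using f by (intro \<sigma>) (simp add: cinner_scaleC_left)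
    finally show "\<sigma> (c * d) *\<^sub>C T f = (\<sigma> c * \<sigma> d) *\<^sub>C T f" by (simp add: \<sigma>f)
  qed
  have \<sigma>_1: "\<sigma> 1 = 1" using \<sigma>f[of 1] by (intro \<sigma>_cancel) simp
  have \<sigma>_0: "\<sigma> 0 = 0" using \<sigma>_add[of 0 0] by simp
  have \<sigma>_minus: "\<sigma> (- c) = - \<sigma> c" for c using \<sigma>_add[of c "- c"] \<sigma>_0 by (simp add: add_eq_0_iff)
  have \<sigma>_nz: "\<sigma> c \<noteq> 0" if "c \<noteq> 0" for c using \<sigma>_mult[of c "inverse c"] that \<sigma>_1 by auto
  \<comment> \<open>Inner product -1 of \<open>x\<close> and \<open>y\<close> means orthogonality of
    \<open>e + x\<close> and \<open>e + y\<close>, which the ray map preserves.\<close>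
  have minus_one: "cinner (T x) (T y) = -1" if x: "cinner x e = 0" and y: "cinner y e = 0" and xy: "cinner x y = -1" for x y
  proof -
    have "cinner (e + x) (e + y) = 0" using x y xy ee perp' by (simp add: cinner_algebra)
    then have "cinner (e' + T x) (e' + T y) = 0" using rep_orth T[OF x] T[OF y] by blast
    then show ?thesis using ee Tperp[OF x] Tperp[OF y] by (simp add: cinner_algebra add_eq_0_iff)
  qed
  have Tff: "cinner (T f) (T f) = 1"
  proof -
    have "cinner (T f) (T ((-1) *\<^sub>C f)) = -1"
      using f f0 by (intro minus_one) (simp_all add: cinner_minus_left cinner_minus_right)
    then show ?thesis by (simp only: \<sigma>f \<sigma>_minus \<sigma>_1) (simp add: cinner_minus_right)
  qed
  \<comment> \<open>Uses that \<open>cnj c *\<^sub>C f\<close> and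
    \<open>(- inverse c) *\<^sub>C f\<close> have inner product -1.\<close>
  have \<sigma>_cnj: "\<sigma> (cnj c) = cnj (\<sigma> c)" for c
  proof (cases "c = 0")
    case False
    define d where "d = - inverse c"
    have "cinner (T (cnj c *\<^sub>C f)) (T (d *\<^sub>C f)) = -1"
      using f f0 False by (intro minus_one) (simp_all add: cinner_algebra d_def)
    then have 1: "\<sigma> (cnj c) * cnj (\<sigma> d) = -1" by (simp add: \<sigma>f cinner_algebra Tff mult.commute)
    have "\<sigma> c * \<sigma> d = -1" using \<sigma>_mult[of c d] False by (simp add: d_def \<sigma>_minus \<sigma>_1)
    then have 2: "cnj (\<sigma> c) * cnj (\<sigma> d) = -1" by (metis complex_cnj_mult complex_cnj_minus complex_cnj_one)
    have "cnj (\<sigma> d) \<noteq> 0" using 1 by auto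
    then show ?thesis using 1 2 by (metis mult_right_cancel)
  qed (simp add: \<sigma>_0)
  have \<sigma>_cases: "\<sigma> = id \<or> \<sigma> = cnj"
    by (rule complex_hom_commuting_with_cnj) (fact \<sigma>_add \<sigma>_mult \<sigma>_1 \<sigma>_cnj)+
  \<comment> \<open>A nonzero inner product is rescaled to -1; the vanishing case is orthogonality
    itself.\<close>
  have T_inner: "cinner (T x) (T y) = \<sigma> (cinner x y)" if x: "cinner x e = 0" and y: "cinner y e = 0" for x y
  proof (cases "cinner x y = 0")
    case True
    show ?thesis
    proof (cases "x = 0 \<or> y = 0")
      case False
      then show ?thesis using True rep_orth[OF repT[OF x] repT[OF y]] \<sigma>_0 by simp
    qed (auto simp: T0 \<sigma>_0)
  next
    case False
    define d where "d = - inverse (cinner x y)"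
    have d: "d \<noteq> 0" "d * cinner x y = -1" using False by (simp_all add: d_def)
    have "cinner (T (d *\<^sub>C x)) (T y) = -1"
      using x y d by (intro minus_one) (simp_all add: cinner_algebra)
    then have "\<sigma> d * cinner (T x) (T y) = -1" by (simp add: \<sigma>[OF x] cinner_algebra)
    moreover have "\<sigma> d * \<sigma> (cinner x y) = -1" using \<sigma>_mult[of d "cinner x y"] d \<sigma>_minus[of 1] \<sigma>_1 by simp
    ultimately show ?thesis using \<sigma>_nz[OF d(1)] by (metis mult_left_cancel)
  qed
  define P where "P w = w - cinner w e *\<^sub>C e" for w
  have P1: "cinner (P w) e = 0" for w using ee by (simp add: P_def cinner_algebra)
  note P = P1 perp'[OF P1]
  have Pw: "w = cinner w e *\<^sub>C e + P w" for w by (simp add: P_def)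
  define S where "S w = \<sigma> (cinner w e) *\<^sub>C e' + T (P w)" for w
  have S_add: "S (x + y) = S x + S y" for x y
  proof -
    have "P (x + y) = P x + P y" by (simp add: P_def cinner_algebra scaleC_add_left)
    then show ?thesis by (simp add: S_def T_add P cinner_algebra \<sigma>_add scaleC_add_left)
  qed
  have S_scale: "S (c *\<^sub>C x) = \<sigma> c *\<^sub>C S x" for c x
  proof -
    have "P (c *\<^sub>C x) = c *\<^sub>C P x"
      by (simp add: P_def cinner_algebra complex_vector.scale_right_diff_distrib)
    then show ?thesis by (simp add: S_def \<sigma> P cinner_algebra \<sigma>_mult scaleC_add_right)
  qed
  have S_inner: "cinner (S x) (S y) = \<sigma> (cinner x y)" for x y
  proof -
    have "cinner x y = cinner x e * cnj (cinner y e) + cinner (P x) (P y)"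
      by (subst Pw[of x], subst Pw[of y]) (simp add: cinner_add_left cinner_add_right cinner_scaleC_left cinner_scaleC_right ee P)
    then show ?thesis
      by (simp add: S_def cinner_algebra ee Tperp P T_inner \<sigma>_add \<sigma>_mult \<sigma>_cnj)
  qed
  have repS: "rep w (S w)" if w: "w \<noteq> 0" for w
  proof (cases "cinner w e = 0")
    case True
    then have "P w = w" by (simp add: P_def)
    then show ?thesis using repT[OF True w] True by (simp add: S_def \<sigma>_0)
  next
    case False
    define c where "c = cinner w e"
    have c: "c \<noteq> 0" using False by (simp add: c_def)
    define x where "x = inverse c *\<^sub>C P w"
    have x: "cinner x e = 0" by (simp add: x_def cinner_algebra P)
    have wx: "w = c *\<^sub>C (e + x)"
      using c by (subst Pw) (simp add: x_def scaleC_add_right c_def[symmetric])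
    have "S (e + x) = e' + T x"
      using x ee by (simp add: S_def P_def cinner_algebra \<sigma>_1)
    then have Sw: "S w = \<sigma> c *\<^sub>C (e' + T x)" by (subst wx) (simp only: S_scale)
    have ex: "rep (e + x) (e' + T x)" using T[OF x] by blast
    obtain d where d: "g w = d *\<^sub>C (e' + T x)" using rep_multiple[OF ex rep_g[OF w] wx] by blast
    have "d \<noteq> 0" using g_nonzero[OF w] d by auto
    then have "e' + T x = inverse d *\<^sub>C g w" by (simp add: d)
    then have "S w = (\<sigma> c * inverse d) *\<^sub>C g w" by (simp only: Sw scaleC_scaleC)
    then show ?thesis using w \<sigma>_nz[OF c] \<open>d \<noteq> 0\<close> unfolding rep_def by (metis mult_eq_0_iff inverse_nonzero_iff_nonzero)
  qed
  have "surj S"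
  proof (rule surjI)
    fix y
    show "S (SOME x. S x = y) = y"
    proof (rule someI_ex, cases "y = 0")
      case True
      then show "\<exists>x. S x = y" using S_add[of 0 0] by (intro exI[of _ 0]) simp
    next
      case False
      then obtain x c where x: "x \<noteq> 0" "y = c *\<^sub>C g x" using g_onto by blast
      obtain d where d: "d \<noteq> 0" "S x = d *\<^sub>C g x" using repS[OF x(1)] by (auto simp: rep_def)
      obtain b where b: "\<sigma> b = c / d" using \<sigma>_cases by (metis complex_cnj_cnj id_apply)
      have "S (b *\<^sub>C x) = y" using d x by (simp add: S_scale b)
      then show "\<exists>x. S x = y" by blast
    qed
  qed
  then have "semi_unitary \<sigma> S"
    unfolding semi_unitary_def using \<sigma>_cases S_add S_scale S_inner by blast
  moreover have "\<forall>x. x \<noteq> 0 \<longrightarrow> (\<exists>c. S x = c *\<^sub>C g x)" using repS by (auto simp: rep_def)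
  ultimately show ?thesis by blast
qed

lemma ex_semi_unitary:
  obtains \<sigma> S where "semi_unitary \<sigma> S" "\<And>x. x \<noteq> 0 \<Longrightarrow> \<exists>c. S x = c *\<^sub>C g x"
proof -
  obtain e :: 'a where "norm e = 1" using ex_unit_orthogonal[OF inf, of "{}"] by auto
  from ex_semi_unitary_aux[OF this] show thesis using that by blast
qed

end

section \<open>Orthogonality preserving maps of pairs of rays\<close>

text \<open>Pairs of rays are represented by pairs of unit vectors.\<close>

definition para :: "'a::complex_hilbert \<Rightarrow> 'a \<Rightarrow> bool" where
  "para x y \<longleftrightarrow> (\<exists>c. cmod c = 1 \<and> y = c *\<^sub>C x)"

definition unit_pairs :: "('a::complex_hilbert \<times> 'a) set" where
  "unit_pairs = {p. norm (fst p) = 1 \<and> norm (snd p) = 1}"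

text \<open>Pairs of rays are viewed as cells of a grid: a row has a fixed first ray, a column a
  fixed second ray.\<close>

definition row :: "'a::complex_hilbert \<times> 'a \<Rightarrow> 'a \<times> 'a \<Rightarrow> bool" where
  "row p q \<longleftrightarrow> para (fst p) (fst q)"

definition col :: "'a::complex_hilbert \<times> 'a \<Rightarrow> 'a \<times> 'a \<Rightarrow> bool" where
  "col p q \<longleftrightarrow> para (snd p) (snd q)"

definition orthp :: "'a::complex_hilbert \<times> 'a \<Rightarrow> 'a \<times> 'a \<Rightarrow> bool" where
  "orthp p q \<longleftrightarrow> cinner (fst p) (fst q) = 0 \<and> cinner (snd p) (snd q) = 0"

lemma para_refl: "para x x"
  unfolding para_def by (intro exI[of _ 1]) simp

lemma para_sym: "para x y \<Longrightarrow> para y x"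
proof -
  assume "para x y"
  then obtain c where c: "cmod c = 1" "y = c *\<^sub>C x" by (auto simp: para_def)
  then have "c \<noteq> 0" by auto
  then have "x = inverse c *\<^sub>C y" using c by simp
  then show ?thesis unfolding para_def using c by (intro exI[of _ "inverse c"]) (simp add: norm_inverse)
qed

lemma para_trans: "para x y \<Longrightarrow> para y z \<Longrightarrow> para x z"
proof -
  assume "para x y" "para y z"
  then obtain c d where "cmod c = 1" "y = c *\<^sub>C x" "cmod d = 1" "z = d *\<^sub>C y" by (auto simp: para_def)
  then show ?thesis unfolding para_def by (intro exI[of _ "d * c"]) (simp add: norm_mult)
qed

lemma para_orth_right: "para x y \<Longrightarrow> cinner z y = 0 \<longleftrightarrow> cinner z x = 0"
  by (auto simp: para_def cinner_algebra)

lemma para_if_multiple: "norm x = 1 \<Longrightarrow> norm y = 1 \<Longrightarrow> y = c *\<^sub>C x \<Longrightarrow> para x y"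
  unfolding para_def by auto

lemma para_if_unit_perp_subset:
  assumes "norm x = 1" "norm y = 1"
    and perp: "\<And>z. norm z = 1 \<Longrightarrow> cinner z x = 0 \<Longrightarrow> cinner z y = 0"
  shows "para x y"
proof -
  obtain c where "y = c *\<^sub>C x"
  proof (rule multiple_if_perp_subset)
    fix z assume z: "cinner z x = 0"
    show "cinner z y = 0"
    proof (cases "z = 0")
      case False
      then have "cinner (inverse (norm z) *\<^sub>R z) y = 0"
        using z by (intro perp) (simp_all add: cinner_scaleR_left)
      then show ?thesis using False by (simp add: cinner_scaleR_left)
    qed simp
  qed (rule that)
  then show ?thesis using para_if_multiple assms by blast
qed

lemma para_not_orth: "para x y \<Longrightarrow> norm x = 1 \<Longrightarrow> cinner x y \<noteq> 0"
  unfolding para_def by (auto simp: cinner_algebra cinner_self_unit)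

lemma swap_in_unit_pairs [simp]: "prod.swap p \<in> unit_pairs \<longleftrightarrow> p \<in> unit_pairs"
  and row_swap [simp]: "row (prod.swap p) (prod.swap q) \<longleftrightarrow> col p q"
  and col_swap [simp]: "col (prod.swap p) (prod.swap q) \<longleftrightarrow> row p q"
  and orthp_swap [simp]: "orthp (prod.swap p) (prod.swap q) \<longleftrightarrow> orthp p q"
  by (auto simp: unit_pairs_def row_def col_def orthp_def)

lemma row_sym: "row p q \<Longrightarrow> row q p" and col_sym: "col p q \<Longrightarrow> col q p"
  and row_trans: "row p q \<Longrightarrow> row q r \<Longrightarrow> row p r" and col_trans: "col p q \<Longrightarrow> col q r \<Longrightarrow> col p r"
  unfolding row_def col_def using para_sym para_trans by blast+

lemma orthp_cong: "row p q \<Longrightarrow> col p q \<Longrightarrow> orthp r p \<longleftrightarrow> orthp r q"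
  unfolding row_def col_def orthp_def by (simp add: para_orth_right)

lemma orthp_commute: "orthp p q \<longleftrightarrow> orthp q p"
  unfolding orthp_def using cinner_eq_0_commute by blast

text \<open>Phrased through \<open>orthp\<close> alone, so that surjective maps preserving
  \<open>orthp\<close> transport it.\<close>

definition in_double_perp :: "'a::complex_hilbert \<times> 'a \<Rightarrow> 'a \<times> 'a \<Rightarrow> 'a \<times> 'a \<Rightarrow> bool" where
  "in_double_perp p q r \<longleftrightarrow> (\<forall>s\<in>unit_pairs. orthp s p \<longrightarrow> orthp s q \<longrightarrow> orthp s r)"

context
  assumes inf: "\<not> (\<exists>B :: 'a::complex_hilbert set. finite B \<and> complex_vector.span B = UNIV)"
begin

lemma ex_unit_orth2: "\<exists>z. norm z = 1 \<and> cinner z x = 0 \<and> cinner z y = 0" for x y :: 'a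
  using ex_unit_orthogonal[OF inf, of "{x, y}"] by auto

text \<open>A vector \<open>z\<close> testing the first components is completed to a pair by some
  \<open>y\<close> orthogonal to both second components, which infinite dimension provides.\<close>

lemma row_if_in_double_perp:
  fixes p q r :: "'a \<times> 'a"
  assumes p: "p \<in> unit_pairs" and r: "r \<in> unit_pairs" "in_double_perp p q r" and "row p q"
  shows "row p r"
  unfolding row_def
proof (rule para_if_unit_perp_subset)
  fix z assume z: "norm z = 1" "cinner z (fst p) = 0"
  obtain y where y: "norm y = 1" "cinner y (snd p) = 0" "cinner y (snd q) = 0" using ex_unit_orth2 by blast
  have "cinner z (fst q) = 0" using z(2) para_orth_right \<open>row p q\<close> unfolding row_def by blast
  then have "orthp (z, y) r"
    using r y z by (auto simp: in_double_perp_def orthp_def unit_pairs_def)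
  then show "cinner z (fst r) = 0" by (simp add: orthp_def)
qed (use p r in \<open>auto simp: unit_pairs_def\<close>)

lemma col_if_in_double_perp:
  fixes p q r :: "'a \<times> 'a"
  assumes p: "p \<in> unit_pairs" and r: "r \<in> unit_pairs" "in_double_perp p q r" and "col p q"
  shows "col p r"
proof -
  have "in_double_perp (prod.swap p) (prod.swap q) (prod.swap r)"
    unfolding in_double_perp_def
  proof (intro ballI impI)
    fix s :: "'a \<times> 'a"
    assume "s \<in> unit_pairs" "orthp s (prod.swap p)" "orthp s (prod.swap q)"
    then have "prod.swap s \<in> unit_pairs" "orthp (prod.swap s) p" "orthp (prod.swap s) q"
      using orthp_swap[of s "prod.swap p"] orthp_swap[of s "prod.swap q"] by simp_all
    then have "orthp (prod.swap s) r" using r(2) by (simp add: in_double_perp_def)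
    then show "orthp s (prod.swap r)" using orthp_swap[of s "prod.swap r"] by simp
  qed
  then show ?thesis
    using row_if_in_double_perp[of "prod.swap p" "prod.swap r" "prod.swap q"] p r \<open>col p q\<close> by simp
qed

text \<open>Makes equality of pairs of rays a matter of orthogonality: equal complements put
  \<open>q\<close> into the double complement of \<open>p\<close> alone.\<close>

lemma row_col_iff_perp:
  fixes p q :: "'a \<times> 'a"
  assumes p: "p \<in> unit_pairs" and q: "q \<in> unit_pairs"
  shows "row p q \<and> col p q \<longleftrightarrow> (\<forall>s\<in>unit_pairs. orthp s p \<longleftrightarrow> orthp s q)"
proof
  assume "row p q \<and> col p q"
  then show "\<forall>s\<in>unit_pairs. orthp s p \<longleftrightarrow> orthp s q" using orthp_cong by blast
next
  assume "\<forall>s\<in>unit_pairs. orthp s p \<longleftrightarrow> orthp s q"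
  then have "in_double_perp p p q" by (simp add: in_double_perp_def)
  then show "row p q \<and> col p q"
    using row_if_in_double_perp[OF p q] col_if_in_double_perp[OF p q] by (simp add: row_def col_def para_refl)
qed

lemma ex_orth_combination:
  assumes x: "norm (x::'a) = 1" and y: "norm y = 1" and np: "\<not> para x y"
  obtains z where "norm z = 1" "cinner x z = 0"
    "\<And>w. cinner w x = 0 \<Longrightarrow> cinner w y = 0 \<Longrightarrow> cinner w z = 0"
proof -
  define z0 where "z0 = y - cinner y x *\<^sub>C x"
  have "z0 \<noteq> 0" using np para_if_multiple[OF x y] by (metis eq_iff_diff_eq_0 z0_def)
  have "cinner z0 x = 0" using x by (simp add: z0_def cinner_algebra cinner_self_unit)
  then have "cinner x z0 = 0" using cinner_eq_0_commute by blast
  then show thesis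
    using \<open>z0 \<noteq> 0\<close> by (intro that[of "inverse (norm z0) *\<^sub>R z0"]) (auto simp: cinner_algebra z0_def)
qed

text \<open>The double orthogonal complement of two pairs of rays is a product of projective subspaces
  of dimension at most one; it contains orthogonal pairs unless one of the factors is a point.\<close>

lemma share_iff:
  fixes p q :: "'a \<times> 'a"
  assumes p: "p \<in> unit_pairs" and q: "q \<in> unit_pairs"
  shows "row p q \<or> col p q \<longleftrightarrow>
    \<not> (\<exists>r\<in>unit_pairs. \<exists>r'\<in>unit_pairs. in_double_perp p q r \<and> in_double_perp p q r' \<and> orthp r r')"
proof
  assume share: "row p q \<or> col p q"
  show "\<not> (\<exists>r\<in>unit_pairs. \<exists>r'\<in>unit_pairs. in_double_perp p q r \<and> in_double_perp p q r' \<and> orthp r r')"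
  proof (intro notI, elim bexE conjE)
    fix r r' assume rr: "r \<in> unit_pairs" "r' \<in> unit_pairs" "in_double_perp p q r" "in_double_perp p q r'" "orthp r r'"
    from share have "row r r' \<or> col r r'"
      using row_if_in_double_perp[OF p] col_if_in_double_perp[OF p] rr row_sym row_trans col_sym col_trans by meson
    then show False using rr para_not_orth by (auto simp: row_def col_def unit_pairs_def orthp_def)
  qed
next
  assume no: "\<not> (\<exists>r\<in>unit_pairs. \<exists>r'\<in>unit_pairs. in_double_perp p q r \<and> in_double_perp p q r' \<and> orthp r r')"
  show "row p q \<or> col p q"
  proof (rule ccontr)
    assume "\<not> (row p q \<or> col p q)"
    then have "\<not> para (fst p) (fst q)" "\<not> para (snd p) (snd q)" by (auto simp: row_def col_def)
    moreover have "norm (fst p) = 1" "norm (snd p) = 1" "norm (fst q) = 1" "norm (snd q) = 1"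
      using p q by (auto simp: unit_pairs_def)
    ultimately obtain a b where
      a: "norm a = 1" "cinner (fst p) a = 0"
        "\<And>w. cinner w (fst p) = 0 \<Longrightarrow> cinner w (fst q) = 0 \<Longrightarrow> cinner w a = 0" and
      b: "norm b = 1" "cinner (snd p) b = 0"
        "\<And>w. cinner w (snd p) = 0 \<Longrightarrow> cinner w (snd q) = 0 \<Longrightarrow> cinner w b = 0"
      using ex_orth_combination by metis
    have "in_double_perp p q (a, b)" using a b by (simp add: in_double_perp_def orthp_def)
    moreover have "in_double_perp p q p" by (simp add: in_double_perp_def)
    moreover have "orthp p (a, b)" using a b by (simp add: orthp_def)
    moreover have "(a, b) \<in> unit_pairs" using a b by (simp add: unit_pairs_def)
    ultimately show False using no p by blast
  qed
qed

end

section \<open>Rows and columns under maps of ray pairs\<close>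

locale pair_map =
  fixes g :: "'a::complex_hilbert \<times> 'a \<Rightarrow> 'a \<times> 'a"
  assumes inf: "\<not> (\<exists>B :: 'a set. finite B \<and> complex_vector.span B = UNIV)"
    and g_unit: "p \<in> unit_pairs \<Longrightarrow> g p \<in> unit_pairs"
    and g_orthp: "p \<in> unit_pairs \<Longrightarrow> q \<in> unit_pairs \<Longrightarrow> orthp (g p) (g q) \<longleftrightarrow> orthp p q"
    and g_onto: "q \<in> unit_pairs \<Longrightarrow> \<exists>p\<in>unit_pairs. row (g p) q \<and> col (g p) q"
begin

text \<open>Surjectivity holds only up to phases, so a quantifier may be moved to the image for
  predicates that do not see phases.\<close>

lemma ball_unit_pairs_image:
  assumes "\<And>q q'. row q q' \<Longrightarrow> col q q' \<Longrightarrow> Q q \<longleftrightarrow> Q q'"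
  shows "(\<forall>q\<in>unit_pairs. Q q) \<longleftrightarrow> (\<forall>p\<in>unit_pairs. Q (g p))"
  using assms g_onto g_unit by metis

lemma orthp_left_cong: "row q q' \<Longrightarrow> col q q' \<Longrightarrow> orthp q p \<longleftrightarrow> orthp q' p"
  using orthp_cong orthp_commute by blast

lemma g_row_col:
  assumes "p \<in> unit_pairs" "q \<in> unit_pairs"
  shows "row (g p) (g q) \<and> col (g p) (g q) \<longleftrightarrow> row p q \<and> col p q"
proof -
  have "(\<forall>s\<in>unit_pairs. orthp s (g p) \<longleftrightarrow> orthp s (g q)) \<longleftrightarrow>
      (\<forall>s\<in>unit_pairs. orthp (g s) (g p) \<longleftrightarrow> orthp (g s) (g q))"
    by (rule ball_unit_pairs_image) (use orthp_left_cong in blast)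
  also have "\<dots> \<longleftrightarrow> (\<forall>s\<in>unit_pairs. orthp s p \<longleftrightarrow> orthp s q)"
    using assms by (simp add: g_orthp)
  finally show ?thesis using assms by (simp add: row_col_iff_perp[OF inf] g_unit)
qed

lemma g_in_double_perp:
  assumes "p \<in> unit_pairs" "q \<in> unit_pairs" "r \<in> unit_pairs"
  shows "in_double_perp (g p) (g q) (g r) \<longleftrightarrow> in_double_perp p q r"
proof -
  have "in_double_perp (g p) (g q) (g r) \<longleftrightarrow>
      (\<forall>s\<in>unit_pairs. orthp (g s) (g p) \<longrightarrow> orthp (g s) (g q) \<longrightarrow> orthp (g s) (g r))"
    unfolding in_double_perp_def by (rule ball_unit_pairs_image) (use orthp_left_cong in blast)
  then show ?thesis unfolding in_double_perp_def using assms by (simp add: g_orthp)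
qed

lemma in_double_perp_cong: "row r r' \<Longrightarrow> col r r' \<Longrightarrow> in_double_perp p q r \<longleftrightarrow> in_double_perp p q r'"
  unfolding in_double_perp_def using orthp_cong by blast

lemma g_share:
  assumes p: "p \<in> unit_pairs" and q: "q \<in> unit_pairs"
  shows "row (g p) (g q) \<or> col (g p) (g q) \<longleftrightarrow> row p q \<or> col p q"
proof -
  have "(\<exists>r\<in>unit_pairs. \<exists>r'\<in>unit_pairs.
      in_double_perp (g p) (g q) r \<and> in_double_perp (g p) (g q) r' \<and> orthp r r') \<longleftrightarrow>
    (\<exists>r\<in>unit_pairs. \<exists>r'\<in>unit_pairs.
      in_double_perp (g p) (g q) (g r) \<and> in_double_perp (g p) (g q) (g r') \<and> orthp (g r) (g r'))"
    (is "?L \<longleftrightarrow> ?R")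
  proof
    assume ?L
    then obtain r r' where r: "r \<in> unit_pairs" "r' \<in> unit_pairs"
      "in_double_perp (g p) (g q) r" "in_double_perp (g p) (g q) r'" "orthp r r'" by blast
    obtain s s' where s: "s \<in> unit_pairs" "row (g s) r" "col (g s) r"
      and s': "s' \<in> unit_pairs" "row (g s') r'" "col (g s') r'"
      using g_onto[OF r(1)] g_onto[OF r(2)] by blast
    have "in_double_perp (g p) (g q) (g s)" "in_double_perp (g p) (g q) (g s')"
      using r s s' in_double_perp_cong by blast+
    moreover have "orthp (g s) (g s')"
      using r(5) orthp_left_cong[OF s(2,3)] orthp_cong[OF s'(2,3)] by blast
    ultimately show ?R using s s' by blast
  next
    assume ?R
    then show ?L using g_unit by blast
  qed
  also have "\<dots> \<longleftrightarrow> (\<exists>r\<in>unit_pairs. \<exists>r'\<in>unit_pairs.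
      in_double_perp p q r \<and> in_double_perp p q r' \<and> orthp r r')"
    using p q by (simp add: g_in_double_perp g_orthp)
  finally show ?thesis using p q by (simp add: share_iff[OF inf] g_unit)
qed

text \<open>One witness, two different cells of a row with \<open>R\<close>-related images, decides
  the behaviour of all rows and columns. Letting \<open>R\<close> and \<open>C\<close> stand for row
  and column in either order covers both cases by one argument.\<close>

lemma rows_and_columns_if:
  assumes R: "R = row \<and> C = col \<or> R = col \<and> C = row"
    and p0: "p0 \<in> unit_pairs" and p1: "p1 \<in> unit_pairs" "row p0 p1" "\<not> col p0 p1" "R (g p0) (g p1)"
    and p: "p \<in> unit_pairs" and q: "q \<in> unit_pairs"
  shows "row p q \<Longrightarrow> R (g p) (g q)" "col p q \<Longrightarrow> C (g p) (g q)"
proof -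
  have sym: "R x y \<Longrightarrow> R y x" "C x y \<Longrightarrow> C y x"
    and trans: "R x y \<Longrightarrow> R y z \<Longrightarrow> R x z" "C x y \<Longrightarrow> C y z \<Longrightarrow> C x z"
    for x y z :: "'a \<times> 'a"
    using R row_sym col_sym row_trans col_trans by blast+
  have eqv: "R (g x) (g y) \<and> C (g x) (g y) \<longleftrightarrow> row x y \<and> col x y"
    if "x \<in> unit_pairs" "y \<in> unit_pairs" for x y using R g_row_col[OF that] by blast
  have share: "R (g x) (g y) \<or> C (g x) (g y) \<longleftrightarrow> row x y \<or> col x y"
    if "x \<in> unit_pairs" "y \<in> unit_pairs" for x y using R g_share[OF that] by blast
  \<comment> \<open>The property of respecting the row and the column through the single cell
    \<open>x\<close>; it spreads from cell to cell along rows and columns.\<close>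
  define N where "N x \<longleftrightarrow> (\<forall>y\<in>unit_pairs. (row x y \<longrightarrow> R (g x) (g y)) \<and> (col x y \<longrightarrow> C (g x) (g y)))" for x
  have N: "N x"
    if x: "x \<in> unit_pairs" and y: "y \<in> unit_pairs" "row x y" "\<not> col x y" "R (g x) (g y)" for x y
    unfolding N_def
  proof (intro ballI conjI impI)
    fix z :: "'a \<times> 'a" assume z: "z \<in> unit_pairs"
    show "R (g x) (g z)" if "row x z"
    proof (rule ccontr)
      \<comment> \<open>Then the images of \<open>x\<close> and \<open>y\<close> are both
        \<open>C\<close>-related to that of \<open>z\<close>, hence to each other, and would
        coincide.\<close>
      assume nR: "\<not> R (g x) (g z)"
      then have "C (g x) (g z)" using share[OF x z] that by blast
      moreover have "row y z" using y(2) that row_sym row_trans by blast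
      then have "R (g y) (g z) \<or> C (g y) (g z)" using share[OF y(1) z] by blast
      then have "C (g y) (g z)" using nR y(4) trans(1) by blast
      ultimately have "C (g x) (g y)" using sym trans by blast
      then show False using eqv[OF x y(1)] y by blast
    qed
    show "C (g x) (g z)" if "col x z"
    proof (cases "row x z")
      case True
      then show ?thesis using eqv[OF x z] that by blast
    next
      case False
      show ?thesis
      proof (rule ccontr)
        \<comment> \<open>Then the images of \<open>z\<close> and \<open>y\<close> share a line,
          although \<open>z\<close> and \<open>y\<close> share neither row nor column.\<close>
        assume "\<not> C (g x) (g z)"
        then have "R (g x) (g z)" using share[OF x z] that by blast
        then have "R (g z) (g y)" using y(4) sym trans by blast
        then have "row z y \<or> col z y" using share[OF z y(1)] by blast
        then show False using False that y row_sym row_trans col_trans by blast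
      qed
    qed
  qed
  have ex_row: "\<exists>y\<in>unit_pairs. row x y \<and> \<not> col x y" if "x \<in> unit_pairs" for x :: "'a \<times> 'a"
  proof -
    obtain z where z: "norm z = 1" "cinner z (snd x) = 0" using ex_unit_orth2[OF inf] by blast
    have "\<not> para (snd x) z" using z para_not_orth[OF para_sym] by blast
    then show ?thesis using z that
      by (intro bexI[of _ "(fst x, z)"]) (auto simp: row_def col_def para_refl unit_pairs_def)
  qed
  have N_row: "N y" if x: "x \<in> unit_pairs" "N x" and y: "y \<in> unit_pairs" "row x y" for x y
  proof -
    obtain z where z: "z \<in> unit_pairs" "row y z" "\<not> col y z" using ex_row[OF y(1)] by blast
    have "R (g x) (g y)" using x y by (simp add: N_def)
    moreover have "R (g x) (g z)" using x y z row_trans unfolding N_def by blast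
    ultimately show ?thesis using N[OF y(1) z] sym trans by blast
  qed
  have N_col: "N y" if x: "x \<in> unit_pairs" "N x" and y: "y \<in> unit_pairs" "col x y" for x y
  proof (cases "row x y")
    case True
    then show ?thesis using N_row x y by blast
  next
    case False
    obtain z where z: "z \<in> unit_pairs" "row y z" "\<not> col y z" using ex_row[OF y(1)] by blast
    have "R (g y) (g z)"
    proof (rule ccontr)
      assume "\<not> R (g y) (g z)"
      then have "C (g y) (g z)" using share[OF y(1) z(1)] z by blast
      moreover have "C (g x) (g y)" using x y by (simp add: N_def)
      ultimately have "C (g x) (g z)" using trans by blast
      then have "row x z \<or> col x z" using share[OF x(1) z(1)] by blast
      then show False using False y z row_sym row_trans col_sym col_trans by blast
    qed
    then show ?thesis using N[OF y(1) z] by blast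
  qed
  \<comment> \<open>The corner cell: it is reached from \<open>p0\<close> along a row, and
    \<open>p\<close> is reached from it along a column.\<close>
  define m where "m = (fst p0, snd p)"
  have m: "m \<in> unit_pairs" "row p0 m" "col m p"
    using p0 p by (auto simp: m_def unit_pairs_def row_def col_def para_refl)
  have "N p0" using N[OF p0 p1] .
  then have "N m" using N_row p0 m by blast
  then have "N p" using N_col m p by blast
  then show "row p q \<Longrightarrow> R (g p) (g q)" "col p q \<Longrightarrow> C (g p) (g q)" using q by (auto simp: N_def)
qed

lemma rows_and_columns:
  "(\<forall>p\<in>unit_pairs. \<forall>q\<in>unit_pairs. (row p q \<longrightarrow> row (g p) (g q)) \<and> (col p q \<longrightarrow> col (g p) (g q))) \<or>
   (\<forall>p\<in>unit_pairs. \<forall>q\<in>unit_pairs. (row p q \<longrightarrow> col (g p) (g q)) \<and> (col p q \<longrightarrow> row (g p) (g q)))"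
proof -
  obtain e :: 'a where e: "norm e = 1" using ex_unit_orth2[OF inf] by blast
  obtain f where f: "norm f = 1" "cinner f e = 0" using ex_unit_orth2[OF inf] by blast
  have p: "(e, e) \<in> unit_pairs" "(e, f) \<in> unit_pairs" using e f by (simp_all add: unit_pairs_def)
  have rc: "row (e, e) (e, f)" "\<not> col (e, e) (e, f)"
    using f para_not_orth[OF para_sym] by (auto simp: row_def col_def para_refl)
  have "row (g (e, e)) (g (e, f)) \<or> col (g (e, e)) (g (e, f))" using g_share[OF p] rc by blast
  then show ?thesis
  proof
    assume "row (g (e, e)) (g (e, f))"
    then show ?thesis using rows_and_columns_if[of row col "(e, e)" "(e, f)"] p rc by blast
  next
    assume "col (g (e, e)) (g (e, f))"
    then show ?thesis using rows_and_columns_if[of col row "(e, e)" "(e, f)"] p rc by blast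
  qed
qed

end

section \<open>Star order automorphisms on atoms\<close>

definition strongly_compatible :: "('a::complex_hilbert \<Rightarrow> 'a) \<Rightarrow> ('a \<Rightarrow> 'a) \<Rightarrow> bool" where
  "strongly_compatible P Q \<longleftrightarrow> P \<noteq> Q \<and> (\<exists>C\<in>type_1_ops. star_le P C \<and> star_le Q C \<and>
     (\<forall>R. is_atom R \<longrightarrow> star_le R C \<longrightarrow> R = P \<or> R = Q))"

lemma strongly_compatible_atoms_iff:
  assumes s: "0 < s" "norm u = 1" "norm v = 1" and t: "0 < t" "norm x = 1" "norm y = 1"
  shows "strongly_compatible (atom s u v) (atom t x y) \<longleftrightarrow> s \<noteq> t \<and> orthp (u, v) (x, y)"
proof
  assume "strongly_compatible (atom s u v) (atom t x y)"
  then obtain C where ne: "atom s u v \<noteq> atom t x y" and C: "C \<in> bounded_ops"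
    and le: "star_le (atom s u v) C" "star_le (atom t x y) C"
    and only: "\<And>R. is_atom R \<Longrightarrow> star_le R C \<Longrightarrow> R = atom s u v \<or> R = atom t x y"
    using type_1_ops_bounded by (auto simp: strongly_compatible_def)
  have "s \<noteq> t"
  proof
    assume st: "s = t"
    obtain P where "is_atom P" "star_le P C" "P \<noteq> atom s u v" "P \<noteq> atom s x y"
      using third_atom_le[OF C s t(2,3) le(1)] le(2) ne st by metis
    then show False using only st by blast
  qed
  then show "s \<noteq> t \<and> orthp (u, v) (x, y)"
    using common_upper_bound_cinner(2)[OF C s t le] by (simp add: orthp_def)
next
  assume st: "s \<noteq> t \<and> orthp (u, v) (x, y)"
  then have o: "cinner u x = 0" "cinner v y = 0" by (auto simp: orthp_def)
  have "atom s u v \<noteq> atom t x y" using atom_eq_atomD[OF s t] st by metis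
  then show "strongly_compatible (atom s u v) (atom t x y)"
    unfolding strongly_compatible_def using sum_of_orthogonal_atoms[OF s t o] st by blast
qed

locale star_automorphism =
  fixes \<phi> :: "('a::complex_hilbert \<Rightarrow> 'a) \<Rightarrow> ('a \<Rightarrow> 'a)"
  assumes inf: "\<not> (\<exists>B :: 'a set. finite B \<and> complex_vector.span B = UNIV)"
    and aut: "star_order_automorphism \<phi>"
begin

lemma bij: "bij_betw \<phi> type_1_ops type_1_ops"
  and le_iff: "A \<in> type_1_ops \<Longrightarrow> B \<in> type_1_ops \<Longrightarrow> star_le (\<phi> A) (\<phi> B) \<longleftrightarrow> star_le A B"
  using aut by (auto simp: star_order_automorphism_def)

lemma in_type_1 [simp]: "A \<in> type_1_ops \<Longrightarrow> \<phi> A \<in> type_1_ops"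
  using bij by (auto simp: bij_betw_def)

lemma eq_iff: "A \<in> type_1_ops \<Longrightarrow> B \<in> type_1_ops \<Longrightarrow> \<phi> A = \<phi> B \<longleftrightarrow> A = B"
  using bij by (auto simp: bij_betw_def dest: inj_onD)

lemma onto: "B \<in> type_1_ops \<Longrightarrow> \<exists>A\<in>type_1_ops. \<phi> A = B"
proof -
  assume "B \<in> type_1_ops"
  then have "B \<in> \<phi> ` type_1_ops" using bij by (simp add: bij_betw_def)
  then show ?thesis by blast
qed

lemma zero: "\<phi> (\<lambda>_. 0) = (\<lambda>_. 0)"
proof -
  obtain B where B: "B \<in> type_1_ops" "\<phi> B = (\<lambda>_. 0)" using onto[OF zero_in_type_1_ops] by blast
  have "star_le (\<phi> (\<lambda>_. 0)) (\<phi> B)"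
    using le_iff[OF zero_in_type_1_ops B(1)] zero_star_le type_1_ops_bounded B(1) by blast
  then show ?thesis
    using star_le_zero_iff[OF type_1_ops_bounded[OF in_type_1[OF zero_in_type_1_ops]]] B(2) by simp
qed

text \<open>Atoms are the minimal nonzero type 1 operators: the preimage \<open>R'\<close> of an
  atom below the image of \<open>P\<close> is nonzero and lies below \<open>P\<close>, and an atom
  below \<open>R'\<close> must be \<open>P\<close>, so \<open>R' = P\<close>.\<close>

lemma atom: assumes P: "is_atom P" shows "is_atom (\<phi> P)"
proof -
  have P1: "P \<in> type_1_ops" using P by (rule is_atom_in_type_1_ops)
  have "\<phi> P \<noteq> (\<lambda>_. 0)"
    using atom_nonzero[OF P] eq_iff[OF P1 zero_in_type_1_ops] zero by simp
  then obtain R where R: "is_atom R" "star_le R (\<phi> P)" using ex_atom_le[OF in_type_1[OF P1]] by blast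
  obtain R' where R': "R' \<in> type_1_ops" "\<phi> R' = R" using onto is_atom_in_type_1_ops R by blast
  have "star_le R' P" using le_iff[OF R'(1) P1] R R' by simp
  moreover have "R' \<noteq> (\<lambda>_. 0)" using R R' zero atom_nonzero by metis
  then obtain Q where Q: "is_atom Q" "star_le Q R'" using ex_atom_le R' by blast
  have "star_le Q P"
    using atom_le_trans[OF Q(1) _ _ Q(2) \<open>star_le R' P\<close>] P1 R'(1) type_1_ops_bounded by blast
  then have "Q = P" using atom_le_atom_imp_eq[OF Q(1) P] by blast
  ultimately have "R' = P" using star_le_antisym P1 R'(1) Q(2) type_1_ops_bounded by blast
  then show ?thesis using R' R by simp
qed

lemma atom_onto: assumes Q: "is_atom Q" shows "\<exists>P. is_atom P \<and> \<phi> P = Q"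
proof -
  have Q1: "Q \<in> type_1_ops" using Q by (rule is_atom_in_type_1_ops)
  obtain P where P: "P \<in> type_1_ops" "\<phi> P = Q" using onto[OF Q1] by blast
  have "P \<noteq> (\<lambda>_. 0)" using P zero atom_nonzero[OF Q] by metis
  then obtain R where R: "is_atom R" "star_le R P" using ex_atom_le P by blast
  then have "star_le (\<phi> R) Q" using le_iff P is_atom_in_type_1_ops by metis
  then have "\<phi> R = Q" using atom_le_atom_imp_eq atom R Q by blast
  then show ?thesis using R by blast
qed

lemma bex_type_1_image: "(\<exists>C\<in>type_1_ops. Q C) \<longleftrightarrow> (\<exists>C\<in>type_1_ops. Q (\<phi> C))"
  using onto in_type_1 by metis

lemma all_atoms_image: "(\<forall>R. is_atom R \<longrightarrow> Q R) \<longleftrightarrow> (\<forall>R. is_atom R \<longrightarrow> Q (\<phi> R))"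
  using atom_onto atom by metis

lemma strongly_compatible_image:
  assumes P: "is_atom P" and Q: "is_atom Q"
  shows "strongly_compatible (\<phi> P) (\<phi> Q) \<longleftrightarrow> strongly_compatible P Q"
proof -
  note T = is_atom_in_type_1_ops
  have "(\<exists>C\<in>type_1_ops. star_le (\<phi> P) C \<and> star_le (\<phi> Q) C \<and>
     (\<forall>R. is_atom R \<longrightarrow> star_le R C \<longrightarrow> R = \<phi> P \<or> R = \<phi> Q)) \<longleftrightarrow>
    (\<exists>C\<in>type_1_ops. star_le (\<phi> P) (\<phi> C) \<and> star_le (\<phi> Q) (\<phi> C) \<and>
     (\<forall>R. is_atom R \<longrightarrow> star_le R (\<phi> C) \<longrightarrow> R = \<phi> P \<or> R = \<phi> Q))"
    by (rule bex_type_1_image)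
  also have "\<dots> \<longleftrightarrow> (\<exists>C\<in>type_1_ops. star_le P C \<and> star_le Q C \<and>
     (\<forall>R. is_atom R \<longrightarrow> star_le R (\<phi> C) \<longrightarrow> R = \<phi> P \<or> R = \<phi> Q))"
    using le_iff[OF T[OF P]] le_iff[OF T[OF Q]] by (intro bex_cong) simp_all
  also have "\<dots> \<longleftrightarrow> (\<exists>C\<in>type_1_ops. star_le P C \<and> star_le Q C \<and>
     (\<forall>R. is_atom R \<longrightarrow> star_le (\<phi> R) (\<phi> C) \<longrightarrow> \<phi> R = \<phi> P \<or> \<phi> R = \<phi> Q))"
    by (subst all_atoms_image) (rule refl)
  also have "\<dots> \<longleftrightarrow> (\<exists>C\<in>type_1_ops. star_le P C \<and> star_le Q C \<and>
     (\<forall>R. is_atom R \<longrightarrow> star_le R C \<longrightarrow> R = P \<or> R = Q))"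
    using P Q by (intro bex_cong) (simp_all add: le_iff eq_iff T cong: imp_cong)
  finally show ?thesis unfolding strongly_compatible_def using eq_iff[OF T[OF P] T[OF Q]] by simp
qed

section \<open>The induced maps of scales and of ray pairs\<close>

definition image_triple :: "real \<Rightarrow> 'a \<times> 'a \<Rightarrow> real \<times> 'a \<times> 'a" where
  "image_triple s p = (SOME q. 0 < fst q \<and> snd q \<in> unit_pairs \<and>
     \<phi> (atom s (fst p) (snd p)) = atom (fst q) (fst (snd q)) (snd (snd q)))"

definition g :: "real \<Rightarrow> 'a \<times> 'a \<Rightarrow> 'a \<times> 'a" where
  "g s p = snd (image_triple s p)"

text \<open>The choice is unambiguous for positive \<open>s\<close> by
  \<open>fst_image_triple\<close>: the scale of the image does not depend on the pair.\<close>

definition f :: "real \<Rightarrow> real" where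
  "f s = (SOME t. \<exists>p\<in>unit_pairs. fst (image_triple s p) = t)"

lemma image_triple:
  assumes "0 < s" "p \<in> unit_pairs"
  shows "0 < fst (image_triple s p)" "g s p \<in> unit_pairs"
    "\<phi> (atom s (fst p) (snd p)) = atom (fst (image_triple s p)) (fst (g s p)) (snd (g s p))"
proof -
  have "is_atom (\<phi> (atom s (fst p) (snd p)))"
    using assms by (intro atom is_atom_atom) (auto simp: unit_pairs_def)
  then obtain t x y where "0 < t" "norm x = 1" "norm y = 1" "\<phi> (atom s (fst p) (snd p)) = atom t x y"
    by (rule is_atomE)
  then have "\<exists>q. 0 < fst q \<and> snd q \<in> unit_pairs \<and>
     \<phi> (atom s (fst p) (snd p)) = atom (fst q) (fst (snd q)) (snd (snd q))"
    by (intro exI[of _ "(t, x, y)"]) (simp add: unit_pairs_def)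
  from someI_ex[OF this]
  show "0 < fst (image_triple s p)" "g s p \<in> unit_pairs"
    "\<phi> (atom s (fst p) (snd p)) = atom (fst (image_triple s p)) (fst (g s p)) (snd (g s p))"
    unfolding image_triple_def g_def by blast+
qed

lemma strongly_compatible_image_triple:
  assumes s: "0 < s" "p \<in> unit_pairs" and t: "0 < t" "q \<in> unit_pairs"
  shows "s \<noteq> t \<and> orthp p q \<longleftrightarrow>
    fst (image_triple s p) \<noteq> fst (image_triple t q) \<and> orthp (g s p) (g t q)"
proof -
  have p: "norm (fst p) = 1" "norm (snd p) = 1" and q: "norm (fst q) = 1" "norm (snd q) = 1"
    using s t by (auto simp: unit_pairs_def)
  have gp: "norm (fst (g s p)) = 1" "norm (snd (g s p)) = 1"
    and gq: "norm (fst (g t q)) = 1" "norm (snd (g t q)) = 1"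
    using image_triple[OF s] image_triple[OF t] by (auto simp: unit_pairs_def)
  have "s \<noteq> t \<and> orthp p q \<longleftrightarrow>
      strongly_compatible (atom s (fst p) (snd p)) (atom t (fst q) (snd q))"
    using strongly_compatible_atoms_iff[OF s(1) p t(1) q] by simp
  also have "\<dots> \<longleftrightarrow> strongly_compatible (\<phi> (atom s (fst p) (snd p))) (\<phi> (atom t (fst q) (snd q)))"
    by (intro strongly_compatible_image[symmetric] is_atom_atom) (use s t p q in auto)
  also have "\<dots> \<longleftrightarrow> fst (image_triple s p) \<noteq> fst (image_triple t q) \<and> orthp (g s p) (g t q)"
    unfolding image_triple(3)[OF s] image_triple(3)[OF t]
    using strongly_compatible_atoms_iff[OF image_triple(1)[OF s] gp image_triple(1)[OF t] gq] by simp
  finally show ?thesis .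
qed

text \<open>Two orthogonal atoms of the same scale have an upper bound but are not strongly
  compatible; this forces their images to have the same scale.\<close>

lemma image_scale_orthp:
  assumes s: "0 < s" and p: "p \<in> unit_pairs" and q: "q \<in> unit_pairs" and o: "orthp p q"
  shows "fst (image_triple s p) = fst (image_triple s q)"
proof (rule ccontr)
  assume ne: "fst (image_triple s p) \<noteq> fst (image_triple s q)"
  have p': "norm (fst p) = 1" "norm (snd p) = 1" and q': "norm (fst q) = 1" "norm (snd q) = 1"
    using p q by (auto simp: unit_pairs_def)
  have gp: "norm (fst (g s p)) = 1" "norm (snd (g s p)) = 1"
    and gq: "norm (fst (g s q)) = 1" "norm (snd (g s q)) = 1"
    using image_triple[OF s p] image_triple[OF s q] by (auto simp: unit_pairs_def)
  define C where "C z = atom s (fst p) (snd p) z + atom s (fst q) (snd q) z" for z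
  have C: "C \<in> type_1_ops" "star_le (atom s (fst p) (snd p)) C" "star_le (atom s (fst q) (snd q)) C"
    using sum_of_orthogonal_atoms(1-3)[OF s p' s q'] o unfolding C_def orthp_def by auto
  have "star_le (\<phi> (atom s (fst p) (snd p))) (\<phi> C)" "star_le (\<phi> (atom s (fst q) (snd q))) (\<phi> C)"
    using C le_iff is_atom_in_type_1_ops is_atom_atom s p' q' by blast+
  then have "orthp (g s p) (g s q)"
    unfolding image_triple(3)[OF s p] image_triple(3)[OF s q] orthp_def
    using common_upper_bound_cinner(2)[OF type_1_ops_bounded[OF in_type_1[OF C(1)]]
        image_triple(1)[OF s p] gp image_triple(1)[OF s q] gq] ne by blast
  then show False using strongly_compatible_image_triple[OF s p s q] ne by blast
qed

lemma ex_orthp: "\<exists>r\<in>unit_pairs. orthp p r \<and> orthp r q" for p q :: "'a \<times> 'a"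
proof -
  obtain x where x: "norm x = 1" "cinner x (fst p) = 0" "cinner x (fst q) = 0"
    using ex_unit_orth2[OF inf] by blast
  obtain y where y: "norm y = 1" "cinner y (snd p) = 0" "cinner y (snd q) = 0"
    using ex_unit_orth2[OF inf] by blast
  have "orthp p (x, y)" using x y unfolding orthp_commute[of p] by (simp add: orthp_def)
  then show ?thesis using x y by (intro bexI[of _ "(x, y)"]) (auto simp: orthp_def unit_pairs_def)
qed

lemma unit_pairs_nonempty: "\<exists>p :: 'a \<times> 'a. p \<in> unit_pairs"
  using ex_orthp by blast

text \<open>Any two pairs have a common orthogonal pair, so the orthogonal case
  \<open>image_scale_orthp\<close> connects them.\<close>

lemma fst_image_triple:
  assumes s: "0 < s" and p: "p \<in> unit_pairs"
  shows "fst (image_triple s p) = f s"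
proof -
  have same: "fst (image_triple s p) = fst (image_triple s q)" if q: "q \<in> unit_pairs" for q
  proof -
    obtain r where "r \<in> unit_pairs" "orthp p r" "orthp r q" using ex_orthp by blast
    then show ?thesis using image_scale_orthp[OF s] p q by metis
  qed
  have "\<exists>t. \<exists>p\<in>unit_pairs. fst (image_triple s p) = t" using p by blast
  from someI_ex[OF this] show ?thesis using same unfolding f_def by metis
qed

lemma g_in_unit_pairs: "0 < s \<Longrightarrow> p \<in> unit_pairs \<Longrightarrow> g s p \<in> unit_pairs"
  by (rule image_triple)

lemma image_atom:
  "0 < s \<Longrightarrow> p \<in> unit_pairs \<Longrightarrow> \<phi> (atom s (fst p) (snd p)) = atom (f s) (fst (g s p)) (snd (g s p))"
  using image_triple(3) fst_image_triple by simp

lemma f_pos: "0 < s \<Longrightarrow> 0 < f s"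
  using image_triple(1) fst_image_triple unit_pairs_nonempty by metis

lemma g_orthp_iff:
  "0 < s \<Longrightarrow> p \<in> unit_pairs \<Longrightarrow> 0 < t \<Longrightarrow> q \<in> unit_pairs \<Longrightarrow>
    s \<noteq> t \<and> orthp p q \<longleftrightarrow> f s \<noteq> f t \<and> orthp (g s p) (g t q)"
  using strongly_compatible_image_triple fst_image_triple by simp

lemma f_eq_iff: "0 < s \<Longrightarrow> 0 < t \<Longrightarrow> f s = f t \<longleftrightarrow> s = t"
  using g_orthp_iff unit_pairs_nonempty ex_orthp by metis

lemma atom_image_onto:
  assumes t: "0 < t" and q: "q \<in> unit_pairs"
  shows "\<exists>s>0. \<exists>p\<in>unit_pairs. f s = t \<and> row (g s p) q \<and> col (g s p) q"
proof -
  have q': "norm (fst q) = 1" "norm (snd q) = 1" using q by (auto simp: unit_pairs_def)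
  obtain P where P: "is_atom P" "\<phi> P = atom t (fst q) (snd q)"
    using atom_onto[OF is_atom_atom[OF t q']] by blast
  obtain s u v where s: "0 < s" "norm u = 1" "norm v = 1" "P = atom s u v" using P(1) by (rule is_atomE)
  have p: "(u, v) \<in> unit_pairs" using s by (simp add: unit_pairs_def)
  have "atom (f s) (fst (g s (u, v))) (snd (g s (u, v))) = atom t (fst q) (snd q)"
    using image_atom[OF s(1) p] P(2) s(4) by simp
  moreover have "norm (fst (g s (u, v))) = 1" "norm (snd (g s (u, v))) = 1"
    using g_in_unit_pairs[OF s(1) p] by (auto simp: unit_pairs_def)
  ultimately obtain c where "t = f s" "cmod c = 1" "fst q = c *\<^sub>C fst (g s (u, v))" "snd q = c *\<^sub>C snd (g s (u, v))"
    using atom_eq_atomD[OF f_pos[OF s(1)] _ _ t q'] by metis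
  then have "f s = t" "row (g s (u, v)) q" "col (g s (u, v)) q"
    by (auto simp: row_def col_def para_def)
  then show ?thesis using s(1) p by blast
qed

lemma f_bij: "bij_betw f {0<..} {0<..}"
  unfolding bij_betw_def
proof
  show "inj_on f {0<..}" using f_eq_iff by (auto intro!: inj_onI)
  show "f ` {0<..} = {0<..}"
  proof
    show "f ` {0<..} \<subseteq> {0<..}" using f_pos by auto
    show "{0<..} \<subseteq> f ` {0<..}"
    proof
      fix t :: real assume "t \<in> {0<..}"
      then obtain s where "s > 0" "f s = t" using atom_image_onto[of t] unit_pairs_nonempty by auto
      then show "t \<in> f ` {0<..}" by auto
    qed
  qed
qed

text \<open>Compatibility compares only different scales, so both images are tested against atoms of
  a third scale \<open>t\<close>. By surjectivity the images of the latter run through all pairs up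
  to phase.\<close>

lemma g_scale_independent:
  assumes s: "0 < s" "p \<in> unit_pairs" and s': "0 < s'"
  shows "row (g s p) (g s' p) \<and> col (g s p) (g s' p)"
  unfolding row_col_iff_perp[OF inf g_in_unit_pairs[OF s] g_in_unit_pairs[OF s' s(2)]]
proof
  fix q :: "'a \<times> 'a" assume q: "q \<in> unit_pairs"
  define t where "t = s + s'"
  have t: "t > 0" "t \<noteq> s" "t \<noteq> s'" using s s' by (auto simp: t_def)
  obtain t' r where r: "t' > 0" "r \<in> unit_pairs" "f t' = f t" "row (g t' r) q" "col (g t' r) q"
    using atom_image_onto[OF f_pos[OF t(1)] q] by blast
  then have "t' = t" using f_eq_iff t by blast
  then have "orthp q (g a p) \<longleftrightarrow> orthp r p" if "0 < a" "t \<noteq> a" for a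
    using g_orthp_iff[OF t(1) r(2) that(1) s(2)] f_eq_iff[OF t(1) that(1)] that(2)
      orthp_cong[OF r(4,5), of "g a p"] orthp_commute by metis
  then show "orthp q (g s p) \<longleftrightarrow> orthp q (g s' p)" using t s s' by blast
qed

sublocale pair_map "g 1"
proof
  show "\<not> (\<exists>B :: 'a set. finite B \<and> complex_vector.span B = UNIV)" by (rule inf)
  show "g 1 p \<in> unit_pairs" if "p \<in> unit_pairs" for p using g_in_unit_pairs that by simp
  show "orthp (g 1 p) (g 1 q) \<longleftrightarrow> orthp p q" if p: "p \<in> unit_pairs" and q: "q \<in> unit_pairs" for p q
  proof -
    \<comment> \<open>Compatibility does not detect orthogonality within scale 1; the detour through
      scale 2 does, and \<open>g_scale_independent\<close> leads back.\<close>
    have "orthp (g 1 p) (g 2 q) \<longleftrightarrow> orthp p q"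
      using g_orthp_iff[of 1 p 2 q] f_eq_iff[of 1 2] p q by simp
    then show ?thesis using orthp_cong[of "g 1 q" "g 2 q" "g 1 p"] g_scale_independent[of 1 q 2] q by simp
  qed
  show "\<exists>p\<in>unit_pairs. row (g 1 p) q \<and> col (g 1 p) q" if q: "q \<in> unit_pairs" for q
  proof -
    obtain s p where s: "s > 0" "p \<in> unit_pairs" "row (g s p) q" "col (g s p) q"
      using atom_image_onto[OF _ q, of 1] by auto
    have "row (g 1 p) (g s p)" "col (g 1 p) (g s p)" using g_scale_independent[of 1 p s] s by simp_all
    then show ?thesis using s row_trans col_trans by blast
  qed
qed

lemma compatible_image_cinner:
  assumes s: "0 < s" "norm u = 1" "norm v = 1" "norm x = 1" "norm y = 1"
    and C: "C \<in> type_1_ops" "star_le (atom s u v) C" "star_le (atom s x y) C"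
    and img: "\<phi> (atom s u v) = atom t u' v'" "\<phi> (atom s x y) = atom t x' y'"
      "0 < t" "norm u' = 1" "norm v' = 1" "norm x' = 1" "norm y' = 1"
  shows "cinner u' x' = cinner v' y'"
proof -
  have "star_le (\<phi> (atom s u v)) (\<phi> C)" "star_le (\<phi> (atom s x y)) (\<phi> C)"
    using C le_iff is_atom_in_type_1_ops is_atom_atom s by blast+
  then show ?thesis
    using common_upper_bound_cinner(1)[OF type_1_ops_bounded[OF in_type_1[OF C(1)]] img(3-5) img(3,6,7)]
    unfolding img by blast
qed

text \<open>The two alternatives of the theorem are distinguished by whether \<open>\<phi>\<close> respects or
  exchanges the two components of a pair of rays.\<close>

definition straight :: bool where
  "straight \<longleftrightarrow> (\<forall>p\<in>unit_pairs. \<forall>q\<in>unit_pairs.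
     (row p q \<longrightarrow> row (g 1 p) (g 1 q)) \<and> (col p q \<longrightarrow> col (g 1 p) (g 1 q)))"

text \<open>The chosen value of \<open>g\<close> fixes the image atom only up to a common phase, so
  every other representation of that atom has the same rays.\<close>

lemma image_atom_1:
  assumes "norm u = 1" "norm v = 1" "0 < t" "norm x = 1" "norm y = 1" "\<phi> (atom 1 u v) = atom t x y"
  shows "row (g 1 (u, v)) (x, y) \<and> col (g 1 (u, v)) (x, y)"
proof -
  have p: "(u, v) \<in> unit_pairs" using assms by (simp add: unit_pairs_def)
  have "atom (f 1) (fst (g 1 (u, v))) (snd (g 1 (u, v))) = atom t x y"
    using image_atom[OF _ p, of 1] assms by simp
  moreover have "norm (fst (g 1 (u, v))) = 1" "norm (snd (g 1 (u, v))) = 1"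
    using g_in_unit_pairs[OF _ p, of 1] by (auto simp: unit_pairs_def)
  ultimately obtain c where "cmod c = 1" "x = c *\<^sub>C fst (g 1 (u, v))" "y = c *\<^sub>C snd (g 1 (u, v))"
    using atom_eq_atomD[OF f_pos[of 1] _ _ assms(3-5)] by (metis zero_less_one)
  then show ?thesis by (auto simp: row_def col_def para_def)
qed

lemma swap_automorphism: "star_automorphism (\<lambda>A. \<phi> (cadjoint A))"
proof
  show "\<not> (\<exists>B :: 'a set. finite B \<and> complex_vector.span B = UNIV)" by (rule inf)
  have "bij_betw cadjoint type_1_ops (type_1_ops :: ('a \<Rightarrow> 'a) set)"
    by (rule bij_betw_byWitness[where f'=cadjoint])
      (auto simp: cadjoint_in_type_1_ops type_1_ops_bounded)
  from bij_betw_trans[OF this bij]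
  have "bij_betw (\<lambda>A. \<phi> (cadjoint A)) type_1_ops type_1_ops" by (simp add: o_def)
  then show "star_order_automorphism (\<lambda>A. \<phi> (cadjoint A))"
    unfolding star_order_automorphism_def
    by (simp add: le_iff star_le_cadjoint_iff type_1_ops_bounded cadjoint_in_type_1_ops)
qed

text \<open>Composing with the adjoint exchanges the components of atoms, so the exchanging case of
  \<open>rows_and_columns\<close> becomes the straight one. The chosen maps \<open>g\<close> and
  \<open>swap.g\<close> are comparable only up to phases.\<close>

lemma straight_or_swap_straight:
  "straight \<or> star_automorphism.straight (\<lambda>A. \<phi> (cadjoint A))"
  using rows_and_columns
proof
  assume "\<forall>p\<in>unit_pairs. \<forall>q\<in>unit_pairs.
    (row p q \<longrightarrow> row (g 1 p) (g 1 q)) \<and> (col p q \<longrightarrow> col (g 1 p) (g 1 q))"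
  then show ?thesis unfolding straight_def ..
next
  assume *: "\<forall>p\<in>unit_pairs. \<forall>q\<in>unit_pairs.
    (row p q \<longrightarrow> col (g 1 p) (g 1 q)) \<and> (col p q \<longrightarrow> row (g 1 p) (g 1 q))"
  interpret swap: star_automorphism "\<lambda>A. \<phi> (cadjoint A)" by (rule swap_automorphism)
  have rel: "row (g 1 (prod.swap p)) (swap.g 1 p)" "col (g 1 (prod.swap p)) (swap.g 1 p)"
    if p: "p \<in> unit_pairs" for p
  proof -
    have n: "norm (snd p) = 1" "norm (fst p) = 1" using p by (auto simp: unit_pairs_def)
    have gn: "norm (fst (swap.g 1 p)) = 1" "norm (snd (swap.g 1 p)) = 1"
      using swap.g_in_unit_pairs[OF zero_less_one p] by (auto simp: unit_pairs_def)
    have "\<phi> (atom 1 (snd p) (fst p)) = atom (swap.f 1) (fst (swap.g 1 p)) (snd (swap.g 1 p))"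
      using swap.image_atom[OF zero_less_one p] by (simp only: cadjoint_atom)
    from image_atom_1[OF n swap.f_pos[OF zero_less_one] gn this]
    show "row (g 1 (prod.swap p)) (swap.g 1 p)" "col (g 1 (prod.swap p)) (swap.g 1 p)"
      by (simp_all only: prod.collapse prod.swap_def)
  qed
  have "swap.straight"
    unfolding swap.straight_def
  proof (intro ballI conjI impI)
    fix p q :: "'a \<times> 'a" assume pq: "p \<in> unit_pairs" "q \<in> unit_pairs"
    show "row (swap.g 1 p) (swap.g 1 q)" if "row p q"
    proof -
      have "row (g 1 (prod.swap p)) (g 1 (prod.swap q))" using * pq that by simp
      from row_trans[OF row_sym[OF rel(1)[OF pq(1)]] row_trans[OF this rel(1)[OF pq(2)]]]
      show ?thesis .
    qed
    show "col (swap.g 1 p) (swap.g 1 q)" if "col p q"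
    proof -
      have "col (g 1 (prod.swap p)) (g 1 (prod.swap q))" using * pq that by simp
      from col_trans[OF col_sym[OF rel(2)[OF pq(1)]] col_trans[OF this rel(2)[OF pq(2)]]]
      show ?thesis .
    qed
  qed
  then show ?thesis ..
qed

end

section \<open>Unitary and antiunitary implementation\<close>

lemma semi_unitary_cases: "semi_unitary \<sigma> S \<Longrightarrow> \<sigma> = id \<or> \<sigma> = cnj"
  and semi_unitary_add: "semi_unitary \<sigma> S \<Longrightarrow> S (x + y) = S x + S y"
  and semi_unitary_scaleC: "semi_unitary \<sigma> S \<Longrightarrow> S (c *\<^sub>C x) = \<sigma> c *\<^sub>C S x"
  and semi_unitary_cinner: "semi_unitary \<sigma> S \<Longrightarrow> cinner (S x) (S y) = \<sigma> (cinner x y)"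
  and semi_unitary_surj: "semi_unitary \<sigma> S \<Longrightarrow> surj S"
  unfolding semi_unitary_def by blast+

lemma semi_unitary_conj:
  assumes "semi_unitary \<sigma> S"
  shows "\<sigma> (\<sigma> c) = c" "cmod (\<sigma> c) = cmod c" "\<sigma> (c * d) = \<sigma> c * \<sigma> d" "\<sigma> (of_real r) = of_real r"
    "\<sigma> (cnj c) = cnj (\<sigma> c)"
  using semi_unitary_cases[OF assms] by auto

lemma semi_unitary_norm:
  assumes S: "semi_unitary \<sigma> S" shows "norm (S x) = norm x"
proof (rule norm_eq_if_cinner_self_eq)
  have "cinner (S x) (S x) = \<sigma> (cinner x x)" using S by (rule semi_unitary_cinner)
  also have "\<dots> = cinner x x" unfolding cinner_self by (rule semi_unitary_conj(4)[OF S])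
  finally show "cinner (S x) (S x) = cinner x x" .
qed

lemma semi_unitary_scaleR: "semi_unitary \<sigma> S \<Longrightarrow> S (r *\<^sub>R x) = r *\<^sub>R S x"
  by (simp add: scaleR_scaleC semi_unitary_scaleC semi_unitary_conj)

lemma semi_unitary_bounded_linear: "semi_unitary \<sigma> S \<Longrightarrow> bounded_linear S"
  by (rule bounded_linear_intro[where K=1]) (simp_all add: semi_unitary_add semi_unitary_scaleR semi_unitary_norm)

lemma semi_unitary_inj: "semi_unitary \<sigma> S \<Longrightarrow> inj S"
proof (rule injI)
  fix x y assume S: "semi_unitary \<sigma> S" and "S x = S y"
  interpret bounded_linear S using S by (rule semi_unitary_bounded_linear)
  have "norm (S (x - y)) = 0" using \<open>S x = S y\<close> by (simp add: diff)
  then show "x = y" by (simp add: semi_unitary_norm[OF S])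
qed

lemma semi_unitary_inv_apply:
  assumes "semi_unitary \<sigma> S" shows "S (inv S x) = x" "inv S (S x) = x"
  using semi_unitary_surj[OF assms] semi_unitary_inj[OF assms] by (simp_all add: surj_f_inv_f)

lemma semi_unitary_inv:
  assumes S: "semi_unitary \<sigma> S" shows "semi_unitary \<sigma> (inv S)"
  unfolding semi_unitary_def
proof (intro conjI allI)
  note inv = semi_unitary_inv_apply[OF S]
  show "\<sigma> = id \<or> \<sigma> = cnj" using S by (rule semi_unitary_cases)
  show "inv S (x + y) = inv S x + inv S y" for x y
    using inv(2)[of "inv S x + inv S y"] by (simp add: semi_unitary_add[OF S] inv)
  show "inv S (c *\<^sub>C x) = \<sigma> c *\<^sub>C inv S x" for c x
    using inv(2)[of "\<sigma> c *\<^sub>C inv S x"] by (simp add: semi_unitary_scaleC[OF S] semi_unitary_conj[OF S] inv)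
  show "cinner (inv S x) (inv S y) = \<sigma> (cinner x y)" for x y
    using semi_unitary_cinner[OF S, of "inv S x" "inv S y"] by (simp add: semi_unitary_conj[OF S] inv)
  show "surj (inv S)" using inv(2) by (rule surjI)
qed

lemma semi_unitary_cinner_inv:
  assumes S: "semi_unitary \<sigma> S" shows "cinner (S x) y = \<sigma> (cinner x (inv S y))"
  using semi_unitary_cinner[OF S, of x "inv S y"] by (simp add: semi_unitary_inv_apply[OF S])

lemma unitary_op_if_semi_unitary:
  assumes S: "semi_unitary id S" shows "unitary_op S"
proof -
  have B: "S \<in> bounded_ops"
    by (rule bounded_opsI[where K=1]) (simp_all add: semi_unitary_add[OF S] semi_unitary_scaleC[OF S] semi_unitary_norm[OF S])
  have "cadjoint S = inv S"
    using semi_unitary_cinner_inv[OF S] by (intro cadjoint_eqI[OF B]) simp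
  then show ?thesis
    using B by (simp add: unitary_op_def fun_eq_iff semi_unitary_inv_apply[OF S])
qed

lemma antiunitary_op_if_semi_unitary:
  assumes S: "semi_unitary cnj S" shows "antiunitary_op S"
  unfolding antiunitary_op_def
  using semi_unitary_add[OF S] semi_unitary_scaleC[OF S] semi_unitary_norm[OF S] semi_unitary_surj[OF S] by blast

text \<open>With the same \<open>\<sigma>\<close> on both sides the conjugations cancel, so the
  composition is complex linear even for antiunitary factors.\<close>

lemma semi_unitary_conjugate:
  assumes S: "semi_unitary \<sigma> S" and T: "semi_unitary \<sigma> T" and W: "W \<in> bounded_ops"
  shows "(\<lambda>x. S (W (inv T x))) \<in> bounded_ops"
    "cadjoint (\<lambda>x. S (W (inv T x))) = (\<lambda>x. T (cadjoint W (inv S x)))"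
proof -
  note T' = semi_unitary_inv[OF T]
  obtain K where K: "\<And>x. norm (W x) \<le> norm x * K" using bounded_ops_norm_le[OF W] by metis
  show B: "(\<lambda>x. S (W (inv T x))) \<in> bounded_ops"
  proof (rule bounded_opsI[where K=K])
    show "norm (S (W (inv T x))) \<le> norm x * K" for x
      using K[of "inv T x"] by (simp add: semi_unitary_norm[OF S] semi_unitary_norm[OF T'])
  qed (simp_all add: semi_unitary_add[OF S] semi_unitary_add[OF T'] semi_unitary_scaleC[OF S]
      semi_unitary_scaleC[OF T'] semi_unitary_conj[OF S] bounded_ops_linear[OF W])
  show "cadjoint (\<lambda>x. S (W (inv T x))) = (\<lambda>x. T (cadjoint W (inv S x)))"
  proof (rule cadjoint_eqI[OF B])
    fix x y
    have "cinner (S (W (inv T x))) y = \<sigma> (cinner (inv T x) (cadjoint W (inv S y)))"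
      by (simp add: semi_unitary_cinner_inv[OF S] cinner_cadjoint_right[OF W])
    also have "\<dots> = cinner (T (inv T x)) (T (cadjoint W (inv S y)))"
      by (simp only: semi_unitary_cinner[OF T])
    finally show "cinner (S (W (inv T x))) y = cinner x (T (cadjoint W (inv S y)))"
      by (simp add: semi_unitary_inv_apply[OF T])
  qed
qed

section \<open>Splitting a pair map into two maps of rays\<close>

locale straight_pair_map = pair_map +
  assumes g_row: "p \<in> unit_pairs \<Longrightarrow> q \<in> unit_pairs \<Longrightarrow> row p q \<Longrightarrow> row (g p) (g q)"
    and g_col: "p \<in> unit_pairs \<Longrightarrow> q \<in> unit_pairs \<Longrightarrow> col p q \<Longrightarrow> col (g p) (g q)"
begin

text \<open>Exchanging the second component of \<open>q\<close> for a vector orthogonal to that of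
  \<open>p\<close> makes the pairs orthogonal and stays in the row of \<open>q\<close>, hence keeps
  the first ray of the image.\<close>

lemma fst_orth:
  assumes p: "p \<in> unit_pairs" and q: "q \<in> unit_pairs" and o: "cinner (fst p) (fst q) = 0"
  shows "cinner (fst (g p)) (fst (g q)) = 0"
proof -
  obtain z where z: "norm z = 1" "cinner z (snd p) = 0" using ex_unit_orth2[OF inf] by blast
  have r: "(fst q, z) \<in> unit_pairs" using q z by (simp add: unit_pairs_def)
  have "cinner (snd p) z = 0" using z cinner_eq_0_commute by blast
  then have "orthp (g p) (g (fst q, z))" using g_orthp[OF p r] o by (simp add: orthp_def)
  moreover have "row (g q) (g (fst q, z))" using g_row[OF q r] by (simp add: row_def para_refl)
  ultimately show ?thesis unfolding orthp_def row_def using para_orth_right by blast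
qed

lemma swap: "straight_pair_map (\<lambda>p. prod.swap (g (prod.swap p)))"
proof
  show "\<not> (\<exists>B :: 'a set. finite B \<and> complex_vector.span B = UNIV)" by (rule inf)
  show "\<exists>p\<in>unit_pairs. row (prod.swap (g (prod.swap p))) q \<and> col (prod.swap (g (prod.swap p))) q"
    if "q \<in> unit_pairs" for q
  proof -
    have "prod.swap q \<in> unit_pairs" using that by simp
    then obtain p where p: "p \<in> unit_pairs" "row (g p) (prod.swap q)" "col (g p) (prod.swap q)"
      using g_onto by blast
    then have "row (prod.swap (g p)) (prod.swap (prod.swap q))" "col (prod.swap (g p)) (prod.swap (prod.swap q))"
      by (simp_all only: row_swap col_swap)
    then show ?thesis using p(1) by (intro bexI[of _ "prod.swap p"]) simp_all
  qed
qed (simp_all add: g_unit g_orthp g_row g_col)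

text \<open>For the converse, \<open>fst_orth\<close> of the swapped map makes the second components
  of the images orthogonal, so orthogonality of whole pairs can be pulled back.\<close>

lemma fst_orth_iff:
  assumes p: "p \<in> unit_pairs" and q: "q \<in> unit_pairs"
  shows "cinner (fst (g p)) (fst (g q)) = 0 \<longleftrightarrow> cinner (fst p) (fst q) = 0"
proof
  assume o: "cinner (fst (g p)) (fst (g q)) = 0"
  obtain z where z: "norm z = 1" "cinner z (snd p) = 0" using ex_unit_orth2[OF inf] by blast
  have r: "(fst q, z) \<in> unit_pairs" using q z by (simp add: unit_pairs_def)
  have "cinner (snd p) z = 0" using z cinner_eq_0_commute by blast
  then have "cinner (snd (g p)) (snd (g (fst q, z))) = 0"
    using straight_pair_map.fst_orth[OF swap, of "prod.swap p" "prod.swap (fst q, z)"] p r by (simp add: unit_pairs_def)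
  moreover have "row (g q) (g (fst q, z))" using g_row[OF q r] by (simp add: row_def para_refl)
  then have "cinner (fst (g p)) (fst (g (fst q, z))) = 0"
    using o para_orth_right unfolding row_def by blast
  ultimately have "orthp (g p) (g (fst q, z))" by (simp add: orthp_def)
  then show "cinner (fst p) (fst q) = 0" using g_orthp[OF p r] by (simp add: orthp_def)
qed (rule fst_orth[OF p q])

text \<open>Freezing the second component at \<open>e\<close> produces a ray map; as
  \<open>g\<close> respects rows, its rays agree with the first rays of all images.\<close>

lemma ex_semi_unitary_fst:
  obtains \<sigma> S where "semi_unitary \<sigma> S" "\<And>p. p \<in> unit_pairs \<Longrightarrow> para (fst (g p)) (S (fst p))"
proof -
  obtain e :: 'a where e: "norm e = 1" using ex_unit_orth2[OF inf] by blast
  define N where "N x = (inverse (norm x) *\<^sub>R x, e)" for x :: 'a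
  have N: "N x \<in> unit_pairs" if "x \<noteq> 0" for x using that e by (simp add: N_def unit_pairs_def)
  define F where "F x = fst (g (N x))" for x
  have norm_F: "norm (F x) = 1" if "x \<noteq> 0" for x
    using g_unit[OF N[OF that]] by (simp add: F_def unit_pairs_def)
  interpret ray_map F
  proof
    show "\<not> (\<exists>B :: 'a set. finite B \<and> complex_vector.span B = UNIV)" by (rule inf)
    show "F x \<noteq> 0" if "x \<noteq> 0" for x using norm_F[OF that] by auto
    show "cinner (F x) (F y) = 0 \<longleftrightarrow> cinner x y = 0" if "x \<noteq> 0" "y \<noteq> 0" for x y
      using fst_orth_iff[OF N[OF that(1)] N[OF that(2)]] that
      by (simp add: F_def N_def cinner_algebra)
    show "\<exists>x c. x \<noteq> 0 \<and> y = c *\<^sub>C F x" if "y \<noteq> 0" for y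
    proof -
      from g_onto[OF N[OF that]] obtain p where p: "p \<in> unit_pairs" "row (g p) (N y)" by blast
      have x: "norm (fst p) = 1" using p by (simp add: unit_pairs_def)
      then have x0: "fst p \<noteq> 0" by auto
      have "row (N (fst p)) p" using x by (simp add: N_def row_def para_refl)
      then have "row (g (N (fst p))) (N y)" using g_row[OF N[OF x0] p(1)] p(2) row_trans by blast
      then obtain c where "inverse (norm y) *\<^sub>R y = c *\<^sub>C F (fst p)"
        by (auto simp: row_def para_def F_def N_def)
      then have "norm y *\<^sub>R (inverse (norm y) *\<^sub>R y) = norm y *\<^sub>R (c *\<^sub>C F (fst p))" by simp
      then have "y = (of_real (norm y) * c) *\<^sub>C F (fst p)" using that by (simp add: scaleR_scaleC)
      then show ?thesis using x0 by blast
    qed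
  qed
  obtain \<sigma> S where S: "semi_unitary \<sigma> S" "\<And>x. x \<noteq> 0 \<Longrightarrow> \<exists>c. S x = c *\<^sub>C F x"
    using ex_semi_unitary by blast
  have "para (fst (g p)) (S (fst p))" if p: "p \<in> unit_pairs" for p
  proof -
    have x: "norm (fst p) = 1" using p by (simp add: unit_pairs_def)
    then have x0: "fst p \<noteq> 0" by auto
    have "row p (N (fst p))" using x by (simp add: N_def row_def para_refl)
    then have 1: "para (fst (g p)) (F (fst p))" using g_row[OF p N[OF x0]] by (simp add: row_def F_def)
    obtain c where c: "S (fst p) = c *\<^sub>C F (fst p)" using S(2)[OF x0] by blast
    have "norm (S (fst p)) = 1" using x semi_unitary_norm[OF S(1)] by simp
    from para_if_multiple[OF norm_F[OF x0] this c] show ?thesis using 1 para_trans by blast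
  qed
  then show thesis using S(1) that by blast
qed

end

lemma (in straight_pair_map) ex_semi_unitary_snd:
  obtains \<tau> T where "semi_unitary \<tau> T" "\<And>p. p \<in> unit_pairs \<Longrightarrow> para (snd (g p)) (T (snd p))"
proof -
  interpret swap: straight_pair_map "\<lambda>p. prod.swap (g (prod.swap p))" by (rule swap)
  obtain \<tau> T where T: "semi_unitary \<tau> T"
    "\<And>p. p \<in> unit_pairs \<Longrightarrow> para (fst (prod.swap (g (prod.swap p)))) (T (fst p))"
    using swap.ex_semi_unitary_fst by blast
  have "para (snd (g p)) (T (snd p))" if "p \<in> unit_pairs" for p
    using T(2)[of "prod.swap p"] that by simp
  then show thesis using that T(1) by blast
qed

section \<open>The form of an automorphism\<close>

text \<open>Otherwise a diagonal operator with scales from \<open>X\<close> would be bounded, while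
  its image lies above atoms of arbitrarily large scale.\<close>

lemma (in star_automorphism) f_bounded:
  assumes X: "X \<subseteq> {0<..}" "bounded X"
  shows "bounded (f ` X)"
proof (rule ccontr)
  assume nb: "\<not> bounded (f ` X)"
  have ex: "\<exists>x\<in>X. r < f x" for r
  proof (rule ccontr)
    assume "\<not> (\<exists>x\<in>X. r < f x)"
    then have "\<forall>y\<in>f ` X. norm y \<le> r" using f_pos X(1) by (force simp: not_less)
    then show False using nb unfolding bounded_iff by blast
  qed
  \<comment> \<open>Strict growth of \<open>f (s n)\<close> makes the scales \<open>s n\<close>
    pairwise distinct, as a Penrose decomposition demands.\<close>
  have "\<exists>s. \<forall>n::nat. (s n \<in> X \<and> real n < f (s n)) \<and> f (s n) < f (s (Suc n))"
  proof (rule dependent_nat_choice)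
    show "\<exists>x. x \<in> X \<and> real 0 < f x" using ex by auto
    show "\<exists>y. (y \<in> X \<and> real (Suc n) < f y) \<and> f x < f y" for x n
      using ex[of "max (real (Suc n)) (f x)"] by auto
  qed
  then obtain s where s: "\<And>n::nat. s n \<in> X" "\<And>n. real n < f (s n)" "\<And>n. f (s n) < f (s (Suc n))" by blast
  have spos: "0 < s n" for n using s(1) X(1) by blast
  have "strict_mono (\<lambda>n. f (s n))" using s(3) by (simp add: strict_mono_Suc_iff)
  then have inj_s: "inj s" by (metis injI strict_mono_eq)
  obtain K where K: "\<And>x. x \<in> X \<Longrightarrow> norm x \<le> K" using X(2) unfolding bounded_iff by blast
  obtain e :: "nat \<Rightarrow> 'a" where e: "\<And>n. norm (e n) = 1" "\<And>m n. m \<noteq> n \<Longrightarrow> cinner (e m) (e n) = 0"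
    using ex_orthonormal_sequence[OF inf] by blast
  define U where "U n = atom 1 (e n) (e n)" for n
  interpret orthogonal_partial_isometries UNIV U
  proof
    show "partial_isometry (U n)" for n
      unfolding U_def partial_isometry_iff[OF atom_in_bounded_ops]
      by (simp add: atom_apply cinner_algebra cinner_self_unit e)
    show "pairwise (\<lambda>i j. orthogonal_ops (U i) (U j)) UNIV"
      using e(2) by (auto simp: pairwise_def orthogonal_ops_def U_def fun_eq_iff atom_apply cinner_algebra)
  qed
  have sK: "cmod (of_real (s n)) \<le> K" for n using K[OF s(1)[of n]] by simp
  have K0: "0 \<le> K" using sK[of 0] norm_ge_zero order_trans by blast
  obtain B where B: "has_sot_sum (\<lambda>n x. of_real (s n) *\<^sub>C U n x) B UNIV"
    using ex_sot_sum[of "\<lambda>n. of_real (s n)" K] sK K0 by blast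
  have U0: "U n \<noteq> (\<lambda>_. 0)" for n
    unfolding U_def by (rule atom_nonzero) (simp add: is_atom_atom e)
  have "penrose_decomposition B UNIV s U"
    unfolding penrose_decomposition_def using piso U0 orth spos inj_s B by (simp add: scaleR_scaleC)
  then interpret penrose B UNIV s U by unfold_locales
  obtain K' where K': "\<And>x. norm (\<phi> B x) \<le> norm x * K'"
    using bounded_ops_norm_le[OF type_1_ops_bounded[OF in_type_1[OF type_1]]] by metis
  have "f (s n) \<le> K'" for n
  proof -
    have p: "(e n, e n) \<in> unit_pairs" using e by (simp add: unit_pairs_def)
    have gp: "norm (fst (g (s n) (e n, e n))) = 1" "norm (snd (g (s n) (e n, e n))) = 1"
      using g_in_unit_pairs[OF spos p] by (auto simp: unit_pairs_def)
    have "star_le (atom (s n) (e n) (e n)) B"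
      unfolding atom_le_iff_component[OF spos e(1) e(1)]
      by (intro bexI[of _ n]) (simp_all add: U_def atom_apply cinner_self_unit e)
    then have "star_le (\<phi> (atom (s n) (e n) (e n))) (\<phi> B)"
      using le_iff type_1 is_atom_in_type_1_ops is_atom_atom spos e by blast
    then have "\<phi> B (snd (g (s n) (e n, e n))) = f (s n) *\<^sub>R fst (g (s n) (e n, e n))"
      using image_atom[OF spos p] atom_le_iff[OF f_pos[OF spos] gp type_1_ops_bounded[OF in_type_1[OF type_1]]]
      by simp
    then show ?thesis using K'[of "snd (g (s n) (e n, e n))"] gp f_pos[OF spos, of n] by simp
  qed
  moreover obtain n :: nat where "K' < n" using reals_Archimedean2 by blast
  ultimately show False using s(2)[of n] by (meson less_le_not_le order_trans less_imp_le not_less)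
qed

section \<open>Phases and the image of a general operator\<close>

locale straight_automorphism = star_automorphism +
  assumes straight: straight
begin

sublocale straight_pair_map "g 1"
  by unfold_locales (use straight in \<open>auto simp: straight_def\<close>)

text \<open>Moving phases to the first factor leaves one phase \<open>l s u v\<close> per atom.
  Atoms of equal scale with a common bound keep matching inner products, which makes this phase
  constant in \<open>u\<close> and \<open>v\<close>.\<close>

lemma image_atom_phase:
  obtains \<sigma> S T \<mu> where "semi_unitary \<sigma> S" "semi_unitary \<sigma> T" "\<And>s. 0 < s \<Longrightarrow> cmod (\<mu> s) = 1"
    "\<And>s u v. 0 < s \<Longrightarrow> norm u = 1 \<Longrightarrow> norm v = 1 \<Longrightarrow> \<phi> (atom s u v) = atom (f s) (\<mu> s *\<^sub>C S u) (T v)"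
proof -
  obtain \<sigma> S where S: "semi_unitary \<sigma> S" "\<And>p. p \<in> unit_pairs \<Longrightarrow> para (fst (g 1 p)) (S (fst p))"
    using ex_semi_unitary_fst by blast
  obtain \<tau> T where T: "semi_unitary \<tau> T" "\<And>p. p \<in> unit_pairs \<Longrightarrow> para (snd (g 1 p)) (T (snd p))"
    using ex_semi_unitary_snd by blast
  note nS = semi_unitary_norm[OF S(1)] and nT = semi_unitary_norm[OF T(1)]
  have ex: "\<exists>l. cmod l = 1 \<and> \<phi> (atom s u v) = atom (f s) (l *\<^sub>C S u) (T v)"
    if s: "0 < s" and u: "norm u = 1" and v: "norm v = 1" for s u v
  proof -
    have p: "(u, v) \<in> unit_pairs" using u v by (simp add: unit_pairs_def)
    have gg: "row (g 1 (u, v)) (g s (u, v))" "col (g 1 (u, v)) (g s (u, v))"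
      using g_scale_independent[OF _ p s, of 1] by simp_all
    have "para (S u) (fst (g s (u, v)))" using S(2)[OF p] gg(1) para_sym para_trans unfolding row_def by fastforce
    then obtain c where c: "cmod c = 1" "fst (g s (u, v)) = c *\<^sub>C S u" by (auto simp: para_def)
    have "para (T v) (snd (g s (u, v)))" using T(2)[OF p] gg(2) para_sym para_trans unfolding col_def by fastforce
    then obtain d where d: "cmod d = 1" "snd (g s (u, v)) = d *\<^sub>C T v" by (auto simp: para_def)
    have d0: "d \<noteq> 0" using d by auto
    have "\<phi> (atom s u v) = atom (f s) (d *\<^sub>C ((c / d) *\<^sub>C S u)) (d *\<^sub>C T v)"
      using image_atom[OF s p] c d d0 by simp
    then have "\<phi> (atom s u v) = atom (f s) ((c / d) *\<^sub>C S u) (T v)" by (simp only: atom_phase[OF d(1)])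
    then show ?thesis using c d by (intro exI[of _ "c / d"]) (simp add: norm_divide)
  qed
  define l where "l s u v = (SOME l. cmod l = 1 \<and> \<phi> (atom s u v) = atom (f s) (l *\<^sub>C S u) (T v))" for s u v
  have l: "cmod (l s u v) = 1" "\<phi> (atom s u v) = atom (f s) (l s u v *\<^sub>C S u) (T v)"
    if "0 < s" "norm u = 1" "norm v = 1" for s u v
    using someI_ex[OF ex[OF that]] unfolding l_def by blast+
  \<comment> \<open>A real inner product is fixed by both \<open>\<sigma>\<close> and
    \<open>\<tau>\<close>, which are not yet known to coincide; being nonzero, it cancels and leaves
    equal phases.\<close>
  have compat: "l s u v = l s x y"
    if s: "0 < s" and n: "norm u = 1" "norm v = 1" "norm x = 1" "norm y = 1"
      and C: "C \<in> type_1_ops" "star_le (atom s u v) C" "star_le (atom s x y) C"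
      and ip: "cinner u x = of_real r" "cinner v y = of_real r" "r \<noteq> 0" for s u v x y C r
  proof -
    have "cinner (l s u v *\<^sub>C S u) (l s x y *\<^sub>C S x) = cinner (T v) (T y)"
      using s n l(1) nS nT
      by (intro compatible_image_cinner[OF s n C l(2)[OF s n(1,2)] l(2)[OF s n(3,4)] f_pos[OF s]]) simp_all
    then have "l s u v * cnj (l s x y) = 1"
      using ip by (simp add: cinner_algebra semi_unitary_cinner[OF S(1)] semi_unitary_cinner[OF T(1)]
          semi_unitary_conj(4)[OF S(1)] semi_unitary_conj(4)[OF T(1)] mult.commute)
    moreover have "l s x y * cnj (l s x y) = 1"
      using l(1)[OF s n(3,4)] by (simp flip: complex_norm_square)
    ultimately show ?thesis by (metis mult.commute mult_cancel_left zero_neq_one mult_zero_left)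
  qed
  have orth_l: "l s u v = l s x y"
    if s: "0 < s" and n: "norm u = 1" "norm v = 1" "norm x = 1" "norm y = 1"
      and o: "cinner u x = 0" "cinner v y = 0" for s u v x y
  proof -
    \<comment> \<open>Normalizes the sum of two orthonormal vectors; the inner products of the
      summands with \<open>w\<close> and \<open>z\<close> are then \<open>r\<close>, real and
      nonzero as \<open>compat\<close> requires.\<close>
    define r where "r = inverse (sqrt 2)"
    have r: "r \<noteq> 0" by (simp add: r_def)
    define C where "C z = atom s u v z + atom s x y z" for z
    have C: "C \<in> type_1_ops" "star_le (atom s u v) C" "star_le (atom s x y) C"
      using sum_of_orthogonal_atoms(1-3)[OF s n(1,2) s n(3,4) o] unfolding C_def by auto
    define w where "w = of_real r *\<^sub>C u + of_real r *\<^sub>C x"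
    define z where "z = of_real r *\<^sub>C v + of_real r *\<^sub>C y"
    have o': "cinner x u = 0" "cinner y v = 0" using o cinner_eq_0_commute by auto
    have "(norm z)\<^sup>2 = r\<^sup>2 + r\<^sup>2"
      unfolding z_def norm_add_power2 using n o by (simp add: cinner_algebra)
    also have "\<dots> = 1" by (simp add: r_def power_inverse)
    finally have nz: "norm z = 1" using norm_ge_zero[of z] by (auto simp: power2_eq_1_iff)
    note wz = combined_atom_le[OF type_1_ops_bounded[OF C(1)] s n C(2,3) nz[unfolded z_def], folded z_def w_def]
    have "l s u v = l s w z"
      by (rule compat[OF s n(1,2) wz(1) nz C(1,2) wz(2) _ _ r])
        (simp_all add: w_def z_def cinner_algebra cinner_self_unit n o)
    moreover have "l s x y = l s w z"
      by (rule compat[OF s n(3,4) wz(1) nz C(1,3) wz(2) _ _ r])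
        (simp_all add: w_def z_def cinner_algebra cinner_self_unit n o')
    ultimately show ?thesis by simp
  qed
  obtain e :: 'a where e: "norm e = 1" using ex_unit_orth2[OF inf] by blast
  define \<mu> where "\<mu> s = l s e e" for s
  have l_const: "l s u v = \<mu> s" if s: "0 < s" and n: "norm u = 1" "norm v = 1" for s u v
  proof -
    obtain x where x: "norm x = 1" "cinner x u = 0" "cinner x e = 0" using ex_unit_orth2[OF inf] by blast
    obtain y where y: "norm y = 1" "cinner y v = 0" "cinner y e = 0" using ex_unit_orth2[OF inf] by blast
    have "l s x y = l s u v" using orth_l[OF s x(1) y(1) n] x y by blast
    moreover have "l s x y = l s e e" using orth_l[OF s x(1) y(1) e e] x y by blast
    ultimately show ?thesis by (simp add: \<mu>_def)
  qed
  have img: "\<phi> (atom s u v) = atom (f s) (\<mu> s *\<^sub>C S u) (T v)"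
    if "0 < s" "norm u = 1" "norm v = 1" for s u v
    using l(2)[OF that] l_const[OF that] by simp
  have \<mu>1: "cmod (\<mu> s) = 1" if "0 < s" for s using l(1)[OF that e e] by (simp add: \<mu>_def)
  \<comment> \<open>A common factor \<open>\<i>\<close> cancels inside an atom, so \<open>S\<close>
    and \<open>T\<close> must pull it out in the same way; its image tells \<open>id\<close> from
    \<open>cnj\<close>.\<close>
  have "\<sigma> \<i> = \<tau> \<i>"
  proof -
    have "atom (f 1) (\<mu> 1 *\<^sub>C S e) (T e) = \<phi> (atom 1 (\<i> *\<^sub>C e) (\<i> *\<^sub>C e))"
      using img[of 1 e e] e by (simp add: atom_phase)
    also have "\<dots> = atom (f 1) (\<mu> 1 *\<^sub>C S (\<i> *\<^sub>C e)) (T (\<i> *\<^sub>C e))" using e by (intro img) simp_all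
    finally have eq: "atom (f 1) (\<mu> 1 *\<^sub>C S e) (T e) =
      atom (f 1) (\<mu> 1 *\<^sub>C S (\<i> *\<^sub>C e)) (T (\<i> *\<^sub>C e))" .
    have "norm (\<mu> 1 *\<^sub>C S e) = 1" "norm (T e) = 1"
      "norm (\<mu> 1 *\<^sub>C S (\<i> *\<^sub>C e)) = 1" "norm (T (\<i> *\<^sub>C e)) = 1" "0 < f 1"
      using e \<mu>1[of 1] f_pos[of 1] nS nT by simp_all
    then obtain c where c: "\<mu> 1 *\<^sub>C S (\<i> *\<^sub>C e) = c *\<^sub>C \<mu> 1 *\<^sub>C S e" "T (\<i> *\<^sub>C e) = c *\<^sub>C T e"
      using atom_eq_atomD[OF _ _ _ _ _ _ eq] by metis
    have "S e \<noteq> 0" "T e \<noteq> 0" "\<mu> 1 \<noteq> 0" using nS[of e] nT[of e] e \<mu>1[of 1] by auto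
    then have "\<sigma> \<i> = c" "\<tau> \<i> = c"
      using c by (simp_all add: semi_unitary_scaleC[OF S(1)] semi_unitary_scaleC[OF T(1)])
    then show ?thesis by simp
  qed
  then have "\<sigma> = \<tau>" using semi_unitary_cases[OF S(1)] semi_unitary_cases[OF T(1)] by (auto simp: complex_eq_iff)
  then show thesis using that S(1) T(1) \<mu>1 img by blast
qed

text \<open>The candidate \<open>D\<close> has Penrose data with scales \<open>f (a j)\<close>, so
  the atoms below it are known and can be matched with the images of the atoms below
  \<open>A\<close>. The right factor is the inverse of the map acting on second components, since
  \<open>v\<close> enters an atom through an inner product.\<close>

lemma form:
  "\<exists>(h :: real \<Rightarrow> complex) (S :: 'a \<Rightarrow> 'a) (T :: 'a \<Rightarrow> 'a).
     (\<forall>X. X \<subseteq> {0<..} \<and> bounded X \<longrightarrow> bounded (h ` X)) \<and>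
     bij_betw (\<lambda>t. cmod (h t)) {0<..} {0<..} \<and>
     ((unitary_op S \<and> unitary_op T) \<or> (antiunitary_op S \<and> antiunitary_op T)) \<and>
     (\<forall>A\<in>type_1_ops. \<forall>(J :: real set) a U. penrose_decomposition A J a U \<longrightarrow>
        (\<exists>B. has_sot_sum (\<lambda>j x. h (a j) *\<^sub>C U j x) B J \<and> \<phi> A = (\<lambda>x. S (B (T x)))))"
proof -
  obtain \<sigma> S T \<mu> where S: "semi_unitary \<sigma> S" and T: "semi_unitary \<sigma> T"
    and \<mu>1: "\<And>s. 0 < s \<Longrightarrow> cmod (\<mu> s) = 1"
    and img: "\<And>s u v. 0 < s \<Longrightarrow> norm u = 1 \<Longrightarrow> norm v = 1 \<Longrightarrow> \<phi> (atom s u v) = atom (f s) (\<mu> s *\<^sub>C S u) (T v)"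
    using image_atom_phase by metis
  note T' = semi_unitary_inv[OF T]
  note cnjs = semi_unitary_conj[OF S]
  \<comment> \<open>\<open>\<sigma>\<close> is an involution, so the phase \<open>\<mu> s\<close> in
    front of \<open>S\<close> becomes \<open>c s\<close> inside it.\<close>
  define c where "c s = \<sigma> (\<mu> s)" for s
  define h where "h s = of_real (f s) * c s" for s
  have c1: "cmod (c s) = 1" if "0 < s" for s using \<mu>1[OF that] by (simp add: c_def cnjs)
  have h: "cmod (h s) = f s" if "0 < s" for s
    using c1[OF that] f_pos[OF that] by (simp add: h_def norm_mult)
  have h_bounded: "bounded (h ` X)" if X: "X \<subseteq> {0<..}" "bounded X" for X
  proof -
    obtain K where K: "\<And>x. x \<in> X \<Longrightarrow> norm (f x) \<le> K"
      using f_bounded[OF X] unfolding bounded_iff by auto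
    have "cmod (h x) \<le> K" if "x \<in> X" for x
    proof -
      have "0 < x" using that X(1) by auto
      then show ?thesis using K[OF that] f_pos h by simp
    qed
    then show ?thesis unfolding bounded_iff by blast
  qed
  have h_bij: "bij_betw (\<lambda>t. cmod (h t)) {0<..} {0<..}"
    using f_bij by (rule bij_betw_cong[THEN iffD2, rotated]) (simp add: h)
  have unitary: "(unitary_op S \<and> unitary_op (inv T)) \<or> (antiunitary_op S \<and> antiunitary_op (inv T))"
    using semi_unitary_cases[OF S] S T' unitary_op_if_semi_unitary antiunitary_op_if_semi_unitary by blast
  have "\<exists>B. has_sot_sum (\<lambda>j x. h (a j) *\<^sub>C U j x) B J \<and> \<phi> A = (\<lambda>x. S (B (inv T x)))"
    if pd: "penrose_decomposition A J a U" for A and J :: "real set" and a U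
  proof -
    interpret penrose A J a U using pd by unfold_locales
    obtain K where K: "0 < K" "\<And>j. j \<in> J \<Longrightarrow> a j \<le> K" using bounded_coeff by blast
    have "a ` J \<subseteq> {0<..}" using pos by auto
    moreover have "bounded (a ` J)"
      unfolding bounded_iff using K(2) pos less_imp_le by (intro exI[of _ K]) (auto simp: abs_of_pos)
    ultimately have "bounded (h ` a ` J)" by (rule h_bounded)
    then obtain M where M: "\<And>j. j \<in> J \<Longrightarrow> cmod (h (a j)) \<le> M" unfolding bounded_iff by auto
    have "cmod (h (a j)) \<le> max M 0" if "j \<in> J" for j using M[OF that] by simp
    then obtain B where B: "has_sot_sum (\<lambda>j x. h (a j) *\<^sub>C U j x) B J"
      using ex_sot_sum[of "\<lambda>j. h (a j)" "max M 0"] by auto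
    then have B': "B \<in> bounded_ops" and Bsum: "\<And>x. ((\<lambda>j. h (a j) *\<^sub>C U j x) has_sum B x) J"
      by (auto simp: has_sot_sum_def)
    define D where "D x = S (B (inv T x))" for x
    \<comment> \<open>The phases are absorbed into the partial isometries, which leaves positive
      coefficients \<open>f (a j)\<close>.\<close>
    define V where "V j x = S (c (a j) *\<^sub>C U j (inv T x))" for j x
    have ca: "cmod (c (a j)) = 1" if "j \<in> J" for j using c1 pos that by blast
    have cc: "c (a j) * cnj (c (a j)) = 1" if "j \<in> J" for j
      using ca[OF that] by (simp flip: complex_norm_square)
    have W: "(\<lambda>x. c (a j) *\<^sub>C U j x) \<in> bounded_ops" if "j \<in> J" for j using that by (simp add: scaleC_in_bounded_ops)
    have V: "V j \<in> bounded_ops" if "j \<in> J" for j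
      unfolding V_def using semi_unitary_conjugate(1)[OF S T W[OF that]] .
    have Vadj: "cadjoint (V j) = (\<lambda>x. T (cnj (c (a j)) *\<^sub>C cadjoint (U j) (inv S x)))" if "j \<in> J" for j
      unfolding V_def semi_unitary_conjugate(2)[OF S T W[OF that]] using that by (simp add: cadjoint_scaleC)
    note inv = semi_unitary_inv_apply[OF S] semi_unitary_inv_apply[OF T]
    have S0: "S 0 = 0" "T 0 = 0" using semi_unitary_scaleC[OF S, of 0 0] semi_unitary_scaleC[OF T, of 0 0]
      cnjs(4)[of 0] by simp_all
    have Vpi: "partial_isometry (V j)" if j: "j \<in> J" for j
      unfolding partial_isometry_iff[OF V[OF j]] Vadj[OF j]
      using j cc[OF j] by (simp add: V_def inv bounded_ops_linear cadjoint_in_bounded_ops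
          partial_isometry_cadjoint_apply[OF piso] mult.commute)
    have V0: "V j \<noteq> (\<lambda>_. 0)" if j: "j \<in> J" for j
    proof -
      obtain x where x: "U j x \<noteq> 0" using nonzero[OF j] by (auto simp: fun_eq_iff)
      have "norm (V j (T x)) = norm (U j x)" using ca[OF j] by (simp add: V_def inv semi_unitary_norm[OF S])
      then show ?thesis using x by auto
    qed
    have Vorth: "pairwise (\<lambda>i j. orthogonal_ops (V i) (V j)) J"
    proof (rule pairwiseI)
      fix i j assume ij: "i \<in> J" "j \<in> J" "i \<noteq> j"
      show "orthogonal_ops (V i) (V j)"
        unfolding orthogonal_ops_def Vadj[OF ij(1)] Vadj[OF ij(2)]
        using ij by (simp add: fun_eq_iff V_def inv bounded_ops_linear cadjoint_in_bounded_ops orth_apply S0)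
    qed
    have Vsum: "has_sot_sum (\<lambda>j x. (f \<circ> a) j *\<^sub>R V j x) D J"
      unfolding has_sot_sum_def
    proof (intro conjI allI)
      show "D \<in> bounded_ops" unfolding D_def by (rule semi_unitary_conjugate(1)[OF S T B'])
      fix x
      show "((\<lambda>j. (f \<circ> a) j *\<^sub>R V j x) has_sum D x) J"
        using has_sum_bounded_linear[OF semi_unitary_bounded_linear[OF S] Bsum[of "inv T x"]]
        by (simp add: D_def V_def h_def semi_unitary_scaleC[OF S] cnjs scaleR_scaleC)
    qed
    have "inj_on (f \<circ> a) J"
      using inj pos f_eq_iff by (auto simp: inj_on_def)
    then have pdD: "penrose_decomposition D J (f \<circ> a) V"
      unfolding penrose_decomposition_def using Vpi V0 Vorth Vsum f_pos pos by auto
    interpret D: penrose D J "f \<circ> a" V using pdD by unfold_locales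
    have "\<phi> A = D"
    proof (rule type_1_ops_eqI[OF in_type_1[OF type_1] D.type_1])
      fix R :: "'a \<Rightarrow> 'a" assume "is_atom R"
      then obtain P where P: "is_atom P" "\<phi> P = R" using atom_onto by blast
      obtain s u v where s: "0 < s" "norm u = 1" "norm v = 1" "P = atom s u v" using P(1) by (rule is_atomE)
      have R: "R = atom (f s) (\<mu> s *\<^sub>C S u) (T v)" using img[OF s(1-3)] P s by simp
      have n: "norm (\<mu> s *\<^sub>C S u) = 1" "norm (T v) = 1"
        using s \<mu>1[OF s(1)] by (simp_all add: semi_unitary_norm[OF S] semi_unitary_norm[OF T])
      have "star_le R (\<phi> A) \<longleftrightarrow> star_le P A"
        using le_iff[OF is_atom_in_type_1_ops[OF P(1)] type_1] P(2) by simp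
      also have "\<dots> \<longleftrightarrow> (\<exists>k\<in>J. a k = s \<and> U k v = u \<and> cadjoint (U k) u = v)"
        unfolding s(4) by (rule atom_le_iff_component[OF s(1-3)])
      also have "\<dots> \<longleftrightarrow> (\<exists>k\<in>J. (f \<circ> a) k = f s \<and> V k (T v) = \<mu> s *\<^sub>C S u \<and>
          cadjoint (V k) (\<mu> s *\<^sub>C S u) = T v)"
      proof (rule bex_cong[OF refl])
        fix k assume k: "k \<in> J"
        have 1: "(f \<circ> a) k = f s \<longleftrightarrow> a k = s" using f_eq_iff[OF pos[OF k] s(1)] by simp
        have 2: "V k (T v) = \<mu> s *\<^sub>C S u \<longleftrightarrow> U k v = u" if "a k = s"
        proof -
          have "V k (T v) = \<mu> s *\<^sub>C S (U k v)"
            by (simp add: V_def inv that semi_unitary_scaleC[OF S] c_def cnjs)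
          moreover have "\<mu> s \<noteq> 0" using \<mu>1[OF s(1)] by auto
          ultimately show ?thesis using semi_unitary_inj[OF S] by (simp add: inj_eq)
        qed
        have 3: "cadjoint (V k) (\<mu> s *\<^sub>C S u) = T v \<longleftrightarrow> cadjoint (U k) u = v" if "a k = s"
        proof -
          have "\<mu> s *\<^sub>C S u = S (c s *\<^sub>C u)" by (simp add: semi_unitary_scaleC[OF S] c_def cnjs)
          then have "cadjoint (V k) (\<mu> s *\<^sub>C S u) = T (cadjoint (U k) u)"
            using cc[OF k] k that by (simp add: Vadj inv bounded_ops_linear cadjoint_in_bounded_ops mult.commute)
          then show ?thesis using semi_unitary_inj[OF T] by (simp add: inj_eq)
        qed
        show "(a k = s \<and> U k v = u \<and> cadjoint (U k) u = v) \<longleftrightarrow>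
          ((f \<circ> a) k = f s \<and> V k (T v) = \<mu> s *\<^sub>C S u \<and> cadjoint (V k) (\<mu> s *\<^sub>C S u) = T v)"
          using 1 2 3 by blast
      qed
      also have "\<dots> \<longleftrightarrow> star_le R D"
        unfolding R by (rule D.atom_le_iff_component[OF f_pos[OF s(1)] n, symmetric])
      finally show "star_le R (\<phi> A) \<longleftrightarrow> star_le R D" .
    qed
    then have "\<phi> A = (\<lambda>x. S (B (inv T x)))" by (simp add: D_def fun_eq_iff)
    then show ?thesis using B by blast
  qed
  then show ?thesis using h_bounded h_bij unitary by blast
qed

end

theorem theorem3p7:
  fixes \<phi> :: "('a::complex_hilbert \<Rightarrow> 'a) \<Rightarrow> ('a \<Rightarrow> 'a)"
  assumes infinite_dim: "\<not> (\<exists>B :: 'a set. finite B \<and> complex_vector.span B = UNIV)"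
    and automorphism: "star_order_automorphism \<phi>"
  shows "\<phi> (\<lambda>_. 0) = (\<lambda>_. 0) \<and>
    (\<exists>(h :: real \<Rightarrow> complex) (\<alpha> :: real) (S :: 'a \<Rightarrow> 'a) (T :: 'a \<Rightarrow> 'a).
       (\<forall>X. X \<subseteq> {0<..} \<and> bounded X \<longrightarrow> bounded (h ` X)) \<and>
       bij_betw (\<lambda>t. cmod (h t)) {0<..} {0<..} \<and>
       0 < \<alpha> \<and>
       ((unitary_op S \<and> unitary_op T) \<or> (antiunitary_op S \<and> antiunitary_op T)) \<and>
       ((\<forall>A\<in>type_1_ops. \<forall>(J :: real set) a U. penrose_decomposition A J a U \<longrightarrow>
           (\<exists>B. has_sot_sum (\<lambda>j x. h (a j) *\<^sub>C U j x) B J \<and>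
                \<phi> A = (\<lambda>x. \<alpha> *\<^sub>R S (B (T x))))) \<or>
        (\<forall>A\<in>type_1_ops. \<forall>(J :: real set) a U. penrose_decomposition A J a U \<longrightarrow>
           (\<exists>B. has_sot_sum (\<lambda>j x. h (a j) *\<^sub>C cadjoint (U j) x) B J \<and>
                \<phi> A = (\<lambda>x. \<alpha> *\<^sub>R S (B (T x)))))))"
proof -
  interpret star_automorphism \<phi> using infinite_dim automorphism by unfold_locales
  from straight_or_swap_straight show ?thesis
  proof
    assume straight
    then interpret straight_automorphism \<phi> by unfold_locales
    from form obtain h S T where
      "\<forall>X. X \<subseteq> {0<..} \<and> bounded X \<longrightarrow> bounded (h ` X)" "bij_betw (\<lambda>t. cmod (h t)) {0<..} {0<..}"
      "(unitary_op S \<and> unitary_op T) \<or> (antiunitary_op S \<and> antiunitary_op T)"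
      "\<forall>A\<in>type_1_ops. \<forall>(J :: real set) a U. penrose_decomposition A J a U \<longrightarrow>
        (\<exists>B. has_sot_sum (\<lambda>j x. h (a j) *\<^sub>C U j x) B J \<and> \<phi> A = (\<lambda>x. S (B (T x))))"
      by blast
    \<comment> \<open>The modulus of \<open>h\<close> already carries the full scale, so the
      constant is 1.\<close>
    then show ?thesis
      by (intro conjI[OF zero] exI[of _ h] exI[of _ "1::real"] exI[of _ S] exI[of _ T]) simp
  next
    assume "star_automorphism.straight (\<lambda>A. \<phi> (cadjoint A))"
    then interpret swap: straight_automorphism "\<lambda>A. \<phi> (cadjoint A)"
      using swap_automorphism by (simp add: straight_automorphism_def straight_automorphism_axioms_def)
    from swap.form obtain h S T where h: "\<forall>X. X \<subseteq> {0<..} \<and> bounded X \<longrightarrow> bounded (h ` X)"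
      "bij_betw (\<lambda>t. cmod (h t)) {0<..} {0<..}"
      "(unitary_op S \<and> unitary_op T) \<or> (antiunitary_op S \<and> antiunitary_op T)" and
      form: "\<forall>A\<in>type_1_ops. \<forall>(J :: real set) a U. penrose_decomposition A J a U \<longrightarrow>
        (\<exists>B. has_sot_sum (\<lambda>j x. h (a j) *\<^sub>C U j x) B J \<and> \<phi> (cadjoint A) = (\<lambda>x. S (B (T x))))"
      by blast
    \<comment> \<open>The straight form is evaluated at the adjoint of \<open>A\<close>, whose
      Penrose components are the adjoints of the \<open>U j\<close> with the same coefficients; the
      double adjoint returns \<open>A\<close>.\<close>
    have "\<exists>B. has_sot_sum (\<lambda>j x. h (a j) *\<^sub>C cadjoint (U j) x) B J \<and> \<phi> A = (\<lambda>x. S (B (T x)))"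
      if "penrose_decomposition A J a U" for A and J :: "real set" and a U
    proof -
      interpret penrose A J a U using that by unfold_locales
      show ?thesis
        using form[rule_format, OF cadjoint_in_type_1_ops[OF type_1] penrose_cadjoint] by simp
    qed
    then show ?thesis
      using h by (intro conjI[OF zero] exI[of _ h] exI[of _ "1::real"] exI[of _ S] exI[of _ T]) simp
  qed
qed

end
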